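(* Let $X$ be a smooth, connected, quasi-projective variety over $\mathbb{C}$ of dimension $n$ embedded in $\mathbb{P}^N$, with $N=n+c$. For $k=k_1+\dots+k_r$ with integers $k_i>0$, let $H_{\{k_1,\dots,k_r\}}(X)$ be the Hilbert scheme of aligned, finite, degree $k$ subschemes of $X$ with multiplicities $k_i$ at points $x_i$ (possibly coinciding). Consider the natural projective line bundle $H_{\{k_1,\dots,k_r\}}(X)\times_G\mathcal{I}$ over $H_{\{k_1,\dots,k_r\}}(X)$ and the projection $$\theta_{\{k_1,\dots,k_r\}}: H_{\{k_1,\dots,k_r\}}(X)\times_G\mathcal{I}\to\mathcal{I}\to\mathbb{P}^N.$$ Then the general fibre of $\theta_{\{k_1,\dots,k_r\}}$ is smooth of pure dimension $N-1+r-kc$.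
   Context: The ground field is $\mathbb{C}$. $G=G(1,N)$ is the Grassmann variety of lines in $\mathbb{P}^N$, and $\mathcal{I}\subset G\times\mathbb{P}^N$ is the incidence variety of pairs (line, point lying on it); it is a projective line bundle over $G$. The empty set is considered to have every dimension. Definition of $H_{\{k_1,\dots,k_r\}}(X)$: for each value $m$ let $r_m=\#\{i:k_i=m\}$ and let $S=\prod_m\mathrm{Sym}^{r_m}(\mathcal{I}/G)$ (fibre product over $G$ of the relative symmetric products). $S$ parametrizes a line $L$ together with unordered families of points $x_i\in L$ weighted by the multiplicities $k_i$, and carries the universal relative effective divisor $Z=\sum_i k_ix_i$ of degree $k$ on $L$. $H_{\{k_1,\dots,k_r\}}(X)\subset S$ is the subscheme over which $Z$, as a subscheme of $\mathbb{P}^N$, is contained in $X$. If some of the points $x_i$ coincide, the multiplicity of $Z$ at the common point is the sum of the corresponding $k_i$. The map $H_{\{k_1,\dots,k_r\}}(X)\to G$ sends a point to the line $L$. *)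

theory Defs
  imports
    "HOL-Analysis.Analysis"
    "HOL-Algebra.Ideal"
    "HOL-Library.Poly_Mapping"
    "HOL-Library.Multiset"
begin

section \<open>Polynomial rings over the complex numbers\<close>

type_synonym 'v cpoly = "('v \<Rightarrow>\<^sub>0 nat) \<Rightarrow>\<^sub>0 complex"

definition Const :: "complex \<Rightarrow> 'v cpoly" where
  "Const c = Poly_Mapping.single 0 c"

definition Var :: "'v \<Rightarrow> 'v cpoly" where
  "Var v = Poly_Mapping.single (Poly_Mapping.single v 1) 1"

definition vars :: "'v cpoly \<Rightarrow> 'v set" where
  "vars p = (\<Union>m\<in>Poly_Mapping.keys p. Poly_Mapping.keys m)"

definition homogeneous :: "'v cpoly \<Rightarrow> bool" where
  "homogeneous p \<longleftrightarrow>
    (\<exists>d. \<forall>m\<in>Poly_Mapping.keys p. (\<Sum>v\<in>Poly_Mapping.keys m. Poly_Mapping.lookup m v) = d)"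

text \<open>Evaluation in an arbitrary commutative ring, with \<open>c\<close> giving its structure of
  complex algebra.\<close>

definition eval_in :: "(complex \<Rightarrow> 'a::comm_ring_1) \<Rightarrow> ('v \<Rightarrow> 'a) \<Rightarrow> 'v cpoly \<Rightarrow> 'a" where
  "eval_in c x p = (\<Sum>m\<in>Poly_Mapping.keys p. c (Poly_Mapping.lookup p m) *
     (\<Prod>v\<in>Poly_Mapping.keys m. x v ^ Poly_Mapping.lookup m v))"

definition value_at :: "('v \<Rightarrow> complex) \<Rightarrow> 'v cpoly \<Rightarrow> complex" where
  "value_at x p = eval_in (\<lambda>c. c) x p"

definition subst :: "('v \<Rightarrow> 'w cpoly) \<Rightarrow> 'v cpoly \<Rightarrow> 'w cpoly" where
  "subst x p = eval_in Const x p"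

definition poly_ring :: "'v set \<Rightarrow> 'v cpoly ring" where
  "poly_ring W = \<lparr>carrier = {p. vars p \<subseteq> W}, mult = (*), one = 1, zero = 0, add = (+)\<rparr>"

lemma cring_poly_ring:
  fixes W :: "'v set"
  shows "cring (poly_ring W)"
proof -
  have add: "vars (p + q) \<subseteq> W" if "vars p \<subseteq> W" "vars q \<subseteq> W" for p q :: "'v cpoly"
    using that Poly_Mapping.keys_add[of p q] unfolding vars_def by blast
  have mult: "vars (p * q) \<subseteq> W" if "vars p \<subseteq> W" "vars q \<subseteq> W" for p q :: "'v cpoly"
  proof
    fix v assume "v \<in> vars (p * q)"
    then obtain m where m: "m \<in> Poly_Mapping.keys (p * q)" "v \<in> Poly_Mapping.keys m"
      unfolding vars_def by blast
    then obtain a b where ab: "m = a + b" "a \<in> Poly_Mapping.keys p" "b \<in> Poly_Mapping.keys q"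
      using Poly_Mapping.keys_mult[of p q] by blast
    then have "v \<in> Poly_Mapping.keys a \<or> v \<in> Poly_Mapping.keys b"
      using m(2) Poly_Mapping.keys_add[of a b] by blast
    then show "v \<in> W"
      using ab that unfolding vars_def by blast
  qed
  have neg: "vars (- p) \<subseteq> W" if "vars p \<subseteq> W" for p :: "'v cpoly"
    using that by (simp add: vars_def in_keys_iff subset_iff Bex_def)
  have "abelian_group (poly_ring W)"
  proof (rule abelian_groupI)
    fix p assume "p \<in> carrier (poly_ring W)"
    then show "\<exists>q\<in>carrier (poly_ring W). q \<oplus>\<^bsub>poly_ring W\<^esub> p = \<zero>\<^bsub>poly_ring W\<^esub>"
      using neg[of p] by (intro bexI[of _ "- p"]) (auto simp: poly_ring_def)
  qed (use add in \<open>auto simp: poly_ring_def vars_def algebra_simps\<close>)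
  moreover have "comm_monoid (poly_ring W)"
    by (rule comm_monoidI)
      (use mult in \<open>auto simp: poly_ring_def vars_def algebra_simps\<close>)
  ultimately show ?thesis
    by (rule cringI) (simp add: poly_ring_def distrib_right)
qed


section \<open>Smoothness\<close>

text \<open>Let \<open>Y\<close> be the closed subscheme of the affine space with coordinates \<open>W\<close> defined by an
  ideal \<open>I\<close> of \<open>poly_ring W\<close>. Only the coordinates of \<open>x\<close> in \<open>W\<close> matter.\<close>

definition zero_of :: "'v cpoly set \<Rightarrow> ('v \<Rightarrow> complex) \<Rightarrow> bool" where
  "zero_of I x \<longleftrightarrow> (\<forall>f\<in>I. value_at x f = 0)"

text \<open>\<open>I\<close> and \<open>J\<close> generate the same ideal in the local ring of the affine space at \<open>x\<close>.\<close>

definition same_stalk :: "'v set \<Rightarrow> ('v \<Rightarrow> complex) \<Rightarrow> 'v cpoly set \<Rightarrow> 'v cpoly set \<Rightarrow> bool" where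
  "same_stalk W x I J \<longleftrightarrow>
    (\<forall>f\<in>I. \<exists>h\<in>carrier (poly_ring W). value_at x h \<noteq> 0 \<and> h * f \<in> J) \<and>
    (\<forall>f\<in>J. \<exists>h\<in>carrier (poly_ring W). value_at x h \<noteq> 0 \<and> h * f \<in> I)"

definition partial_deriv :: "'v \<Rightarrow> 'v cpoly \<Rightarrow> ('v \<Rightarrow> complex) \<Rightarrow> complex" where
  "partial_deriv w g x = deriv (\<lambda>z. value_at (x(w := z)) g) (x w)"

definition independent_differentials ::
    "'v set \<Rightarrow> ('v \<Rightarrow> complex) \<Rightarrow> 'v cpoly list \<Rightarrow> bool" where
  "independent_differentials W x gs \<longleftrightarrow>
    (\<forall>c :: nat \<Rightarrow> complex.
      (\<forall>w\<in>W. (\<Sum>a<length gs. c a * partial_deriv w (gs ! a) x) = 0)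
        \<longrightarrow> (\<forall>a<length gs. c a = 0))"

text \<open>\<open>Y\<close> is smooth of (relative) dimension \<open>d\<close> at its closed point \<open>x\<close>, as in Bosch,
  Luetkebohmert and Raynaud, Neron Models, 2.2: near \<open>x\<close>, the ideal is generated by
  \<open>card W - d\<close> functions whose differentials at \<open>x\<close> are linearly independent. The dimension is
  an integer, since an expected dimension may be negative (no scheme is smooth of negative
  dimension at a point).\<close>

definition smooth_at :: "'v set \<Rightarrow> 'v cpoly set \<Rightarrow> int \<Rightarrow> ('v \<Rightarrow> complex) \<Rightarrow> bool" where
  "smooth_at W I d x \<longleftrightarrow> zero_of I x \<and>
    (\<exists>gs. set gs \<subseteq> carrier (poly_ring W) \<and> int (length gs) = int (card W) - d \<and>
       same_stalk W x I (genideal (poly_ring W) (set gs)) \<and>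
       independent_differentials W x gs)"


section \<open>Subvarieties of projective space\<close>

text \<open>A finite type \<open>'i\<close> indexes the homogeneous coordinates, so \<open>CARD('i) = N + 1\<close>. A point of
  projective space is given by a nonzero vector, and a set of points by the set of all
  vectors representing them. The Zariski topology is pulled back to nonzero vectors, so that
  its open sets, and therefore its locally closed sets, are stable under nonzero scalars; lattice
  operations and connectedness are the same as in projective space.\<close>

definition zariski :: "('i::finite \<Rightarrow> complex) topology" where
  "zariski = topology_generated_by
     {{x. (\<exists>i. x i \<noteq> 0) \<and> value_at x g \<noteq> 0} | g. homogeneous g}"

definition quasi_projective :: "('i::finite \<Rightarrow> complex) set \<Rightarrow> bool" where
  "quasi_projective X \<longleftrightarrow>
    (\<exists>Y O'. closedin zariski Y \<and> openin zariski O' \<and> X = Y \<inter> O')"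

text \<open>The ideal, in the affine chart where the coordinate \<open>i\<close> is 1, of the closure of \<open>X\<close> in that
  chart. As \<open>X\<close> is open in its closure, this gives the reduced structure of \<open>X\<close> near each of
  its points.\<close>

definition chart_ideal :: "('i::finite \<Rightarrow> complex) set \<Rightarrow> 'i \<Rightarrow> 'i cpoly set" where
  "chart_ideal X i =
    {f \<in> carrier (poly_ring (UNIV - {i})). \<forall>x\<in>X. x i = 1 \<longrightarrow> value_at x f = 0}"

definition smooth_of_dim :: "('i::finite \<Rightarrow> complex) set \<Rightarrow> nat \<Rightarrow> bool" where
  "smooth_of_dim X n \<longleftrightarrow>
    (\<forall>i. \<forall>x\<in>X. x i = 1 \<longrightarrow> smooth_at (UNIV - {i}) (chart_ideal X i) (int n) x)"


section \<open>Aligned subschemes with prescribed multiplicities\<close>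

text \<open>The multiset \<open>K\<close> consists of the multiplicities \<open>k\<^sub>1, \<dots>, k\<^sub>r\<close>, so that \<open>r\<^sub>m\<close> is \<open>count K m\<close>.

  The scheme \<open>S = \<Prod>\<^sub>m Sym\<^bsup>r\<^sub>m\<^esup>(\<I>/G)\<close> over the Grassmannian \<open>G\<close> of lines is covered by affine
  spaces, one for each choice of distinct \<open>i\<close>, \<open>j\<close> and of numbers \<open>e m \<le> r\<^sub>m\<close>:

  \<^item> the lines not meeting \<open>x\<^sub>i = x\<^sub>j = 0\<close> form the standard affine chart of \<open>G\<close>; such a line is
    spanned by a unique pair \<open>u\<close>, \<open>v\<close> with \<open>(u\<^sub>i, u\<^sub>j) = (1, 0)\<close> and \<open>(v\<^sub>i, v\<^sub>j) = (0, 1)\<close>, and its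
    points are the \<open>s u + t v\<close>, with \<open>(s : t)\<close> in the projective line;
  \<^item> an unordered family of \<open>r\<^sub>m\<close> points of this line is an effective divisor of degree \<open>r\<^sub>m\<close>, the
    zero divisor of a nonzero binary form \<open>F\<^sub>m(s, t)\<close> of degree \<open>r\<^sub>m\<close>, unique up to a nonzero scalar
    (by the theorem on symmetric functions the \<open>r\<close>-th symmetric product of the projective line
    is the projective space of binary forms of degree \<open>r\<close>); the form is normalized by
    requiring the coefficient of \<open>s\<^bsup>e m\<^esup> t\<^bsup>r\<^sub>m - e m\<^esup>\<close> to be 1.

  The universal divisor \<open>Z = \<Sum> k\<^sub>i x\<^sub>i\<close> is then the zero divisor of \<open>\<Prod>\<^sub>m F\<^sub>m\<^bsup>m\<^esup>\<close>.\<close>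

datatype 'i coord =
    FrameU 'i | FrameV 'i \<comment> \<open>coordinates of \<open>u\<close> and \<open>v\<close>\<close>
  | FormCoeff nat nat \<comment> \<open>\<open>FormCoeff m a\<close> is the coefficient of \<open>s\<^bsup>a\<^esup> t\<^bsup>r\<^sub>m - a\<^esup>\<close> in \<open>F\<^sub>m\<close>\<close>
  | ParS | ParT \<comment> \<open>homogeneous coordinates \<open>s\<close>, \<open>t\<close> on the line\<close>
  | LinePt \<comment> \<open>affine coordinate of the point in the fibre of \<open>\<I>/G\<close>\<close>

definition S_coords :: "nat multiset \<Rightarrow> 'i \<Rightarrow> 'i \<Rightarrow> (nat \<Rightarrow> nat) \<Rightarrow> 'i coord set" where
  "S_coords K i j e = FrameU ` (UNIV - {i, j}) \<union> FrameV ` (UNIV - {i, j}) \<union>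
     {FormCoeff m a | m a. m \<in># K \<and> a \<le> count K m \<and> a \<noteq> e m}"

definition is_S_chart :: "nat multiset \<Rightarrow> 'i \<Rightarrow> 'i \<Rightarrow> (nat \<Rightarrow> nat) \<Rightarrow> bool" where
  "is_S_chart K i j e \<longleftrightarrow> i \<noteq> j \<and> (\<forall>m\<in>#K. e m \<le> count K m)"

definition frame_u :: "'i \<Rightarrow> 'i \<Rightarrow> 'i \<Rightarrow> 'i coord cpoly" where
  "frame_u i j l = (if l = i then 1 else if l = j then 0 else Var (FrameU l))"

definition frame_v :: "'i \<Rightarrow> 'i \<Rightarrow> 'i \<Rightarrow> 'i coord cpoly" where
  "frame_v i j l = (if l = i then 0 else if l = j then 1 else Var (FrameV l))"

definition line_param :: "'i \<Rightarrow> 'i \<Rightarrow> 'i \<Rightarrow> 'i coord cpoly" where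
  "line_param i j l = Var ParS * frame_u i j l + Var ParT * frame_v i j l"

definition points_form :: "nat multiset \<Rightarrow> (nat \<Rightarrow> nat) \<Rightarrow> nat \<Rightarrow> 'i coord cpoly" where
  "points_form K e m = (\<Sum>a\<le>count K m.
     (if a = e m then 1 else Var (FormCoeff m a)) * Var ParS ^ a * Var ParT ^ (count K m - a))"

definition Z_form :: "nat multiset \<Rightarrow> (nat \<Rightarrow> nat) \<Rightarrow> 'i coord cpoly" where
  "Z_form K e = (\<Prod>m\<in>set_mset K. points_form K e m ^ m)"

text \<open>Over the closed subscheme of the chart of \<open>S\<close> given by the ideal \<open>J\<close>, the divisor \<open>Z\<close> is
  contained in the closure of \<open>X\<close> if and only if the restriction to the line of every
  homogeneous \<open>g\<close> vanishing on \<open>X\<close> is a multiple of the equation of \<open>Z\<close>, modulo \<open>J\<close>. (No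
  saturation with respect to \<open>(s, t)\<close> is needed: \<open>Z_form\<close> is a primitive form, hence the ideal it
  generates is saturated over any base.) The ideal defining the largest such subscheme is the
  smallest such \<open>J\<close>.\<close>

definition Z_in_closure_mod ::
    "('i::finite \<Rightarrow> complex) set \<Rightarrow> nat multiset \<Rightarrow> 'i \<Rightarrow> 'i \<Rightarrow> (nat \<Rightarrow> nat) \<Rightarrow> 'i coord cpoly set \<Rightarrow> bool" where
  "Z_in_closure_mod X K i j e J \<longleftrightarrow>
    (\<forall>g. homogeneous g \<and> (\<forall>x\<in>X. value_at x g = 0) \<longrightarrow>
      subst (line_param i j) g \<in>
        genideal (poly_ring (S_coords K i j e \<union> {ParS, ParT})) (insert (Z_form K e) J))"

definition H_ideal ::
    "('i::finite \<Rightarrow> complex) set \<Rightarrow> nat multiset \<Rightarrow> 'i \<Rightarrow> 'i \<Rightarrow> (nat \<Rightarrow> nat) \<Rightarrow> 'i coord cpoly set" where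
  "H_ideal X K i j e =
    \<Inter>{J. ideal J (poly_ring (S_coords K i j e)) \<and> Z_in_closure_mod X K i j e J}"

text \<open>The open condition that the support of \<open>Z\<close> lies in \<open>X\<close>, which together with \<open>H_ideal\<close>
  means that \<open>Z\<close> is contained in the locally closed subscheme \<open>X\<close>.\<close>

definition support_in ::
    "('i::finite \<Rightarrow> complex) set \<Rightarrow> nat multiset \<Rightarrow> 'i \<Rightarrow> 'i \<Rightarrow> (nat \<Rightarrow> nat) \<Rightarrow> ('i coord \<Rightarrow> complex) \<Rightarrow> bool" where
  "support_in X K i j e x \<longleftrightarrow>
    (\<forall>s t. (s, t) \<noteq> (0, 0) \<and> value_at (x(ParS := s, ParT := t)) (Z_form K e) = 0 \<longrightarrow>
       (\<lambda>l. value_at (x(ParS := s, ParT := t)) (line_param i j l)) \<in> X)"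

definition H_point ::
    "('i::finite \<Rightarrow> complex) set \<Rightarrow> nat multiset \<Rightarrow> 'i \<Rightarrow> 'i \<Rightarrow> (nat \<Rightarrow> nat) \<Rightarrow> ('i coord \<Rightarrow> complex) \<Rightarrow> bool" where
  "H_point X K i j e x \<longleftrightarrow> zero_of (H_ideal X K i j e) x \<and> support_in X K i j e x"


section \<open>The fibres of the projection to projective space\<close>

text \<open>The line bundle \<open>S \<times>\<^sub>G \<I>\<close> is covered by the products of the charts of \<open>S\<close> with the two affine
  charts \<open>(1 : b)\<close> and \<open>(b : 1)\<close> of the projective line, selected by \<open>\<delta>\<close>; the map \<open>\<theta>\<close> sends
  \<open>(a : b)\<close> to the point \<open>a u + b v\<close> of projective space.\<close>

definition bundle_coords :: "nat multiset \<Rightarrow> 'i \<Rightarrow> 'i \<Rightarrow> (nat \<Rightarrow> nat) \<Rightarrow> 'i coord set" where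
  "bundle_coords K i j e = insert LinePt (S_coords K i j e)"

definition theta :: "'i \<Rightarrow> 'i \<Rightarrow> bool \<Rightarrow> 'i \<Rightarrow> 'i coord cpoly" where
  "theta i j \<delta> l =
    (if \<delta> then frame_u i j l + Var LinePt * frame_v i j l
     else Var LinePt * frame_u i j l + frame_v i j l)"

text \<open>The scheme-theoretic fibre over \<open>p\<close> of the restriction of \<open>\<theta>\<close> to \<open>H \<times>\<^sub>G \<I>\<close>.\<close>

definition theta_fibre_ideal ::
    "('i::finite \<Rightarrow> complex) set \<Rightarrow> nat multiset \<Rightarrow> ('i \<Rightarrow> complex) \<Rightarrow>
      'i \<Rightarrow> 'i \<Rightarrow> (nat \<Rightarrow> nat) \<Rightarrow> bool \<Rightarrow> 'i coord cpoly set" where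
  "theta_fibre_ideal X K p i j e \<delta> = genideal (poly_ring (bundle_coords K i j e))
     (H_ideal X K i j e \<union>
      {Const (p l) * theta i j \<delta> l' - Const (p l') * theta i j \<delta> l | l l'. True})"

definition theta_fibre_smooth_of_pure_dim ::
    "('i::finite \<Rightarrow> complex) set \<Rightarrow> nat multiset \<Rightarrow> ('i \<Rightarrow> complex) \<Rightarrow> int \<Rightarrow> bool" where
  "theta_fibre_smooth_of_pure_dim X K p d \<longleftrightarrow>
    (\<forall>i j e \<delta> x. is_S_chart K i j e \<and> H_point X K i j e x \<and>
        zero_of (theta_fibre_ideal X K p i j e \<delta>) x \<longrightarrow>
      smooth_at (bundle_coords K i j e) (theta_fibre_ideal X K p i j e \<delta>) d x)"

end

theory Submission
  imports Defs "HOL-Computational_Algebra.Fundamental_Theorem_Algebra"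
begin

text \<open>
  Let \<open>Z = \<Sum> k\<^sub>i x\<^sub>i\<close> be contained in \<open>X\<close> and in the line \<open>L\<close>. The tangent space of \<open>H\<close> at \<open>(L, Z)\<close> is the
  kernel of the map on global sections induced by a surjection \<open>Q \<rightarrow> N\<^sub>X|\<^sub>Z\<close> of sheaves on \<open>L\<close>, where \<open>Q\<close> is
  the sum of the normal bundle \<open>N\<^sub>L = \<O>(1)\<^bsup>N-1\<^esup>\<close> and of a torsion sheaf of deformations of the points
  \<open>x\<^sub>i\<close>. Let \<open>F\<close> be the kernel of this surjection. If \<open>\<theta>\<close> is submersive on \<open>H \<times>\<^sub>G \<I>\<close> at \<open>(L, Z, p)\<close>, then the
  global sections of \<open>F\<close> generate \<open>N\<^sub>L\<close> at \<open>p\<close>; hence \<open>F\<close> modulo torsion is a sum of line bundles of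
  nonnegative degree, \<open>H\<^sup>1(F) = 0\<close>, and \<open>H\<^sup>0(Q) \<rightarrow> H\<^sup>0(N\<^sub>X|\<^sub>Z)\<close> is surjective. So the \<open>k c\<close> local equations of
  \<open>H\<close> and the \<open>N\<close> equations of the fibre of \<open>\<theta>\<close> have independent differentials. In coordinates the
  vanishing of \<open>H\<^sup>1(F)\<close> is elementary: with a general point of \<open>L\<close> at infinity and \<open>\<tau>\<close> the coordinate on
  the rest of \<open>L\<close>, the sections of \<open>F\<close> include, modulo torsion, a vector \<open>\<tau> e\<^sub>l\<close> plus a constant one for
  each \<open>l\<close>, so that every polynomial section of \<open>N\<^sub>L\<close> is congruent to a constant one.

  Submersivity of \<open>\<theta>\<close> at all points of \<open>H \<times>\<^sub>G \<I>\<close> over a general \<open>p\<close> is an algebraic Sard lemma, which does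
  not need \<open>H\<close> to be reduced: if the images of the points where it fails were dense, then an
  ultrafilter of such points would have a residue field containing the function field of the
  projective space, and the derivations of the latter extend to the former.
\<close>

section \<open>Evaluation homomorphisms\<close>

text \<open>\<open>H_ideal\<close> is an intersection over infinitely many ideals J, so it has no
  generators to start from. Elements of it come from division by the equation z of Z: the
  remainders, times a power of the leading coefficient \<phi> chosen before J, lie in every J. The
  opposite bound comes from exhibiting one admissible J, the contraction of the local ideal
  generated by these remainders. Neither \<phi> nor the denominators near the points of Z are units
  among polynomials; hence \<open>loc\<close> inverts functions nonzero at x, and powers of \<phi>
  are removed by primitivity of Z, which is visible in the coordinate with \<beta> = 0. Z may be
  supported at several points of X, where the local equations of X differ. They are glued to c
  equations valid at all these points, so that division by z yields exactly k c equations. The point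
  at infinity must lie off Z, so that \<phi> is nonzero at x, and tangent vectors of H must displace
  it arbitrarily. The point over p has the second property but may lie on Z. The second property is
  open, so it passes to nearby points, of which only finitely many lie on Z.\<close>

definition ring_map :: "('a::comm_ring_1 \<Rightarrow> 'b::comm_ring_1) \<Rightarrow> bool" where
  "ring_map h \<longleftrightarrow> h 1 = 1 \<and> (\<forall>a b. h (a + b) = h a + h b) \<and> (\<forall>a b. h (a * b) = h a * h b)"

lemma ring_map_simps:
  assumes "ring_map h"
  shows "h 1 = 1" "h 0 = 0" "h (a + b) = h a + h b" "h (a * b) = h a * h b"
    "h (- a) = - h a" "h (a - b) = h a - h b" "h (a ^ n) = h a ^ n"
proof -
  show *: "h 1 = 1" "h (a + b) = h a + h b" "h (a * b) = h a * h b" for a b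
    using assms by (auto simp: ring_map_def)
  show z: "h 0 = 0"
    using *(2)[of 0 0] by simp
  show m: "h (- a) = - h a" for a
    using *(2)[of "- a" a] z by (simp add: eq_neg_iff_add_eq_0)
  show "h (a - b) = h a - h b"
    using *(2)[of a "- b"] m by simp
  show "h (a ^ n) = h a ^ n"
    by (induction n) (auto simp: *)
qed

lemma ring_map_sum: "ring_map h \<Longrightarrow> h (sum f A) = (\<Sum>a\<in>A. h (f a))"
  by (induction A rule: infinite_finite_induct) (auto simp: ring_map_simps)

lemma ring_map_prod: "ring_map h \<Longrightarrow> h (prod f A) = (\<Prod>a\<in>A. h (f a))"
  by (induction A rule: infinite_finite_induct) (auto simp: ring_map_simps)

lemma ring_map_comp: "ring_map f \<Longrightarrow> ring_map g \<Longrightarrow> ring_map (\<lambda>x. f (g x))"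
  by (auto simp: ring_map_def)

lemma ring_map_id [simp]: "ring_map (\<lambda>x. x)"
  by (auto simp: ring_map_def)

lemma ring_map_const_poly [simp]: "ring_map (\<lambda>c. [:c:])"
  by (auto simp: ring_map_def one_pCons)

lemma ring_map_poly [simp]: "ring_map (\<lambda>p. poly p a)"
  by (auto simp: ring_map_def)

lemma ring_map_map_poly:
  assumes "ring_map h"
  shows "ring_map (map_poly h)"
  unfolding ring_map_def
proof (intro conjI allI)
  note h = ring_map_simps[OF assms]
  show "map_poly h 1 = 1"
    by (simp add: h map_poly_pCons one_pCons)
  fix p q
  show "map_poly h (p + q) = map_poly h p + map_poly h q"
    by (rule poly_eqI) (simp add: coeff_map_poly h)
  show "map_poly h (p * q) = map_poly h p * map_poly h q"
    by (rule poly_eqI) (simp add: coeff_map_poly h coeff_mult ring_map_sum[OF assms])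
qed

definition mon_in :: "('v \<Rightarrow> 'a::comm_ring_1) \<Rightarrow> ('v \<Rightarrow>\<^sub>0 nat) \<Rightarrow> 'a" where
  "mon_in x m = (\<Prod>v\<in>Poly_Mapping.keys m. x v ^ Poly_Mapping.lookup m v)"

lemma mon_in_superset:
  assumes "finite A" "Poly_Mapping.keys m \<subseteq> A"
  shows "mon_in x m = (\<Prod>v\<in>A. x v ^ Poly_Mapping.lookup m v)"
  unfolding mon_in_def
  by (rule prod.mono_neutral_left) (use assms in \<open>auto simp: in_keys_iff\<close>)

lemma mon_in_add: "mon_in x (m + m') = mon_in x m * mon_in x m'"
proof -
  let ?A = "Poly_Mapping.keys m \<union> Poly_Mapping.keys m'"
  have "Poly_Mapping.keys (m + m') \<subseteq> ?A"
    by (rule Poly_Mapping.keys_add)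
  then show ?thesis
    by (simp add: mon_in_superset[of ?A] lookup_add power_add prod.distrib)
qed

lemma mon_in_0 [simp]: "mon_in x 0 = 1"
  by (simp add: mon_in_def)

lemma eval_in_eq: "eval_in c x p = (\<Sum>m\<in>Poly_Mapping.keys p. c (Poly_Mapping.lookup p m) * mon_in x m)"
  by (simp add: eval_in_def mon_in_def)

lemma eval_in_superset:
  assumes "finite A" "Poly_Mapping.keys p \<subseteq> A" "c 0 = 0"
  shows "eval_in c x p = (\<Sum>m\<in>A. c (Poly_Mapping.lookup p m) * mon_in x m)"
  unfolding eval_in_eq
  by (rule sum.mono_neutral_left) (use assms in \<open>auto simp: in_keys_iff\<close>)

lemma eval_in_add:
  assumes "ring_map c"
  shows "eval_in c x (p + q) = eval_in c x p + eval_in c x q"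
proof -
  let ?A = "Poly_Mapping.keys p \<union> Poly_Mapping.keys q"
  have "Poly_Mapping.keys (p + q) \<subseteq> ?A"
    by (rule Poly_Mapping.keys_add)
  then show ?thesis
    using ring_map_simps[OF assms]
    by (simp add: eval_in_superset[of ?A] lookup_add distrib_right sum.distrib)
qed

lemma eval_in_single:
  assumes "ring_map c"
  shows "eval_in c x (Poly_Mapping.single m a) = c a * mon_in x m"
  using ring_map_simps(2)[OF assms]
  by (cases "a = 0") (simp_all add: eval_in_eq)

lemma poly_mapping_sum_singles:
  fixes p :: "'m \<Rightarrow>\<^sub>0 'a::comm_monoid_add"
  shows "p = (\<Sum>m\<in>Poly_Mapping.keys p. Poly_Mapping.single m (Poly_Mapping.lookup p m))"
proof (rule poly_mapping_eqI)
  fix k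
  show "Poly_Mapping.lookup p k = Poly_Mapping.lookup
      (\<Sum>m\<in>Poly_Mapping.keys p. Poly_Mapping.single m (Poly_Mapping.lookup p m)) k"
    by (simp add: lookup_sum lookup_single when_def in_keys_iff)
qed

lemma eval_in_0 [simp]: "eval_in c x 0 = 0"
  by (simp add: eval_in_def)

lemma eval_in_sum:
  assumes "ring_map c"
  shows "eval_in c x (sum f A) = (\<Sum>a\<in>A. eval_in c x (f a))"
  by (induction A rule: infinite_finite_induct) (auto simp: eval_in_add[OF assms])

lemma eval_in_mult:
  assumes "ring_map c"
  shows "eval_in c x (p * q) = eval_in c x p * eval_in c x q"
proof -
  let ?s = "\<lambda>p m. Poly_Mapping.single m (Poly_Mapping.lookup p m)"
  have "p * q = (\<Sum>m\<in>Poly_Mapping.keys p. ?s p m) * (\<Sum>m\<in>Poly_Mapping.keys q. ?s q m)"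
    using poly_mapping_sum_singles[of p] poly_mapping_sum_singles[of q] by simp
  also have "\<dots> = (\<Sum>m\<in>Poly_Mapping.keys p. \<Sum>m'\<in>Poly_Mapping.keys q. ?s p m * ?s q m')"
    by (rule sum_product)
  finally have *: "p * q = \<dots>" .
  show ?thesis
    unfolding * eval_in_sum[OF assms]
    by (simp only: mult_single eval_in_single[OF assms] mon_in_add ring_map_simps(4)[OF assms]
        eval_in_eq[of c x p] eval_in_eq[of c x q] sum_product) (simp add: algebra_simps)
qed

lemma eval_in_ring_map: "ring_map c \<Longrightarrow> ring_map (eval_in c x)"
  unfolding ring_map_def[of "eval_in c x"]
  by (metis eval_in_add eval_in_mult eval_in_single mon_in_0 mult_1 ring_map_simps(1) single_one)

lemma eval_in_Const [simp]: "ring_map c \<Longrightarrow> eval_in c x (Const a) = c a"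
  by (simp add: Const_def eval_in_single)

lemma eval_in_Var [simp]: "ring_map c \<Longrightarrow> eval_in c x (Var v) = x v"
  by (simp add: Var_def eval_in_single mon_in_def ring_map_simps)

lemma Const_simps:
  "Const 0 = 0" "Const 1 = 1" "Const (a + b) = Const a + Const b" "Const (a * b) = Const a * Const b"
  by (auto simp: Const_def single_add mult_single)

lemma ring_map_Const [simp]: "ring_map Const"
  by (simp add: ring_map_def Const_simps)

lemma single_eq_mon_in: "Poly_Mapping.single m a = Const a * mon_in Var m"
proof -
  have single_power: "Poly_Mapping.single k (1::complex) ^ n
      = Poly_Mapping.single (\<Sum>i<n. k) 1" for k :: "'a \<Rightarrow>\<^sub>0 nat" and n
    by (induction n) (auto simp: mult_single add.commute)
  have prod: "(\<Prod>v\<in>A. Poly_Mapping.single (f v) (1::complex)) = Poly_Mapping.single (sum f A) 1"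
    for f :: "'a \<Rightarrow> 'a \<Rightarrow>\<^sub>0 nat" and A
    by (induction A rule: infinite_finite_induct) (auto simp: mult_single)
  have s: "(\<Sum>i<n. Poly_Mapping.single v (1::nat)) = Poly_Mapping.single v n" for v :: 'a and n
    by (induction n) (auto simp: single_add[symmetric])
  have "mon_in Var m = Poly_Mapping.single
      (\<Sum>v\<in>Poly_Mapping.keys m. Poly_Mapping.single v (Poly_Mapping.lookup m v)) 1"
    unfolding mon_in_def Var_def single_power s prod ..
  also have "\<dots> = Poly_Mapping.single m 1"
    using poly_mapping_sum_singles[of m] by simp
  finally show ?thesis
    by (simp add: Const_def mult_single)
qed

lemma eval_in_Const_Var: "eval_in Const Var p = p"
  using poly_mapping_sum_singles[of p]
  by (simp add: eval_in_eq single_eq_mon_in)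

lemma ring_map_eval_in:
  assumes "ring_map h"
  shows "h (eval_in c x p) = eval_in (\<lambda>a. h (c a)) (\<lambda>v. h (x v)) p"
  by (simp add: eval_in_def ring_map_simps[OF assms] ring_map_sum[OF assms] ring_map_prod[OF assms])

lemma mon_in_cong: "(\<And>v. v \<in> Poly_Mapping.keys m \<Longrightarrow> x v = y v) \<Longrightarrow> mon_in x m = mon_in y m"
  unfolding mon_in_def by (rule prod.cong) auto

lemma eval_in_cong:
  assumes "\<And>v. v \<in> vars p \<Longrightarrow> x v = y v"
  shows "eval_in c x p = eval_in c y p"
  unfolding eval_in_eq
proof (rule sum.cong)
  fix m assume "m \<in> Poly_Mapping.keys p"
  then have "mon_in x m = mon_in y m"
    using assms by (intro mon_in_cong) (auto simp: vars_def)
  then show "c (Poly_Mapping.lookup p m) * mon_in x m = c (Poly_Mapping.lookup p m) * mon_in y m"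
    by simp
qed simp

lemma vars_add: "vars (p + q) \<subseteq> vars p \<union> vars q"
  using Poly_Mapping.keys_add[of p q] unfolding vars_def by blast

lemma vars_mult: "vars (p * q) \<subseteq> vars p \<union> vars q"
proof
  fix v assume "v \<in> vars (p * q)"
  then obtain m where m: "m \<in> Poly_Mapping.keys (p * q)" "v \<in> Poly_Mapping.keys m"
    unfolding vars_def by blast
  then obtain a b where ab: "m = a + b" "a \<in> Poly_Mapping.keys p" "b \<in> Poly_Mapping.keys q"
    using Poly_Mapping.keys_mult[of p q] by blast
  then have "v \<in> Poly_Mapping.keys a \<or> v \<in> Poly_Mapping.keys b"
    using m(2) Poly_Mapping.keys_add[of a b] by blast
  then show "v \<in> vars p \<union> vars q"
    using ab unfolding vars_def by blast
qed

lemma vars_Const [simp]: "vars (Const c) = {}"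
  by (auto simp: vars_def Const_def split: if_splits)

lemma vars_Var [simp]: "vars (Var v) = {v}"
  by (auto simp: vars_def Var_def)

lemma vars_0 [simp]: "vars 0 = {}" and vars_1 [simp]: "vars 1 = {}"
  by (auto simp: vars_def)

lemma vars_uminus [simp]: "vars (- p) = vars p"
  by (simp add: vars_def in_keys_iff Bex_def)

lemma finite_vars [simp]: "finite (vars p)"
  by (auto simp: vars_def)

section \<open>Polynomials in a prescribed set of variables\<close>

definition vars_in :: "'v set \<Rightarrow> 'v cpoly \<Rightarrow> bool" where
  "vars_in W p \<longleftrightarrow> vars p \<subseteq> W"

lemma vars_in_intros [intro, simp]:
  "vars_in W 0" "vars_in W 1" "vars_in W (Const c)"
  "v \<in> W \<Longrightarrow> vars_in W (Var v)"
  "vars_in W p \<Longrightarrow> vars_in W q \<Longrightarrow> vars_in W (p + q)"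
  "vars_in W p \<Longrightarrow> vars_in W q \<Longrightarrow> vars_in W (p * q)"
  "vars_in W p \<Longrightarrow> vars_in W (- p)"
  using vars_add[of p q] vars_mult[of p q] unfolding vars_in_def by auto

lemma vars_in_diff [intro, simp]: "vars_in W p \<Longrightarrow> vars_in W q \<Longrightarrow> vars_in W (p - q)"
  using vars_in_intros(5)[of W p "- q"] by simp

lemma vars_in_sum [intro]: "(\<And>a. a \<in> A \<Longrightarrow> vars_in W (f a)) \<Longrightarrow> vars_in W (sum f A)"
  by (induction A rule: infinite_finite_induct) auto

lemma vars_in_prod [intro]: "(\<And>a. a \<in> A \<Longrightarrow> vars_in W (f a)) \<Longrightarrow> vars_in W (prod f A)"
  by (induction A rule: infinite_finite_induct) auto

lemma vars_in_power [intro, simp]: "vars_in W p \<Longrightarrow> vars_in W (p ^ n)"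
  by (induction n) auto

lemma vars_in_mono: "vars_in W p \<Longrightarrow> W \<subseteq> W' \<Longrightarrow> vars_in W' p"
  by (auto simp: vars_in_def)

lemma vars_in_eval:
  assumes "\<And>v. v \<in> vars p \<Longrightarrow> vars_in W (x v)"
  shows "vars_in W (eval_in Const x p)"
  unfolding eval_in_def
proof (intro vars_in_sum vars_in_intros(6) vars_in_prod vars_in_power)
  fix m v assume "m \<in> Poly_Mapping.keys p" "v \<in> Poly_Mapping.keys m"
  then show "vars_in W (x v)"
    using assms by (auto simp: vars_def)
qed simp

text \<open>\<open>eval_in Const Var p\<close> writes p as a sum of products of constants and
  variables. Carrying \<open>vars_in W\<close> along keeps the induction inside the subring of
  polynomials in W.\<close>

lemma cpoly_induct_in [consumes 1, case_names Const Var add mult]: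
  assumes "vars_in W p"
    and C: "\<And>c. Q (Const c)" and V: "\<And>v. v \<in> W \<Longrightarrow> Q (Var v)"
    and A: "\<And>p q. vars_in W p \<Longrightarrow> vars_in W q \<Longrightarrow> Q p \<Longrightarrow> Q q \<Longrightarrow> Q (p + q)"
    and M: "\<And>p q. vars_in W p \<Longrightarrow> vars_in W q \<Longrightarrow> Q p \<Longrightarrow> Q q \<Longrightarrow> Q (p * q)"
  shows "Q p"
proof -
  let ?Q = "\<lambda>p. vars_in W p \<and> Q p"
  have pow: "?Q (q ^ n)" if "?Q q" for q n
    using that C[of 1] by (induction n) (auto simp: Const_simps intro: M)
  have prod: "?Q (prod f B)" if "\<And>b. b \<in> B \<Longrightarrow> ?Q (f b)" for f and B :: "'b set"
    using that C[of 1] by (induction B rule: infinite_finite_induct) (auto simp: Const_simps intro: M)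
  have sum: "?Q (sum f B)" if "\<And>b. b \<in> B \<Longrightarrow> ?Q (f b)" for f and B :: "('b \<Rightarrow>\<^sub>0 nat) set"
    using that C[of 0] by (induction B rule: infinite_finite_induct) (auto simp: Const_simps intro: A)
  have "?Q (eval_in Const Var p)"
    unfolding eval_in_def
  proof (rule sum)
    fix m assume m: "m \<in> Poly_Mapping.keys p"
    have "?Q (\<Prod>v\<in>Poly_Mapping.keys m. Var v ^ Poly_Mapping.lookup m v)"
    proof (intro prod pow conjI V)
      fix v assume "v \<in> Poly_Mapping.keys m"
      then have "v \<in> W"
        using assms(1) m by (auto simp: vars_in_def vars_def)
      then show "v \<in> W" "vars_in W (Var v)"
        by simp_all
    qed
    then show "?Q (Const (Poly_Mapping.lookup p m) *
        (\<Prod>v\<in>Poly_Mapping.keys m. Var v ^ Poly_Mapping.lookup m v))"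
      using C M by auto
  qed
  then show ?thesis
    by (simp add: eval_in_Const_Var)
qed

lemma cpoly_induct [case_names Const Var add mult]:
  assumes "\<And>c. Q (Const c)" "\<And>v. Q (Var v)"
    "\<And>p q. Q p \<Longrightarrow> Q q \<Longrightarrow> Q (p + q)" "\<And>p q. Q p \<Longrightarrow> Q q \<Longrightarrow> Q (p * q)"
  shows "Q p"
  by (rule cpoly_induct_in[of UNIV]) (use assms in \<open>auto simp: vars_in_def\<close>)

lemma ring_map_value_at [simp]: "ring_map (value_at x)"
proof -
  have "value_at x = eval_in (\<lambda>c. c) x"
    by (rule ext) (simp add: value_at_def)
  then show ?thesis
    by (simp add: eval_in_ring_map)
qed

lemma ring_map_subst [simp]: "ring_map (subst \<sigma>)"
proof -
  have "subst \<sigma> = eval_in Const \<sigma>"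
    by (rule ext) (simp add: subst_def)
  then show ?thesis
    by (simp add: eval_in_ring_map)
qed

lemmas value_at_simps [simp] = ring_map_simps[OF ring_map_value_at]
lemmas value_at_sum = ring_map_sum[OF ring_map_value_at]
lemmas value_at_prod = ring_map_prod[OF ring_map_value_at]
lemmas subst_simps [simp] = ring_map_simps[OF ring_map_subst]

lemma value_at_Const [simp]: "value_at x (Const c) = c"
  and value_at_Var [simp]: "value_at x (Var v) = x v"
  and subst_Const [simp]: "subst \<sigma> (Const c) = Const c"
  and subst_Var [simp]: "subst \<sigma> (Var v) = \<sigma> v"
  by (auto simp: value_at_def subst_def)

lemma value_at_cong: "(\<And>v. v \<in> vars p \<Longrightarrow> x v = y v) \<Longrightarrow> value_at x p = value_at y p"
  unfolding value_at_def by (rule eval_in_cong)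

lemma value_at_subst: "value_at x (subst \<sigma> p) = value_at (\<lambda>v. value_at x (\<sigma> v)) p"
  by (induction p rule: cpoly_induct) simp_all

lemma vars_in_subst: "(\<And>v. v \<in> vars p \<Longrightarrow> vars_in W (\<sigma> v)) \<Longrightarrow> vars_in W (subst \<sigma> p)"
  unfolding subst_def by (rule vars_in_eval)


section \<open>Directional derivatives\<close>

text \<open>The restriction of a polynomial to the line \<open>x + t v\<close>, as a polynomial in
  t. Its linear coefficient is a derivative whose Leibniz rule is mere multiplication of
  polynomials.\<close>

definition jet :: "('v \<Rightarrow> complex) \<Rightarrow> ('v \<Rightarrow> complex) \<Rightarrow> 'v cpoly \<Rightarrow> complex poly" where
  "jet x v = eval_in (\<lambda>c. [:c:]) (\<lambda>w. [:x w, v w:])"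

definition dir :: "('v \<Rightarrow> complex) \<Rightarrow> ('v \<Rightarrow> complex) \<Rightarrow> 'v cpoly \<Rightarrow> complex" where
  "dir x v p = coeff (jet x v p) 1"

lemma ring_map_jet: "ring_map (jet x v)"
  by (simp add: jet_def eval_in_ring_map)

lemma poly_jet: "poly (jet x v p) z = value_at (\<lambda>w. x w + z * v w) p"
  unfolding jet_def ring_map_eval_in[OF ring_map_poly] by (simp add: value_at_def)

lemma coeff_jet_0: "coeff (jet x v p) 0 = value_at x p"
  using poly_jet[of x v p 0] by (simp add: poly_0_coeff_0)

lemma dir_Const [simp]: "dir x v (Const c) = 0"
  and dir_Var [simp]: "dir x v (Var w) = v w"
  and dir_0 [simp]: "dir x v 0 = 0"
  and dir_1 [simp]: "dir x v 1 = 0"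
  and dir_add [simp]: "dir x v (p + q) = dir x v p + dir x v q"
  and dir_uminus [simp]: "dir x v (- p) = - dir x v p"
  and dir_diff [simp]: "dir x v (p - q) = dir x v p - dir x v q"
  by (simp_all add: dir_def ring_map_simps[OF ring_map_jet])
    (simp_all add: jet_def)

lemma dir_mult [simp]: "dir x v (p * q) = value_at x p * dir x v q + dir x v p * value_at x q"
  by (simp add: dir_def ring_map_simps[OF ring_map_jet] coeff_mult coeff_jet_0)

lemma dir_sum: "dir x v (sum f A) = (\<Sum>a\<in>A. dir x v (f a))"
  by (induction A rule: infinite_finite_induct) auto

lemma dir_lin:
  "dir x (\<lambda>w. a * v w + b * v' w) p = a * dir x v p + b * dir x v' p"
  by (induction p rule: cpoly_induct) (simp_all add: algebra_simps)

lemma dir_cong: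
  assumes "vars_in W p" "\<And>w. w \<in> W \<Longrightarrow> v w = v' w"
  shows "dir x v p = dir x v' p"
  using assms(1) by (induction p rule: cpoly_induct_in) (simp_all add: assms)

text \<open>The passage from the complex derivative in the definition of smoothness to the algebraic
  one: as a function of the coordinate w alone, p is a jet shifted by \<open>x w\<close>.\<close>

lemma partial_deriv_eq_dir: "partial_deriv w p x = dir x (\<lambda>u. if u = w then 1 else 0) p"
proof -
  let ?e = "\<lambda>u. if u = w then 1 else (0::complex)"
  have eq: "value_at (x(w := z)) p = poly (jet x ?e p) (z - x w)" for z
    unfolding poly_jet by (rule value_at_cong) auto
  have "((\<lambda>z. poly (jet x ?e p) (z - x w)) has_field_derivative
      poly (pderiv (jet x ?e p)) (x w - x w) * 1) (at (x w))"
    by (auto intro!: derivative_eq_intros DERIV_chain'[where g = "poly (jet x ?e p)"] poly_DERIV)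
  then show ?thesis
    unfolding partial_deriv_def eq
    by (simp add: DERIV_imp_deriv dir_def poly_0_coeff_0 coeff_pderiv)
qed

lemma dir_eq_sum:
  assumes "vars_in W p" "finite W"
  shows "dir x v p = (\<Sum>w\<in>W. v w * partial_deriv w p x)"
  using assms(1) 
proof (induction p rule: cpoly_induct_in)
  case (Var u)
  have "(\<Sum>w\<in>W. v w * (if u = w then 1 else 0)) = (\<Sum>w\<in>W. if w = u then v w else 0)"
    by (rule sum.cong) auto
  also have "\<dots> = v u"
    using Var assms(2) by simp
  finally show ?case
    by (simp add: partial_deriv_eq_dir)
qed (simp_all add: partial_deriv_eq_dir algebra_simps sum.distrib sum_distrib_left sum_distrib_right)

section \<open>Polynomials as functions on affine space\<close>

lemma ring_map_poly_eval: "ring_map h \<Longrightarrow> h (poly f a) = poly (map_poly h f) (h a)"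
  by (induction f) (simp_all add: map_poly_pCons ring_map_simps)

text \<open>The identification with polynomials in w over the ring of the other variables;
  \<open>Var w\<close> becomes the polynomial variable.\<close>

definition split_var :: "'v \<Rightarrow> 'v cpoly \<Rightarrow> 'v cpoly poly" where
  "split_var w = eval_in (\<lambda>c. [:Const c:]) (\<lambda>v. if v = w then [:0, 1:] else [:Var v:])"

lemma ring_map_const_Const [simp]: "ring_map (\<lambda>c. [:Const c:])"
  using ring_map_comp[OF ring_map_const_poly ring_map_Const] .

lemma ring_map_split_var [simp]: "ring_map (split_var w)"
  by (simp add: split_var_def eval_in_ring_map)

lemma split_var_Const [simp]: "split_var w (Const c) = [:Const c:]"
  and split_var_Var: "split_var w (Var v) = (if v = w then [:0, 1:] else [:Var v:])"
  by (simp_all add: split_var_def)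

lemma poly_split_var: "poly (split_var w p) (Var w) = p"
  by (induction p rule: cpoly_induct) (auto simp: ring_map_simps[OF ring_map_split_var] split_var_Var)

lemma vars_in_split_var: "vars_in (insert w V) p \<Longrightarrow> vars_in (V - {w}) (coeff (split_var w p) n)"
proof (induction p arbitrary: n rule: cpoly_induct_in)
  case (Var v)
  then show ?case
    by (cases n; cases "n - 1") (auto simp: split_var_Var coeff_pCons split: nat.splits)
qed (auto simp: ring_map_simps[OF ring_map_split_var] coeff_mult coeff_pCons
      intro!: vars_in_sum split: nat.splits)

lemma vars_in_empty: "vars_in {} p \<Longrightarrow> \<exists>c. p = Const c"
  by (induction p rule: cpoly_induct_in) (auto simp flip: Const_simps)

lemma Const_eq_0_iff [simp]: "Const c = 0 \<longleftrightarrow> c = 0"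
  by (metis Const_simps(1) value_at_Const)

text \<open>As a polynomial in w it has a nonzero coefficient, which by induction is nonzero at some
  x. Specializing the coefficients at x leaves a nonzero one-variable polynomial over an infinite
  field.\<close>

lemma cpoly_nonzero_value_aux:
  assumes "finite V"
  shows "vars_in V p \<Longrightarrow> p \<noteq> 0 \<Longrightarrow> \<exists>x. value_at x p \<noteq> 0"
  using assms
proof (induction V arbitrary: p rule: finite_induct)
  case empty
  then show ?case
    using vars_in_empty by fastforce
next
  case (insert w V)
  let ?f = "split_var w p"
  have "?f \<noteq> 0"
    using poly_split_var[of w p] insert.prems by auto
  then obtain n where n: "coeff ?f n \<noteq> 0"
    using leading_coeff_neq_0 by blast
  have co: "vars_in V (coeff ?f m)" for m
    using vars_in_split_var[OF insert.prems(1)] insert.hyps by simp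
  obtain x where x: "value_at x (coeff ?f n) \<noteq> 0"
    using insert.IH[OF co n] by blast
  have "map_poly (value_at x) ?f \<noteq> 0"
    using x by (metis coeff_0 coeff_map_poly value_at_simps(2))
  then obtain a where a: "poly (map_poly (value_at x) ?f) a \<noteq> 0"
    using poly_all_0_iff_0 by blast
  have "map_poly (value_at (x(w := a))) ?f = map_poly (value_at x) ?f"
  proof (rule poly_eqI)
    fix m
    have "w \<notin> vars (coeff ?f m)"
      using co[of m] insert.hyps by (auto simp: vars_in_def)
    then have "value_at (x(w := a)) (coeff ?f m) = value_at x (coeff ?f m)"
      by (intro value_at_cong) auto
    then show "coeff (map_poly (value_at (x(w := a))) ?f) m = coeff (map_poly (value_at x) ?f) m"
      by (simp add: coeff_map_poly)
  qed
  then have "value_at (x(w := a)) p \<noteq> 0"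
    using ring_map_poly_eval[OF ring_map_value_at, of "x(w := a)" ?f "Var w"] a
    by (simp add: poly_split_var)
  then show ?case
    by blast
qed

lemma cpoly_nonzero_value: "p \<noteq> 0 \<Longrightarrow> \<exists>x. value_at x p \<noteq> 0"
  using cpoly_nonzero_value_aux[of "vars p" p] by (simp add: vars_in_def)

lemma cpoly_eqI: "(\<And>x. value_at x p = value_at x q) \<Longrightarrow> p = q"
  using cpoly_nonzero_value[of "p - q"] by auto

text \<open>A point where p and a point where q does not vanish are joined by a line, on which both
  factors restrict to nonzero polynomials in one variable.\<close>

lemma cpoly_mult_nonzero:
  fixes p q :: "'v cpoly"
  assumes "p \<noteq> 0" "q \<noteq> 0"
  shows "p * q \<noteq> 0"
proof -
  obtain x y where xy: "value_at x p \<noteq> 0" "value_at y q \<noteq> 0"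
    using assms cpoly_nonzero_value by meson
  let ?v = "\<lambda>w. y w - x w"
  have "poly (jet x ?v p) 0 \<noteq> 0" "poly (jet x ?v q) 1 \<noteq> 0"
    using xy by (simp_all add: poly_jet)
  then have "jet x ?v p * jet x ?v q \<noteq> 0"
    by auto
  then have "jet x ?v (p * q) \<noteq> 0"
    by (simp add: ring_map_simps[OF ring_map_jet])
  then show ?thesis
    by (metis ring_map_simps(2)[OF ring_map_jet])
qed

lemma cpoly_prod_nonzero:
  fixes f :: "'a \<Rightarrow> 'v cpoly"
  shows "finite A \<Longrightarrow> (\<And>a. a \<in> A \<Longrightarrow> f a \<noteq> 0) \<Longrightarrow> prod f A \<noteq> 0"
  by (induction A rule: finite_induct) (simp_all add: cpoly_mult_nonzero)


section \<open>Ideals and localization at a point\<close>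

text \<open>A ring is a module over itself with its ideals as submodules:
  \<open>mul.subspace\<close> means ideal, \<open>mul.span\<close> the generated ideal. These ideals
  live in the ring of all variables; passing to \<open>poly_ring W\<close> is a contraction.\<close>

interpretation mul: module "(*) :: 'a::comm_ring_1 \<Rightarrow> 'a \<Rightarrow> 'a"
  by standard (auto simp: algebra_simps)

declare mul.scale_scale [simp del]

lemma subspace_mult_right: "mul.subspace A \<Longrightarrow> a \<in> A \<Longrightarrow> a * c \<in> A"
  using mul.subspace_scale[of A a c] by (simp add: mult.commute)

text \<open>A ring map onto \<open>poly_ring W\<close> that fixes it and preserves values at x. It
  brings cofactors with foreign variables back into \<open>poly_ring W\<close>, and keeps
  denominators nonzero at x.\<close>

definition retract :: "'v set \<Rightarrow> ('v \<Rightarrow> complex) \<Rightarrow> 'v cpoly \<Rightarrow> 'v cpoly" where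
  "retract W x = subst (\<lambda>v. if v \<in> W then Var v else Const (x v))"

lemma ring_map_retract [simp]: "ring_map (retract W x)"
  by (simp add: retract_def)

lemmas retract_simps [simp] = ring_map_simps[OF ring_map_retract]

lemma vars_in_retract [simp]: "vars_in W (retract W x p)"
  unfolding retract_def by (rule vars_in_subst) auto

lemma retract_id: "vars_in W p \<Longrightarrow> retract W x p = p"
  by (induction p rule: cpoly_induct_in) (auto simp: retract_def)

lemma value_at_retract [simp]: "value_at x (retract W x p) = value_at x p"
  unfolding retract_def value_at_subst by (rule value_at_cong) auto

lemma carrier_poly_ring: "p \<in> carrier (poly_ring W) \<longleftrightarrow> vars_in W p"
  by (simp add: poly_ring_def vars_in_def)

lemma ideal_poly_ringD:
  assumes "ideal J (poly_ring W)"
  shows "p \<in> J \<Longrightarrow> vars_in W p" "0 \<in> J" "p \<in> J \<Longrightarrow> q \<in> J \<Longrightarrow> p + q \<in> J"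
    "p \<in> J \<Longrightarrow> vars_in W q \<Longrightarrow> q * p \<in> J"
proof -
  interpret ideal J "poly_ring W"
    by fact
  show "p \<in> J \<Longrightarrow> vars_in W p"
    using a_subset carrier_poly_ring by blast
  show "0 \<in> J"
    using additive_subgroup.zero_closed[OF ideal.axioms(1)[OF assms]] by (simp add: poly_ring_def)
  show "p \<in> J \<Longrightarrow> q \<in> J \<Longrightarrow> p + q \<in> J"
    using additive_subgroup.a_closed[OF ideal.axioms(1)[OF assms], of p q]
    by (simp add: poly_ring_def)
  show "p \<in> J \<Longrightarrow> vars_in W q \<Longrightarrow> q * p \<in> J"
    using I_l_closed[of p q] by (simp add: poly_ring_def vars_in_def)
qed

lemma ideal_poly_ringI:
  assumes "mul.subspace A"
  shows "ideal {p \<in> A. vars_in W p} (poly_ring W)"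
proof (rule idealI)
  interpret cring "poly_ring W"
    by (rule cring_poly_ring)
  show "ring (poly_ring W)"
    by (rule ring_axioms)
  let ?J = "{p \<in> A. vars_in W p}"
  have inv: "a_inv (poly_ring W) p = - p" if "vars_in W p" for p
  proof (rule minus_equality)
    show "- p \<oplus>\<^bsub>poly_ring W\<^esub> p = \<zero>\<^bsub>poly_ring W\<^esub>"
      by (simp add: poly_ring_def)
  qed (use that in \<open>simp_all add: carrier_poly_ring\<close>)
  show "subgroup ?J (add_monoid (poly_ring W))"
  proof (rule add.subgroupI)
    show "?J \<subseteq> carrier (poly_ring W)"
      by (auto simp: carrier_poly_ring)
    show "?J \<noteq> {}"
      using mul.subspace_0[OF assms] by blast
    show "\<ominus>\<^bsub>poly_ring W\<^esub> p \<in> ?J" if "p \<in> ?J" for p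
      using that assms by (simp add: inv mul.subspace_neg)
    show "p \<oplus>\<^bsub>poly_ring W\<^esub> q \<in> ?J" if "p \<in> ?J" "q \<in> ?J" for p q
      using that assms by (simp add: poly_ring_def mul.subspace_add)
  qed
  show "p \<otimes>\<^bsub>poly_ring W\<^esub> a \<in> ?J" "a \<otimes>\<^bsub>poly_ring W\<^esub> p \<in> ?J"
    if "a \<in> ?J" "p \<in> carrier (poly_ring W)" for a p
    using that assms mul.subspace_scale[of A a p]
    by (auto simp: carrier_poly_ring) (auto simp: poly_ring_def mult.commute)
qed

text \<open>Extending an ideal to more variables and contracting it adds nothing, because the
  retraction maps the extension back into J.\<close>

lemma ideal_span_subset:
  assumes "ideal J (poly_ring W)" "p \<in> mul.span J" "vars_in W p"
  shows "p \<in> J"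
proof -
  note J = ideal_poly_ringD[OF assms(1)]
  have "retract W (\<lambda>_. 0) p \<in> J"
    using assms(2)
  proof (induction rule: mul.span_induct_alt)
    case base
    show ?case
      using J(2) by simp
  next
    case (step c a q)
    have "retract W (\<lambda>_. 0) a = a"
      using J(1) step.hyps retract_id by blast
    then show ?case
      using J(3,4) step by simp
  qed
  then show ?thesis
    using retract_id[OF assms(3)] by simp
qed

lemma genideal_eq_span:
  assumes "\<And>p. p \<in> S \<Longrightarrow> vars_in W p"
  shows "genideal (poly_ring W) S = {p \<in> mul.span S. vars_in W p}"
proof
  interpret cring "poly_ring W"
    by (rule cring_poly_ring)
  have S: "S \<subseteq> carrier (poly_ring W)"
    using assms by (auto simp: carrier_poly_ring)
  show "genideal (poly_ring W) S \<subseteq> {p \<in> mul.span S. vars_in W p}"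
    by (rule genideal_minimal)
      (use assms in \<open>auto intro!: ideal_poly_ringI mul.subspace_span mul.span_base\<close>)
  have "mul.span S \<subseteq> mul.span (genideal (poly_ring W) S)"
    by (rule mul.span_mono) (rule genideal_self[OF S])
  then show "{p \<in> mul.span S. vars_in W p} \<subseteq> genideal (poly_ring W) S"
    using ideal_span_subset[OF genideal_ideal[OF S]] by blast
qed

text \<open>For an ideal A, the contraction to the polynomial ring of its extension to the local
  ring at x.\<close>

definition loc :: "('v \<Rightarrow> complex) \<Rightarrow> 'v cpoly set \<Rightarrow> 'v cpoly set" where
  "loc x A = {f. \<exists>h. value_at x h \<noteq> 0 \<and> h * f \<in> A}"

lemma loc_base: "A \<subseteq> loc x A"
  by (auto simp: loc_def intro!: exI[of _ 1])

lemma loc_mono: "A \<subseteq> B \<Longrightarrow> loc x A \<subseteq> loc x B"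
  by (auto simp: loc_def)

lemma loc_cancel: "value_at x h \<noteq> 0 \<Longrightarrow> h * f \<in> loc x A \<Longrightarrow> f \<in> loc x A"
  unfolding loc_def mem_Collect_eq
proof (elim exE conjE)
  fix h' assume "value_at x h \<noteq> 0" "value_at x h' \<noteq> 0" "h' * (h * f) \<in> A"
  then show "\<exists>h. value_at x h \<noteq> 0 \<and> h * f \<in> A"
    by (intro exI[of _ "h' * h"]) (simp add: mult.assoc)
qed

lemma subspace_loc:
  assumes "mul.subspace A"
  shows "mul.subspace (loc x A)"
  unfolding mul.subspace_def
proof (intro conjI ballI allI)
  show "0 \<in> loc x A"
    using loc_base mul.subspace_0[OF assms] by blast
  fix f g c
  assume f: "f \<in> loc x A"
  then obtain h where h: "value_at x h \<noteq> 0" "h * f \<in> A"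
    by (auto simp: loc_def)
  have "h * (c * f) \<in> A"
    using mul.subspace_scale[OF assms h(2), of c] by (simp add: algebra_simps)
  then show "c * f \<in> loc x A"
    using h(1) by (auto simp: loc_def)
  assume "g \<in> loc x A"
  then obtain h' where h': "value_at x h' \<noteq> 0" "h' * g \<in> A"
    by (auto simp: loc_def)
  have "(h * h') * (f + g) = h' * (h * f) + h * (h' * g)"
    by (simp add: algebra_simps)
  also have "\<dots> \<in> A"
    using mul.subspace_scale[OF assms h(2)] mul.subspace_scale[OF assms h'(2)]
    by (intro mul.subspace_add[OF assms])
  finally show "f + g \<in> loc x A"
    using h(1) h'(1) unfolding loc_def by (intro CollectI exI[of _ "h * h'"]) simp
qed

lemma same_stalkI:
  assumes I: "\<And>f. f \<in> I \<Longrightarrow> vars_in W f" and J: "\<And>f. f \<in> J \<Longrightarrow> vars_in W f"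
    and "\<And>f. f \<in> I \<Longrightarrow> f \<in> loc x (mul.span J)" "\<And>f. f \<in> J \<Longrightarrow> f \<in> loc x (mul.span I)"
  shows "same_stalk W x (genideal (poly_ring W) I) (genideal (poly_ring W) J)"
proof -
  have aux: "\<exists>h\<in>carrier (poly_ring W). value_at x h \<noteq> 0 \<and> h * f \<in> genideal (poly_ring W) B"
    if A: "\<And>f. f \<in> A \<Longrightarrow> vars_in W f" and B: "\<And>f. f \<in> B \<Longrightarrow> vars_in W f"
      and AB: "\<And>f. f \<in> A \<Longrightarrow> f \<in> loc x (mul.span B)"
      and f: "f \<in> genideal (poly_ring W) A" for A B f
  proof -
    have f: "f \<in> mul.span A" "vars_in W f"
      using f genideal_eq_span[OF A] by auto
    have "f \<in> loc x (mul.span B)"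
      using f(1) mul.span_minimal[of A "loc x (mul.span B)"] AB subspace_loc[OF mul.subspace_span]
      by blast
    then obtain h where h: "value_at x h \<noteq> 0" "h * f \<in> mul.span B"
      by (auto simp: loc_def)
    have "retract W x (h * f) \<in> mul.span B"
      using h(2)
    proof (induction rule: mul.span_induct_alt)
      case (step c a q)
      have "retract W x a \<in> mul.span B"
        using B[OF step.hyps] mul.span_base[OF step.hyps] by (simp add: retract_id)
      then show ?case
        using step by (simp add: mul.span_add mul.span_scale)
    qed (simp add: mul.span_zero)
    then have "retract W x h * f \<in> mul.span B"
      using retract_id[OF f(2)] by simp
    then show ?thesis
      using h(1) f(2) by (intro bexI[of _ "retract W x h"])
        (auto simp: carrier_poly_ring genideal_eq_span[OF B])
  qed
  show ?thesis
    unfolding same_stalk_def using aux[of I J] aux[of J I] assms by blast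
qed

text \<open>Gaussian elimination over the local ring: a matrix that is a nonzero multiple of the
  identity at \<open>x\<close> is invertible there.\<close>

lemma local_cramer:
  fixes n :: nat
  assumes "mul.subspace L" "\<And>h f. value_at x h \<noteq> 0 \<Longrightarrow> h * f \<in> L \<Longrightarrow> f \<in> L"
    and "\<And>a. a < n \<Longrightarrow> (\<Sum>b<n. A a b * r b) \<in> L"
    and "\<And>a b. a < n \<Longrightarrow> b < n \<Longrightarrow> value_at x (A a b) = (if a = b then u else 0)" "u \<noteq> 0"
  shows "b < n \<Longrightarrow> r b \<in> L"
  using assms(3-5)
proof (induction n arbitrary: A u b)
  case (Suc n)
  have last: "(\<Sum>b<n. A n b * r b) + A n n * r n \<in> L"
    using Suc.prems(2)[of n] by simp
  \<comment> \<open>Cross multiplication with the pivot replaces division; at x the reduced matrix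
    is \<open>u * u\<close> times the identity.\<close>
  define A' where "A' = (\<lambda>a b. A n n * A a b - A a n * A n b)"
  have 1: "(\<Sum>b<n. A' a b * r b) \<in> L" if "a < n" for a
  proof -
    have "(\<Sum>b<n. A' a b * r b) =
        A n n * ((\<Sum>b<n. A a b * r b) + A a n * r n) - A a n * ((\<Sum>b<n. A n b * r b) + A n n * r n)"
      by (simp add: A'_def algebra_simps sum_distrib_left sum_subtractf)
    also have "\<dots> \<in> L"
      using Suc.prems(2)[of a] that last
      by (intro mul.subspace_diff[OF assms(1)] mul.subspace_scale[OF assms(1)]) auto
    finally show ?thesis .
  qed
  have 2: "value_at x (A' a b) = (if a = b then u * u else 0)" if "a < n" "b < n" for a b
    using that Suc.prems(3)[of a b] Suc.prems(3)[of n n] Suc.prems(3)[of a n]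
    by (auto simp: A'_def)
  have r: "r b \<in> L" if "b < n" for b
    using Suc.IH[of b A' "u * u"] 1 2 that \<open>u \<noteq> 0\<close> by simp
  have "A n n * r n = ((\<Sum>b<n. A n b * r b) + A n n * r n) - (\<Sum>b<n. A n b * r b)"
    by simp
  also have "\<dots> \<in> L"
    using r by (intro mul.subspace_diff[OF assms(1)] last mul.subspace_sum[OF assms(1)]
        mul.subspace_scale[OF assms(1)]) auto
  finally have "r n \<in> L"
    using assms(2)[of "A n n" "r n"] Suc.prems(3)[of n n] \<open>u \<noteq> 0\<close> by simp
  then show ?case
    using r Suc.prems(1) by (cases "b = n") auto
qed simp

section \<open>Hilbert's basis theorem\<close>

lemma span_lessThanE:
  fixes a :: "nat \<Rightarrow> 'a::comm_ring_1"
  assumes "f \<in> mul.span (a ` {..<m})"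
  obtains u where "f = (\<Sum>n<m. u n * a n)"
proof -
  have "\<exists>u. f = (\<Sum>n<m. u n * a n)"
    using assms
  proof (induction m arbitrary: f)
    case (Suc m)
    then obtain k where "f - k * a m \<in> mul.span (a ` {..<m})"
      by (auto simp: lessThan_Suc mul.span_breakdown_eq)
    then obtain u where u: "f - k * a m = (\<Sum>n<m. u n * a n)"
      using Suc.IH by blast
    have "(\<Sum>n<m. (u(m := k)) n * a n) = (\<Sum>n<m. u n * a n)"
      by (rule sum.cong) auto
    then have "f = (\<Sum>n<Suc m. (u(m := k)) n * a n)"
      using u by (simp add: algebra_simps)
    then show ?case
      by blast
  qed simp
  then show thesis
    using that by blast
qed

lemma finite_subset_span_range:
  fixes a :: "nat \<Rightarrow> 'a::comm_ring_1"
  assumes "finite B" "B \<subseteq> mul.span (range a)"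
  shows "\<exists>m. B \<subseteq> mul.span (a ` {..<m})"
  using assms
proof (induction B rule: finite_induct)
  case (insert b B)
  then obtain m where m: "B \<subseteq> mul.span (a ` {..<m})"
    by auto
  have "b \<in> mul.span (range a)"
    using insert.prems by simp
  then have "\<exists>m. b \<in> mul.span (a ` {..<m})"
  proof (induction rule: mul.span_induct_alt)
    case base
    show ?case
      using mul.span_zero by blast
  next
    case (step c x y)
    then obtain m n where m: "y \<in> mul.span (a ` {..<m})" and n: "x = a n"
      by blast
    have "y \<in> mul.span (a ` {..<max m (Suc n)})"
      using m mul.span_mono[OF image_mono, of "{..<m}" "{..<max m (Suc n)}" a] by auto
    moreover have "x \<in> mul.span (a ` {..<max m (Suc n)})"
      unfolding n by (rule mul.span_base) auto
    ultimately show ?case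
      using mul.span_add mul.span_scale by blast
  qed
  then obtain m' where m': "b \<in> mul.span (a ` {..<m'})"
    by blast
  have "mul.span (a ` {..<m}) \<subseteq> mul.span (a ` {..<max m m'})"
    "mul.span (a ` {..<m'}) \<subseteq> mul.span (a ` {..<max m m'})"
    by (intro mul.span_mono image_mono; simp)+
  then show ?case
    using m m' by (intro exI[of _ "max m m'"]) auto
qed simp

text \<open>Hilbert's argument, by induction on the variables: polynomials in w of least degree
  outside the ideal of the earlier ones have leading coefficients in fewer variables, and a relation
  between these leading coefficients lowers the degree.\<close>

lemma noetherian_sequence:
  fixes a :: "nat \<Rightarrow> 'v cpoly"
  assumes "finite W" "\<And>n. vars_in W (a n)"
  shows "\<exists>m. a m \<in> mul.span (a ` {..<m})"
  using assms
proof (induction W arbitrary: a rule: finite_induct)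
  case empty
  obtain c d where c: "a 0 = Const c" "a 1 = Const d"
    using empty vars_in_empty by meson
  show ?case
  proof (cases "c = 0")
    case True
    then have "a 0 \<in> mul.span (a ` {..<0})"
      using c by (simp add: Const_simps)
    then show ?thesis
      by blast
  next
    case False
    then have "a 1 = Const (d / c) * a 0"
      using c by (simp flip: Const_simps)
    then have "a 1 \<in> mul.span (a ` {..<1})"
      using mul.span_scale[OF mul.span_base[of "a 0" "a ` {..<1}"], of "Const (d / c)"]
      by simp
    then show ?thesis
      by blast
  qed
next
  case (insert w V)
  show ?case
  proof (rule ccontr)
    assume "\<nexists>m. a m \<in> mul.span (a ` {..<m})"
    then have nf: "a m \<notin> mul.span (a ` {..<m})" for m
      by blast
    define e where "e = (\<lambda>f. poly f (Var w) :: 'v cpoly)"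
    have e_simps: "e (f + g) = e f + e g" "e (f * g) = e f * e g" "e (f - g) = e f - e g"
      "e (sum h A) = (\<Sum>i\<in>A. e (h i))" for f g and h :: "nat \<Rightarrow> 'v cpoly poly" and A
      by (simp_all add: e_def poly_sum)
    \<comment> \<open>The ideal generated by the sequence, read as polynomials in w with
      coefficients in the variables V.\<close>
    define I where "I = {f. (\<forall>n. vars_in V (coeff f n)) \<and> e f \<in> mul.span (range a)}"
    have not_fg: "\<exists>f\<in>I. e f \<notin> mul.span (e ` B)" if "finite B" "B \<subseteq> I" for B
    proof -
      have "finite (e ` B)" "e ` B \<subseteq> mul.span (range a)"
        using that by (auto simp: I_def)
      then obtain m where m: "e ` B \<subseteq> mul.span (a ` {..<m})"
        using finite_subset_span_range by meson
      have ea: "e (split_var w (a m)) = a m"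
        by (simp add: e_def poly_split_var)
      have "vars_in V (coeff (split_var w (a m)) n)" for n
        using vars_in_split_var[OF insert.prems, of m n] insert.hyps by simp
      then have "split_var w (a m) \<in> I"
        by (simp add: I_def ea mul.span_base)
      moreover have "a m \<notin> mul.span (e ` B)"
        using nf[of m] mul.span_minimal[OF m] by blast
      ultimately show ?thesis
        using ea by (intro bexI[of _ "split_var w (a m)"]) auto
    qed
    define Q where "Q = (\<lambda>g (n::nat) f. f \<in> I \<and> e f \<notin> mul.span (e ` g ` {..<n}) \<and>
        (\<forall>f'\<in>I. e f' \<notin> mul.span (e ` g ` {..<n}) \<longrightarrow> degree f \<le> degree f'))"
    have "\<exists>g. \<forall>n. Q g n (g n)"
    proof (rule dependent_wellorder_choice)
      fix f and g g' :: "nat \<Rightarrow> 'v cpoly poly" and n :: nat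
      assume eq: "\<And>m. m < n \<Longrightarrow> g m = g' m"
      have "g ` {..<n} = g' ` {..<n}"
        by (rule image_cong) (auto simp: eq)
      then show "Q g n f = Q g' n f"
        unfolding Q_def by simp
    next
      fix n :: nat and g assume g: "\<And>m. m < n \<Longrightarrow> Q g m (g m)"
      have "g ` {..<n} \<subseteq> I"
        using g by (auto simp: Q_def)
      then obtain f where "f \<in> I \<and> e f \<notin> mul.span (e ` g ` {..<n})"
        using not_fg[of "g ` {..<n}"] by blast
      then obtain f' where "f' \<in> I \<and> e f' \<notin> mul.span (e ` g ` {..<n})"
        "\<forall>f. f \<in> I \<and> e f \<notin> mul.span (e ` g ` {..<n}) \<longrightarrow> degree f' \<le> degree f"
        using ex_has_least_nat[of "\<lambda>f. f \<in> I \<and> e f \<notin> mul.span (e ` g ` {..<n})" f degree]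
        by blast
      then show "\<exists>f. Q g n f"
        unfolding Q_def by blast
    qed
    then obtain g where Qg: "\<And>n. Q g n (g n)"
      by meson
    have g: "g n \<in> I" "e (g n) \<notin> mul.span (e ` g ` {..<n})" for n
      using Qg[of n] by (simp_all add: Q_def)
    have least: "degree (g n) \<le> degree f" if "f \<in> I" "e f \<notin> mul.span (e ` g ` {..<n})" for n f
      using Qg[of n] that by (simp add: Q_def)
    have mono: "degree (g n) \<le> degree (g m)" if "n \<le> m" for n m
    proof (rule least[OF g(1)])
      have "mul.span (e ` g ` {..<n}) \<subseteq> mul.span (e ` g ` {..<m})"
        using that by (intro mul.span_mono image_mono) auto
      then show "e (g m) \<notin> mul.span (e ` g ` {..<n})"
        using g(2) by blast
    qed
    define c where "c = (\<lambda>n. lead_coeff (g n))"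
    have cV: "vars_in V (c n)" for n
      using g(1)[of n] by (simp add: I_def c_def)
    obtain m where "c m \<in> mul.span (c ` {..<m})"
      using insert.IH[of c] cV by blast
    then obtain u where u: "c m = (\<Sum>n<m. u n * c n)"
      using span_lessThanE by blast
    \<comment> \<open>The cofactors u may contain w; retraction to V keeps the relation because the
      c n are polynomials in V.\<close>
    define u' where "u' = (\<lambda>n. retract V (\<lambda>_. 0) (u n))"
    have "c m = retract V (\<lambda>_. 0) (c m)"
      using retract_id[OF cV] by simp
    also have "\<dots> = (\<Sum>n<m. u' n * c n)"
      using retract_id[OF cV] by (simp add: u ring_map_sum[OF ring_map_retract] u'_def)
    finally have cm: "c m = (\<Sum>n<m. u' n * c n)" .
    define d where "d = degree (g m)"
    \<comment> \<open>Shifted to degree d, so that by \<open>cm\<close> subtracting all t n from g m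
      cancels its leading coefficient.\<close>
    define t where "t = (\<lambda>n. monom (u' n) (d - degree (g n)) * g n)"
    define h where "h = g m - (\<Sum>n<m. t n)"
    have et: "(\<Sum>n<m. e (t n)) \<in> mul.span (e ` g ` {..<m})"
    proof (intro mul.span_sum)
      fix n assume "n \<in> {..<m}"
      then have "e (g n) \<in> mul.span (e ` g ` {..<m})"
        by (intro mul.span_base) blast
      then show "e (t n) \<in> mul.span (e ` g ` {..<m})"
        unfolding t_def e_simps by (rule mul.span_scale)
    qed
    have "e ` g ` {..<m} \<subseteq> mul.span (range a)"
      using g(1) by (auto simp: I_def)
    then have "mul.span (e ` g ` {..<m}) \<subseteq> mul.span (range a)"
      by (rule mul.span_minimal) simp
    then have "e h \<in> mul.span (range a)"
      using g(1)[of m] et by (auto simp: h_def e_simps I_def intro!: mul.span_diff)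
    moreover have "vars_in V (coeff h n)" for n
      using g(1) by (auto simp: h_def t_def coeff_sum coeff_monom_mult I_def u'_def intro!: vars_in_sum)
    ultimately have "h \<in> I"
      by (simp add: I_def)
    moreover have eh: "e h \<notin> mul.span (e ` g ` {..<m})"
      using g(2)[of m] mul.span_add[OF _ et, of "e h"] by (auto simp: h_def e_simps)
    ultimately have "d \<le> degree h"
      unfolding d_def by (rule least)
    moreover have t_coeff: "coeff (t n) i = (if i = d then u' n * c n else 0)"
      if "n < m" "i \<ge> d" for n i
    proof (cases "i = d")
      case True
      then show ?thesis
        using mono[of n m] that by (auto simp: t_def coeff_monom_mult c_def d_def)
    next
      case False
      then have "i - (d - degree (g n)) > degree (g n)"
        using mono[of n m] that by (auto simp: d_def)
      then show ?thesis
        using False by (simp add: t_def coeff_monom_mult coeff_eq_0)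
    qed
    have "coeff h i = 0" if "i \<ge> d" for i
    proof (cases "i = d")
      case True
      then show ?thesis
        using cm by (simp add: h_def coeff_sum t_coeff) (simp add: c_def d_def)
    next
      case False
      then show ?thesis
        using that by (simp add: h_def coeff_sum t_coeff) (simp add: d_def coeff_eq_0)
    qed
    ultimately have "h = 0"
      using leading_coeff_0_iff[of h] by blast
    then show False
      using eh mul.span_zero[of "e ` g ` {..<m}"] by (simp add: e_def)
  qed
qed

text \<open>If no finite subset sufficed, dependent choice would give a sequence in S with no term
  in the ideal of its predecessors.\<close>

lemma hilbert_basis:
  fixes S :: "'v cpoly set"
  assumes "finite W" "\<And>f. f \<in> S \<Longrightarrow> vars_in W f"
  obtains G where "finite G" "G \<subseteq> S" "S \<subseteq> mul.span G"
proof -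
  have "\<exists>G. finite G \<and> G \<subseteq> S \<and> S \<subseteq> mul.span G"
  proof (rule ccontr)
    assume *: "\<not> ?thesis"
    define Q where "Q = (\<lambda>g (n::nat) f. f \<in> S \<and> f \<notin> mul.span (g ` {..<n}))"
    have "\<exists>g. \<forall>n. Q g n (g n)"
    proof (rule dependent_wellorder_choice)
      fix f and g g' :: "nat \<Rightarrow> 'v cpoly" and n :: nat
      assume eq: "\<And>m. m < n \<Longrightarrow> g m = g' m"
      have "g ` {..<n} = g' ` {..<n}"
        by (rule image_cong) (auto simp: eq)
      then show "Q g n f = Q g' n f"
        unfolding Q_def by simp
    next
      fix n :: nat and g assume g: "\<And>m. m < n \<Longrightarrow> Q g m (g m)"
      have "g ` {..<n} \<subseteq> S"
        using g by (auto simp: Q_def)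
      then have "\<not> S \<subseteq> mul.span (g ` {..<n})"
        using * by blast
      then show "\<exists>f. Q g n f"
        unfolding Q_def by blast
    qed
    then obtain g where Qg: "\<And>n. Q g n (g n)"
      by meson
    have g: "g n \<in> S" "g n \<notin> mul.span (g ` {..<n})" for n
      using Qg[of n] by (simp_all add: Q_def)
    then show False
      using noetherian_sequence[OF assms(1), of g] assms(2) by blast
  qed
  then show thesis
    using that by blast
qed


section \<open>Pseudo-division\<close>

text \<open>The coefficient of z in degree k may fail to be invertible, so f is multiplied by a
  power of it, one factor for each possible degree of f. The bound on q makes the quotient
  homogenize to the expected degree.\<close>

lemma pseudo_division:
  fixes z f :: "'v cpoly poly"
  assumes z: "\<And>n. n > k \<Longrightarrow> coeff z n = 0" "\<And>n. vars_in W (coeff z n)"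
    and "\<And>n. n \<ge> D \<Longrightarrow> coeff f n = 0" "\<And>n. vars_in W (coeff f n)"
  obtains q r where "smult (coeff z k ^ D) f = q * z + r" "\<And>n. n \<ge> k \<Longrightarrow> coeff r n = 0"
    "\<And>n. n + k \<ge> D \<Longrightarrow> coeff q n = 0" "\<And>n. vars_in W (coeff q n)" "\<And>n. vars_in W (coeff r n)"
proof -
  let ?Q = "\<lambda>D f q r. smult (coeff z k ^ D) f = q * z + r \<and> (\<forall>n\<ge>k. coeff r n = 0) \<and>
    (\<forall>n. n + k \<ge> D \<longrightarrow> coeff q n = 0) \<and> (\<forall>n. vars_in W (coeff q n)) \<and> (\<forall>n. vars_in W (coeff r n))"
  have "\<exists>q r. ?Q D f q r"
    using assms(3,4)
  proof (induction D arbitrary: f)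
    case 0
    then have "f = 0"
      by (simp add: poly_eq_iff)
    then show ?case
      by (intro exI[of _ 0]) simp
  next
    case (Suc D)
    show ?case
    proof (cases "D < k")
      case True
      have "coeff f n = 0" if "n \<ge> k" for n
        using Suc.prems(1)[of n] that True by simp
      then have "?Q (Suc D) f 0 (smult (coeff z k ^ Suc D) f)"
        using z(2) Suc.prems(2) by (auto simp del: power_Suc)
      then show ?thesis
        by blast
    next
      case False
      \<comment> \<open>One division step: multiplying f by \<open>coeff z k\<close> makes the top
        coefficient cancel.\<close>
      define m where "m = monom (coeff f D) (D - k)"
      define f' where "f' = smult (coeff z k) f - m * z"
      have "coeff f' n = 0" if "n \<ge> D" for n
      proof (cases "n = D")
        case True
        then show ?thesis
          using False by (simp add: f'_def m_def coeff_monom_mult)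
      next
        case neq: False
        then have "n - (D - k) > k"
          using that False by simp
        then show ?thesis
          using neq that Suc.prems(1)[of n] z(1) by (simp add: f'_def m_def coeff_monom_mult)
      qed
      moreover have "vars_in W (coeff f' n)" for n
        using Suc.prems(2) z(2) by (auto simp: f'_def m_def coeff_monom_mult)
      ultimately obtain q r where qr: "?Q D f' q r"
        using Suc.IH[of f'] by blast
      have "?Q (Suc D) f (q + smult (coeff z k ^ D) m) r"
      proof (intro conjI allI impI)
        have "smult (coeff z k ^ Suc D) f = smult (coeff z k ^ D) (f' + m * z)"
          by (simp add: f'_def mult.commute)
        also have "\<dots> = (q + smult (coeff z k ^ D) m) * z + r"
          using qr by (simp add: smult_add_right algebra_simps)
        finally show "smult (coeff z k ^ Suc D) f = (q + smult (coeff z k ^ D) m) * z + r" .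
        show "coeff r n = 0" if "n \<ge> k" for n
          using qr that by blast
        show "coeff (q + smult (coeff z k ^ D) m) n = 0" if "n + k \<ge> Suc D" for n
        proof -
          have "coeff q n = 0" "D - k \<noteq> n"
            using qr that False by auto
          then show ?thesis
            by (simp add: m_def)
        qed
        show "vars_in W (coeff (q + smult (coeff z k ^ D) m) n)" for n
          using qr Suc.prems(2) z(2) by (auto simp: m_def)
        show "vars_in W (coeff r n)" for n
          using qr by blast
      qed
      then show ?thesis
        by blast
    qed
  qed
  then show thesis
    using that by blast
qed

section \<open>An algebraic Sard lemma\<close>

text \<open>A minimal proper filter below F0 decides each P: if the complement of P does not belong
  to it, intersecting with P gives a proper filter, which by minimality is the same one.\<close>

lemma ultrafilter_exists:
  fixes F0 :: "'a filter"
  assumes "F0 \<noteq> bot"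
  obtains F where "F \<le> F0" "F \<noteq> bot" "\<And>P. eventually P F \<or> eventually (\<lambda>x. \<not> P x) F"
proof -
  define A where "A = {F. F \<le> F0 \<and> F \<noteq> bot}"
  \<comment> \<open>Reversed order, since Zorn's lemma yields maximal elements and a minimal proper
    filter is wanted.\<close>
  define R where "R = (\<lambda>F G :: 'a filter. G \<le> F)"
  have po: "partial_order_on A (relation_of R A)"
    by (rule partial_order_on_relation_ofI) (auto simp: R_def)
  have "\<exists>M\<in>A. \<forall>F\<in>A. R M F \<longrightarrow> F = M"
  proof (rule predicate_Zorn[OF po])
    fix C assume C: "C \<in> Chains (relation_of R A)"
    then have CA: "C \<subseteq> A" and ch: "\<And>F G. F \<in> C \<Longrightarrow> G \<in> C \<Longrightarrow> F \<le> G \<or> G \<le> F"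
      by (auto simp: Chains_def relation_of_def R_def)
    show "\<exists>U\<in>A. \<forall>F\<in>C. R F U"
    proof (cases "C = {}")
      case True
      then show ?thesis
        using assms by (auto simp: A_def)
    next
      case False
      have base: "\<exists>x\<in>C. x \<le> inf F G" if "F \<in> C" "G \<in> C" for F G
        using ch[OF that] that by (auto simp: inf_absorb1 inf_absorb2)
      have "Inf C \<noteq> bot"
      proof
        assume "Inf C = bot"
        then have "eventually (\<lambda>_. False) (Inf C)"
          by simp
        then obtain F where "F \<in> C" "eventually (\<lambda>_. False) F"
          using eventually_Inf_base[OF False base] by blast
        then show False
          using CA by (auto simp: A_def)
      qed
      moreover have "Inf C \<le> F0"
        using False CA by (auto simp: A_def intro: Inf_lower2)
      ultimately show ?thesis
        by (intro bexI[of _ "Inf C"]) (auto simp: A_def R_def intro: Inf_lower)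
    qed
  qed
  then obtain M where M: "M \<le> F0" "M \<noteq> bot"
    and max: "\<And>F. F \<le> F0 \<Longrightarrow> F \<noteq> bot \<Longrightarrow> F \<le> M \<Longrightarrow> F = M"
    by (auto simp: A_def R_def)
  have "eventually P M \<or> eventually (\<lambda>x. \<not> P x) M" for P
  proof (rule disjCI)
    assume nP: "\<not> eventually (\<lambda>x. \<not> P x) M"
    let ?F = "inf M (principal {x. P x})"
    have "?F \<noteq> bot"
      using nP by (simp add: eventually_False[symmetric] eventually_inf_principal)
    then have "?F = M"
      using M(1) by (intro max) (auto intro: le_infI1)
    moreover have "eventually P ?F"
      by (simp add: eventually_inf_principal)
    ultimately show "eventually P M"
      by simp
  qed
  then show thesis
    using that M by blast
qed

text \<open>For an ultrafilter \<open>F\<close> on points, the polynomials vanishing \<open>F\<close>-almost everywhere form a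
  prime ideal. A vector field \<open>v\<close> that satisfies the following condition is a derivation of the
  residue field, defined so far only on the subfield generated by the coordinates in \<open>V\<close>.\<close>

definition tangent_field ::
    "('v \<Rightarrow> complex) filter \<Rightarrow> 'v set \<Rightarrow> (('v \<Rightarrow> complex) \<Rightarrow> 'v \<Rightarrow> complex) \<Rightarrow> bool" where
  "tangent_field F V v \<longleftrightarrow> (\<forall>p. vars_in V p \<longrightarrow>
     (\<forall>\<^sub>F \<xi> in F. value_at \<xi> p = 0) \<longrightarrow> (\<forall>\<^sub>F \<xi> in F. dir \<xi> (v \<xi>) p = 0))"

lemma vars_in_of_nat [simp]: "vars_in W (of_nat n)"
  by (induction n) auto

lemma value_at_of_nat [simp]: "value_at x (of_nat n) = of_nat n"
  by (induction n) auto

lemma dir_zero_vector [simp]: "dir x (\<lambda>_. 0) p = 0"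
  by (induction p rule: cpoly_induct) auto

text \<open>The formal derivative; the one of the library needs a ring without zero divisors.\<close>

definition formal_deriv :: "'a::comm_ring_1 poly \<Rightarrow> 'a poly" where
  "formal_deriv f = (\<Sum>n<degree f. monom (of_nat (Suc n) * coeff f (Suc n)) n)"

lemma coeff_formal_deriv: "coeff (formal_deriv f) n = of_nat (Suc n) * coeff f (Suc n)"
  by (simp add: formal_deriv_def coeff_sum if_distrib coeff_eq_0 cong: if_cong del: of_nat_Suc)

lemma degree_formal_deriv: "degree (formal_deriv f) \<le> degree f - 1"
  by (rule degree_le) (simp add: coeff_formal_deriv coeff_eq_0)

lemma dir_power: "dir x v (p ^ n) = of_nat n * value_at x p ^ (n - 1) * dir x v p"
proof (induction n)
  case (Suc n)
  then show ?case
    by (cases n) (simp_all add: algebra_simps)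
qed simp

lemma dir_poly_Var:
  assumes "\<And>n. vars_in V (coeff f n)" "w \<notin> V"
  shows "dir x (\<lambda>u. if u = w then 1 else 0) (poly f (Var w))
    = value_at x (poly (formal_deriv f) (Var w))"
proof -
  let ?e = "\<lambda>u. if u = w then 1 else 0"
  have "dir x ?e (coeff f n) = dir x (\<lambda>_. 0) (coeff f n)" for n
    by (rule dir_cong[OF assms(1)]) (use assms(2) in auto)
  then have "dir x ?e (poly f (Var w))
      = (\<Sum>n\<le>degree f. value_at x (coeff f n) * (of_nat n * x w ^ (n - 1)))"
    by (simp add: poly_altdef dir_sum dir_power)
  also have "\<dots> = (\<Sum>n<degree f. value_at x (coeff f (Suc n)) * (of_nat (Suc n) * x w ^ n))"
    by (cases "degree f") (simp_all add: sum.atMost_Suc_shift lessThan_Suc_atMost del: sum.atMost_Suc)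
  also have "\<dots> = value_at x (poly (formal_deriv f) (Var w))"
    by (simp add: formal_deriv_def poly_sum poly_monom value_at_sum algebra_simps)
  finally show ?thesis .
qed

text \<open>A derivation extends to one more generator w of the residue field: freely if w is
  transcendental, otherwise by the value forced by differentiating an equation of least degree,
  which is separable in characteristic zero.\<close>

lemma tangent_field_extend:
  fixes F :: "('v \<Rightarrow> complex) filter"
  assumes ultra: "\<And>P. eventually P F \<or> eventually (\<lambda>x. \<not> P x) F" and "F \<noteq> bot"
    and v: "tangent_field F V v" and w: "w \<notin> V"
  shows "\<exists>b. tangent_field F (insert w V) (\<lambda>\<xi>. (v \<xi>)(w := b \<xi>))"
proof -
  define N where "N = (\<lambda>p. \<forall>\<^sub>F \<xi> in F. value_at \<xi> p = 0)"
  define e where "e = (\<lambda>f. poly f (Var w) :: 'v cpoly)"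
  define D where "D = (\<lambda>b \<xi>. dir \<xi> ((v \<xi>)(w := b \<xi>)))"
  have N_add: "N (p + q)" and N_diff: "N (p - q)" if "N p" "N q" for p q
    using that unfolding N_def by (auto elim: eventually_elim2)
  have N_mult: "N (p * q)" if "N q" for p q
    using that unfolding N_def by (auto elim: eventually_mono)
  have not_N: "\<forall>\<^sub>F \<xi> in F. value_at \<xi> p \<noteq> 0" if "\<not> N p" for p
    using ultra[of "\<lambda>\<xi>. value_at \<xi> p = 0"] that by (simp add: N_def)
  have N_sum: "N (sum f A)" if "\<And>a. a \<in> A \<Longrightarrow> N (f a)" for f and A :: "nat set"
    using that by (induction A rule: infinite_finite_induct) (auto intro: N_add, auto simp: N_def)
  have coeffs_null: "\<forall>\<^sub>F \<xi> in F. D b \<xi> (e f) = 0"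
    if f: "\<And>n. vars_in V (coeff f n)" "\<And>n. N (coeff f n)" for f b
  proof -
    have "\<forall>\<^sub>F \<xi> in F. dir \<xi> (v \<xi>) (coeff f n) = 0" for n
      using v f by (auto simp: tangent_field_def N_def)
    then have "\<forall>\<^sub>F \<xi> in F. \<forall>n\<in>{..degree f}. dir \<xi> (v \<xi>) (coeff f n) = 0"
      by (simp add: eventually_ball_finite)
    moreover have "\<forall>\<^sub>F \<xi> in F. \<forall>n\<in>{..degree f}. value_at \<xi> (coeff f n) = 0"
      using f(2) by (simp add: eventually_ball_finite N_def)
    ultimately show ?thesis
    proof eventually_elim
      case (elim \<xi>)
      have "D b \<xi> (coeff f n) = dir \<xi> (v \<xi>) (coeff f n)" for n
        unfolding D_def by (rule dir_cong[OF f(1)]) (use w in auto)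
      then show ?case
        using elim by (simp add: e_def poly_altdef D_def dir_sum)
    qed
  qed
  \<comment> \<open>Nontrivial equations for w over the residue field generated by V; there are none
    exactly when w is transcendental.\<close>
  define Bad where "Bad = {f. (\<forall>n. vars_in V (coeff f n)) \<and> N (e f) \<and> (\<exists>n. \<not> N (coeff f n))}"
  have split: "vars_in V (coeff (split_var w p) n)" if "vars_in (insert w V) p" for p n
    using vars_in_split_var[OF that] w by simp
  have e_split: "e (split_var w p) = p" for p
    by (simp add: e_def poly_split_var)
  show ?thesis
  proof (cases "Bad = {}")
    case True
    show ?thesis
    proof (intro exI[of _ "\<lambda>_. 0"], unfold tangent_field_def, intro allI impI)
      fix p assume p: "vars_in (insert w V) p" "\<forall>\<^sub>F \<xi> in F. value_at \<xi> p = 0"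
      have "split_var w p \<notin> Bad" "N (e (split_var w p))"
        using True p(2) by (auto simp: e_split N_def)
      then have "N (coeff (split_var w p) n)" for n
        using split[OF p(1)] by (auto simp: Bad_def)
      then show "\<forall>\<^sub>F \<xi> in F. dir \<xi> ((v \<xi>)(w := 0)) p = 0"
        using coeffs_null[of "split_var w p" "\<lambda>_. 0"] split[OF p(1)] by (simp add: e_split D_def)
    qed
  next
    case False
    then obtain f where f: "f \<in> Bad" and least: "\<And>g. g \<in> Bad \<Longrightarrow> degree f \<le> degree g"
      using ex_has_least_nat[of "\<lambda>f. f \<in> Bad" _ degree] by blast
    have fV: "vars_in V (coeff f n)" for n
      using f by (auto simp: Bad_def)
    have Nf: "N (e f)"
      using f by (auto simp: Bad_def)
    define c where "c = lead_coeff f"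
    \<comment> \<open>Otherwise deleting the leading term would give a nontrivial equation of
      smaller degree.\<close>
    have c: "\<not> N c"
    proof
      assume Nc: "N c"
      obtain n where n: "\<not> N (coeff f n)"
        using f by (auto simp: Bad_def)
      define f' where "f' = f - monom c (degree f)"
      have "n \<noteq> degree f"
        using n Nc by (auto simp: c_def)
      moreover have "coeff f n \<noteq> 0"
        using n by (auto simp: N_def)
      ultimately have "n < degree f"
        using le_degree[of f n] by simp
      have "degree f' \<le> degree f - 1"
      proof (rule degree_le, intro allI impI)
        fix i assume "degree f - 1 < i"
        then show "coeff f' i = 0"
          by (cases "i = degree f") (auto simp: f'_def c_def coeff_eq_0)
      qed
      moreover have "N (e f')"
        using N_diff[OF Nf N_mult[OF Nc, of "Var w ^ degree f"]]
        by (simp add: f'_def e_def poly_monom mult.commute)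
      then have "f' \<in> Bad"
        using fV n \<open>n < degree f\<close> by (auto simp: Bad_def f'_def c_def intro!: exI[of _ n])
      ultimately show False
        using least[of f'] \<open>n < degree f\<close> by simp
    qed
    have d: "degree f > 0"
    proof (rule ccontr)
      assume "\<not> degree f > 0"
      then have "e f = c"
        by (simp add: e_def c_def poly_altdef)
      then show False
        using c Nf by simp
    qed
    \<comment> \<open>Otherwise the formal derivative would be an equation of smaller degree: in
      characteristic zero its leading coefficient, \<open>degree f\<close> times c, is
      nontrivial.\<close>
    have "\<not> N (e (formal_deriv f))"
    proof
      assume "N (e (formal_deriv f))"
      moreover have "coeff (formal_deriv f) (degree f - 1) = of_nat (degree f) * c"
        using d by (simp add: coeff_formal_deriv c_def)
      then have "\<not> N (coeff (formal_deriv f) (degree f - 1))"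
        using c d by (simp add: N_def)
      ultimately have "formal_deriv f \<in> Bad"
        using fV unfolding Bad_def by (auto simp: coeff_formal_deriv simp del: of_nat_Suc)
      moreover have "degree (formal_deriv f) \<le> degree f - 1"
        by (rule degree_formal_deriv)
      ultimately show False
        using least[of "formal_deriv f"] d by simp
    qed
    then have nz: "\<forall>\<^sub>F \<xi> in F. value_at \<xi> (e (formal_deriv f)) \<noteq> 0"
      by (rule not_N)
    \<comment> \<open>\<open>D b \<xi> (e f)\<close> is affine linear in \<open>b \<xi>\<close>,
      with slope the value of the formal derivative; this is its zero.\<close>
    define b where "b = (\<lambda>\<xi>. - D (\<lambda>_. 0) \<xi> (e f) / value_at \<xi> (e (formal_deriv f)))"
    have Df: "\<forall>\<^sub>F \<xi> in F. D b \<xi> (e f) = 0"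
      using nz
    proof eventually_elim
      case (elim \<xi>)
      have "D b \<xi> (e f) = dir \<xi> (\<lambda>u. 1 * ((v \<xi>)(w := 0)) u + b \<xi> * (if u = w then 1 else 0)) (e f)"
        unfolding D_def by (rule arg_cong[where f = "\<lambda>v. dir \<xi> v (e f)"]) auto
      also have "\<dots> = D (\<lambda>_. 0) \<xi> (e f) + b \<xi> * value_at \<xi> (e (formal_deriv f))"
        unfolding dir_lin using dir_poly_Var[OF fV w] by (simp add: D_def e_def del: fun_upd_apply)
      finally show ?case
        using elim by (simp add: b_def)
    qed
    have "\<forall>\<^sub>F \<xi> in F. D b \<xi> p = 0"
      if p: "vars_in (insert w V) p" "\<forall>\<^sub>F \<xi> in F. value_at \<xi> p = 0" for p
    proof -
      \<comment> \<open>Up to a power of c, any other equation is a multiple of f plus a remainder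
        of smaller degree, whose coefficients are null by minimality.\<close>
      let ?g = "split_var w p"
      define m where "m = Suc (degree ?g)"
      obtain q r where qr: "smult (coeff f (degree f) ^ m) ?g = q * f + r"
        "\<And>n. n \<ge> degree f \<Longrightarrow> coeff r n = 0" "\<And>n. vars_in V (coeff r n)"
        by (rule pseudo_division[of "degree f" f V m ?g])
          (use split[OF p(1)] fV in \<open>auto simp: coeff_eq_0 m_def\<close>)
      have "e (smult (c ^ m) ?g) = e (q * f + r)"
        using qr(1) by (simp add: c_def)
      then have ep: "c ^ m * p = e q * e f + e r"
        using e_split[of p] by (simp add: e_def)
      have "N (c ^ m * p - e q * e f)"
        using p(2) Nf by (intro N_diff N_mult) (simp_all add: N_def)
      then have "N (e r)"
        by (simp add: ep)
      have "N (coeff r n)" for n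
      proof (rule ccontr)
        assume n: "\<not> N (coeff r n)"
        then have "r \<in> Bad"
          using \<open>N (e r)\<close> qr(3) by (auto simp: Bad_def)
        moreover have "degree r < degree f"
          using qr(2) d by (metis leading_coeff_0_iff degree_0 linorder_not_le)
        ultimately show False
          using least[of r] by simp
      qed
      then have "\<forall>\<^sub>F \<xi> in F. D b \<xi> (e r) = 0"
        using coeffs_null[of r b] qr(3) by simp
      moreover have "\<forall>\<^sub>F \<xi> in F. value_at \<xi> (e f) = 0"
        using Nf by (simp add: N_def)
      ultimately show ?thesis
        using Df not_N[OF c] p(2)
      proof eventually_elim
        case (elim \<xi>)
        have "D b \<xi> (c ^ m * p) = D b \<xi> (e q * e f + e r)"
          by (simp add: ep)
        then have "value_at \<xi> c ^ m * D b \<xi> p = 0"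
          using elim by (simp add: D_def)
        then show ?case
          using elim by simp
      qed
    qed
    then show ?thesis
      unfolding tangent_field_def D_def by blast
  qed
qed

lemma tangent_field_extend_finite:
  fixes F :: "('v \<Rightarrow> complex) filter"
  assumes ultra: "\<And>P. eventually P F \<or> eventually (\<lambda>x. \<not> P x) F" "F \<noteq> bot"
    and v: "tangent_field F V v" and "finite W" "W \<inter> V = {}"
  shows "\<exists>v'. tangent_field F (W \<union> V) v' \<and> (\<forall>\<xi>. \<forall>u\<in>V. v' \<xi> u = v \<xi> u)"
  using assms(4,5)
proof (induction W rule: finite_induct)
  case empty
  then show ?case
    using v by auto
next
  case (insert w W)
  then obtain v' where v': "tangent_field F (W \<union> V) v'" "\<forall>\<xi>. \<forall>u\<in>V. v' \<xi> u = v \<xi> u"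
    by auto
  obtain b where "tangent_field F (insert w (W \<union> V)) (\<lambda>\<xi>. (v' \<xi>)(w := b \<xi>))"
    using tangent_field_extend[OF ultra v'(1), of w] insert by auto
  moreover have "\<forall>\<xi>. \<forall>u\<in>V. ((v' \<xi>)(w := b \<xi>)) u = v \<xi> u"
    using v'(2) insert.prems by auto
  ultimately show ?case
    unfolding Un_insert_left by blast
qed

text \<open>The direction a that fails to lift may vary with the point: along the ultrafilter the
  coordinates in \<Lambda> satisfy no equation, so every pointwise choice is a derivation of the
  field they generate. Its extension to W lifts a at some point of B, contrary to the choice of
  a.\<close>

lemma algebraic_sard:
  fixes B :: "('v \<Rightarrow> complex) set"
  assumes fin: "finite \<Lambda>" "finite W" and disj: "W \<inter> \<Lambda> = {}"
    and S: "\<And>f. f \<in> S \<Longrightarrow> vars_in (W \<union> \<Lambda>) f" "\<And>f \<xi>. f \<in> S \<Longrightarrow> \<xi> \<in> B \<Longrightarrow> value_at \<xi> f = 0"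
    and B: "\<And>\<xi>. \<xi> \<in> B \<Longrightarrow> \<exists>a. \<nexists>v. (\<forall>u\<in>\<Lambda>. v u = a u) \<and> (\<forall>f\<in>S. dir \<xi> v f = 0)"
  shows "\<exists>q. q \<noteq> 0 \<and> vars_in \<Lambda> q \<and> (\<forall>\<xi>\<in>B. value_at \<xi> q = 0)"
proof (rule ccontr)
  assume "\<not> ?thesis"
  then have dense: "\<exists>\<xi>\<in>B. value_at \<xi> q \<noteq> 0" if "q \<noteq> 0" "vars_in \<Lambda> q" for q
    using that by blast
  define C where "C = {q. q \<noteq> 0 \<and> vars_in \<Lambda> q}"
  \<comment> \<open>Proper when no nonzero polynomial in \<Lambda> vanishes on B, as finite
    intersections correspond to products.\<close>
  define F0 where "F0 = (INF q\<in>C. principal {\<xi>\<in>B. value_at \<xi> q \<noteq> 0})"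
  have C1: "1 \<in> C"
    by (simp add: C_def)
  have C_mult: "p * q \<in> C" if "p \<in> C" "q \<in> C" for p q
    using that by (auto simp: C_def cpoly_mult_nonzero)
  have ev: "eventually P F0 \<longleftrightarrow> (\<exists>q\<in>C. \<forall>\<xi>\<in>B. value_at \<xi> q \<noteq> 0 \<longrightarrow> P \<xi>)" for P
    unfolding F0_def
  proof (subst eventually_INF_base)
    show "C \<noteq> {}"
      using C1 by blast
    show "\<exists>r\<in>C. principal {\<xi>\<in>B. value_at \<xi> r \<noteq> 0} \<le>
        inf (principal {\<xi>\<in>B. value_at \<xi> p \<noteq> 0}) (principal {\<xi>\<in>B. value_at \<xi> q \<noteq> 0})"
      if "p \<in> C" "q \<in> C" for p q
      using C_mult[OF that] by (intro bexI[of _ "p * q"]) auto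
  qed (auto simp: eventually_principal)
  have "F0 \<noteq> bot"
    unfolding eventually_False[symmetric] ev using dense by (auto simp: C_def)
  then obtain F where F: "F \<le> F0" "F \<noteq> bot" "\<And>P. eventually P F \<or> eventually (\<lambda>x. \<not> P x) F"
    using ultrafilter_exists by blast
  have FB: "\<forall>\<^sub>F \<xi> in F. \<xi> \<in> B"
    by (rule filter_leD[OF F(1)]) (use C1 in \<open>auto simp: ev\<close>)
  have indep: "p = 0" if "vars_in \<Lambda> p" "\<forall>\<^sub>F \<xi> in F. value_at \<xi> p = 0" for p
  proof (rule ccontr)
    assume "p \<noteq> 0"
    then have "\<forall>\<^sub>F \<xi> in F0. value_at \<xi> p \<noteq> 0"
      using that(1) by (auto simp: ev C_def)
    then have "\<forall>\<^sub>F \<xi> in F. value_at \<xi> p \<noteq> 0"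
      using F(1) filter_leD by blast
    with that(2) have "\<forall>\<^sub>F \<xi> in F. False"
      by eventually_elim simp
    then show False
      using F(2) by simp
  qed
  obtain a where a: "\<And>\<xi>. \<xi> \<in> B \<Longrightarrow> \<nexists>v. (\<forall>u\<in>\<Lambda>. v u = a \<xi> u) \<and> (\<forall>f\<in>S. dir \<xi> v f = 0)"
    using B by metis
  have "tangent_field F \<Lambda> a"
    unfolding tangent_field_def
  proof (intro allI impI)
    fix p assume "vars_in \<Lambda> p" "\<forall>\<^sub>F \<xi> in F. value_at \<xi> p = 0"
    then have "p = 0"
      by (rule indep)
    then show "\<forall>\<^sub>F \<xi> in F. dir \<xi> (a \<xi>) p = 0"
      by simp
  qed
  then obtain v where v: "tangent_field F (W \<union> \<Lambda>) v" "\<And>\<xi> u. u \<in> \<Lambda> \<Longrightarrow> v \<xi> u = a \<xi> u"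
    using tangent_field_extend_finite[OF F(3,2) _ fin(2) disj] by blast
  \<comment> \<open>Filters are closed under finite intersections only, so the equations are reduced
    to finitely many.\<close>
  obtain G where G: "finite G" "G \<subseteq> S" "S \<subseteq> mul.span G"
    using hilbert_basis[of "W \<union> \<Lambda>" S] fin S(1) by blast
  have "\<forall>\<^sub>F \<xi> in F. dir \<xi> (v \<xi>) g = 0" if "g \<in> G" for g
  proof -
    have "\<forall>\<^sub>F \<xi> in F. value_at \<xi> g = 0"
      using FB by (rule eventually_mono) (use S(2) G(2) that in blast)
    then show ?thesis
      using v(1) S(1) G(2) that by (auto simp: tangent_field_def)
  qed
  then have "\<forall>\<^sub>F \<xi> in F. \<forall>g\<in>G. dir \<xi> (v \<xi>) g = 0"
    using G(1) by (simp add: eventually_ball_finite)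
  with FB have "\<forall>\<^sub>F \<xi> in F. \<xi> \<in> B \<and> (\<forall>g\<in>G. dir \<xi> (v \<xi>) g = 0)"
    by eventually_elim simp
  then obtain \<xi> where \<xi>: "\<xi> \<in> B" "\<And>g. g \<in> G \<Longrightarrow> dir \<xi> (v \<xi>) g = 0"
    using eventually_happens'[OF F(2)] by blast
  have "value_at \<xi> f = 0 \<and> dir \<xi> (v \<xi>) f = 0" if "f \<in> mul.span G" for f
    using that
  proof (induction rule: mul.span_induct_alt)
    case (step c g f)
    then have "value_at \<xi> g = 0"
      using S(2) G(2) \<xi>(1) by blast
    then show ?case
      using step \<xi>(2) by simp
  qed simp
  then have "\<forall>f\<in>S. dir \<xi> (v \<xi>) f = 0"
    using G(3) by blast
  then show False
    using a[OF \<xi>(1)] v(2) by blast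
qed

section \<open>Homogeneous polynomials\<close>

definition hom_deg :: "nat \<Rightarrow> 'v cpoly \<Rightarrow> bool" where
  "hom_deg d p \<longleftrightarrow>
    (\<forall>m\<in>Poly_Mapping.keys p. (\<Sum>v\<in>Poly_Mapping.keys m. Poly_Mapping.lookup m v) = d)"

lemma homogeneous_iff: "homogeneous p \<longleftrightarrow> (\<exists>d. hom_deg d p)"
  by (simp add: homogeneous_def hom_deg_def)

lemma monomial_degree_add:
  fixes a b :: "'v \<Rightarrow>\<^sub>0 nat"
  shows "(\<Sum>v\<in>Poly_Mapping.keys (a + b). Poly_Mapping.lookup (a + b) v) =
    (\<Sum>v\<in>Poly_Mapping.keys a. Poly_Mapping.lookup a v) +
    (\<Sum>v\<in>Poly_Mapping.keys b. Poly_Mapping.lookup b v)"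
proof -
  let ?A = "Poly_Mapping.keys a \<union> Poly_Mapping.keys b"
  have *: "(\<Sum>v\<in>Poly_Mapping.keys c. Poly_Mapping.lookup c v) = (\<Sum>v\<in>?A. Poly_Mapping.lookup c v)"
    if "Poly_Mapping.keys c \<subseteq> ?A" for c :: "'v \<Rightarrow>\<^sub>0 nat"
    by (rule sum.mono_neutral_left) (use that in \<open>auto simp: in_keys_iff\<close>)
  show ?thesis
    using *[of a] *[of b] *[of "a + b"] Poly_Mapping.keys_add[of a b]
    by (simp add: lookup_add sum.distrib)
qed

lemma hom_deg_add: "hom_deg d p \<Longrightarrow> hom_deg d q \<Longrightarrow> hom_deg d (p + q)"
  using Poly_Mapping.keys_add[of p q] unfolding hom_deg_def by blast

lemma hom_deg_mult: "hom_deg d p \<Longrightarrow> hom_deg e q \<Longrightarrow> hom_deg (d + e) (p * q)"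
  unfolding hom_deg_def
proof
  fix m assume pq: "\<forall>m\<in>Poly_Mapping.keys p. (\<Sum>v\<in>Poly_Mapping.keys m. Poly_Mapping.lookup m v) = d"
    "\<forall>m\<in>Poly_Mapping.keys q. (\<Sum>v\<in>Poly_Mapping.keys m. Poly_Mapping.lookup m v) = e"
    and "m \<in> Poly_Mapping.keys (p * q)"
  then obtain a b where "m = a + b" "a \<in> Poly_Mapping.keys p" "b \<in> Poly_Mapping.keys q"
    using Poly_Mapping.keys_mult[of p q] by blast
  then show "(\<Sum>v\<in>Poly_Mapping.keys m. Poly_Mapping.lookup m v) = d + e"
    using pq by (simp add: monomial_degree_add)
qed

lemma hom_deg_Const [simp]: "hom_deg 0 (Const c)"
  by (auto simp: hom_deg_def Const_def)

lemma hom_deg_1 [simp]: "hom_deg 0 1"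
  using hom_deg_Const[of 1] by (simp add: Const_simps)

lemma hom_deg_Var [simp]: "hom_deg (Suc 0) (Var v)"
  by (auto simp: hom_deg_def Var_def)

lemma hom_deg_power: "hom_deg d p \<Longrightarrow> hom_deg (n * d) (p ^ n)"
  by (induction n) (auto intro: hom_deg_mult)

lemma homogeneous_prod: "(\<And>a. a \<in> A \<Longrightarrow> homogeneous (f a)) \<Longrightarrow> homogeneous (prod f A)"
  by (induction A rule: infinite_finite_induct)
    (auto simp: homogeneous_iff intro: hom_deg_1 hom_deg_mult)

lemma eval_in_hom:
  assumes "hom_deg d g"
  shows "eval_in c (\<lambda>v. t * y v) g = t ^ d * eval_in c y g"
proof -
  have "mon_in (\<lambda>v. t * y v) m = t ^ d * mon_in y m" if "m \<in> Poly_Mapping.keys g" for m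
    using assms that
    by (auto simp: mon_in_def hom_deg_def power_mult_distrib prod.distrib power_sum)
  then show ?thesis
    by (simp add: eval_in_eq sum_distrib_left algebra_simps)
qed

lemma value_at_hom: "hom_deg d g \<Longrightarrow> value_at (\<lambda>v. t * y v) g = t ^ d * value_at y g"
  unfolding value_at_def by (rule eval_in_hom)

text \<open>The degree d need not be optimal: in a sum, powers of \<open>Var i\<close> bring the
  summands to a common degree. Off the hyperplane \<open>x i = 0\<close> the identity determines
  g.\<close>

lemma homogenization:
  "\<exists>d g. hom_deg d g \<and> (\<forall>x. x i \<noteq> 0 \<longrightarrow> value_at x g = x i ^ d * value_at (\<lambda>l. x l / x i) f)"
proof -
  let ?Q = "\<lambda>d f g. hom_deg d g \<and> (\<forall>x. x i \<noteq> 0 \<longrightarrow> value_at x g = x i ^ d * value_at (\<lambda>l. x l / x i) f)"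
  have up: "?Q (n + d) f (Var i ^ n * g)" if "?Q d f g" for d f g n
    using that hom_deg_mult[OF hom_deg_power[OF hom_deg_Var, of n i], of d g]
    by (simp add: power_add)
  have "\<exists>d g. ?Q d f g"
  proof (induction f rule: cpoly_induct)
    case (Const c)
    show ?case
      by (intro exI[of _ "0::nat"] exI[of _ "Const c"]) simp
  next
    case (Var v)
    show ?case
      by (intro exI[of _ "1::nat"] exI[of _ "Var v"]) simp
  next
    case (add p q)
    then obtain d e g h where g: "?Q d p g" and h: "?Q e q h"
      by blast
    have "?Q (e + d) (p + q) (Var i ^ e * g + Var i ^ d * h)"
      using up[OF g, of e] up[OF h, of d]
      by (auto simp: hom_deg_add add.commute distrib_left)
    then show ?case
      by blast
  next
    case (mult p q)
    then obtain d e g h where g: "?Q d p g" and h: "?Q e q h"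
      by blast
    then have "?Q (d + e) (p * q) (g * h)"
      by (auto simp: hom_deg_mult power_add)
    then show ?case
      by blast
  qed
  then show ?thesis .
qed

lemma openin_zariski_scale:
  assumes "openin zariski U" "x \<in> U"
  shows "\<exists>i. x i \<noteq> 0" "c \<noteq> 0 \<Longrightarrow> (\<lambda>i. c * x i) \<in> U"
proof -
  let ?B = "{{x. (\<exists>i. x i \<noteq> 0) \<and> value_at x g \<noteq> 0} | g :: 'a cpoly. homogeneous g}"
  have "generate_topology_on ?B U"
    using assms(1) by (simp add: zariski_def openin_topology_generated_by_iff)
  then have "\<forall>x\<in>U. (\<exists>i. x i \<noteq> 0) \<and> (\<forall>c. c \<noteq> 0 \<longrightarrow> (\<lambda>i. c * x i) \<in> U)"
  proof induction
    case (UN K)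
    then show ?case
      by fast
  next
    case (Basis s)
    then show ?case
      by (auto simp: homogeneous_iff value_at_hom)
  qed auto
  then show "\<exists>i. x i \<noteq> 0" "c \<noteq> 0 \<Longrightarrow> (\<lambda>i. c * x i) \<in> U"
    using assms(2) by auto
qed

lemma quasi_projective_scale:
  assumes "quasi_projective X" "x \<in> X"
  shows "\<exists>i. x i \<noteq> 0" "c \<noteq> 0 \<Longrightarrow> (\<lambda>i. c * x i) \<in> X"
proof -
  obtain Y U where Y: "closedin zariski Y" and U: "openin zariski U" and X: "X = Y \<inter> U"
    using assms(1) by (auto simp: quasi_projective_def)
  have x: "x \<in> U" "x \<in> Y"
    using assms(2) X by auto
  show "\<exists>i. x i \<noteq> 0"
    using openin_zariski_scale(1)[OF U] x by blast
  assume c: "c \<noteq> 0"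
  let ?y = "\<lambda>i. c * x i"
  have yU: "?y \<in> U"
    using openin_zariski_scale(2)[OF U] x c by blast
  have "?y \<in> Y"
  proof (rule ccontr)
    assume "?y \<notin> Y"
    moreover have "?y \<in> topspace zariski"
      using yU openin_subset[OF U] by blast
    ultimately have "(\<lambda>i. (1 / c) * ?y i) \<in> topspace zariski - Y"
      using openin_zariski_scale(2)[of "topspace zariski - Y" ?y "1 / c"] c Y
      by (auto simp: closedin_def)
    then show False
      using c x by simp
  qed
  then show "?y \<in> X"
    using yU X by simp
qed


section \<open>Local equations of a smooth variety at finitely many points\<close>

text \<open>Row rank equals column rank, one row at a time: if the last row vanished on the common
  kernel of the others, it would be a combination of them.\<close>

lemma independent_rows_surjective:
  fixes M :: "nat \<Rightarrow> 'w \<Rightarrow> complex"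
  assumes "finite W"
    and "\<And>c. (\<And>w. w \<in> W \<Longrightarrow> (\<Sum>a<n. c a * M a w) = 0) \<Longrightarrow> \<forall>a<n. c a = 0"
  shows "\<exists>v. (\<forall>w. w \<notin> W \<longrightarrow> v w = 0) \<and> (\<forall>a<n. (\<Sum>w\<in>W. v w * M a w) = t a)"
  using assms(2)
proof (induction n arbitrary: t)
  case 0
  then show ?case
    by (intro exI[of _ "\<lambda>_. 0"]) simp
next
  case (Suc n)
  define row where "row = (\<lambda>a v. \<Sum>w\<in>W. v w * M a w)"
  have row_lin: "row a (\<lambda>w. v w + c * v' w) = row a v + c * row a v'" for a v v' c
    by (simp add: row_def algebra_simps sum.distrib sum_distrib_left)
  have indep: "\<forall>a<n. c a = 0" if c: "\<And>w. w \<in> W \<Longrightarrow> (\<Sum>a<n. c a * M a w) = 0" for c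
  proof -
    have "(\<Sum>a<Suc n. (c(n := 0)) a * M a w) = (\<Sum>a<n. c a * M a w)" for w
      by simp
    then have *: "\<forall>a<Suc n. (c(n := 0)) a = 0"
      using Suc.prems[of "c(n := 0)"] c by presburger
    show ?thesis
    proof (intro allI impI)
      fix a assume "a < n"
      then show "c a = 0"
        using *[rule_format, of a] by simp
    qed
  qed
  have IH: "\<exists>v. (\<forall>w. w \<notin> W \<longrightarrow> v w = 0) \<and> (\<forall>a<n. row a v = t a)" for t
    unfolding row_def by (rule Suc.IH[OF indep])
  have "\<exists>e. (\<forall>w. w \<notin> W \<longrightarrow> e w = 0) \<and> (\<forall>a<n. row a e = (if a = b then 1 else 0))" for b
    by (rule IH)
  then obtain e where e: "\<And>b w. w \<notin> W \<Longrightarrow> e b w = 0"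
    "\<And>b a. a < n \<Longrightarrow> row a (e b) = (if a = b then 1 else 0)"
    by metis
  have "\<exists>v. (\<forall>w. w \<notin> W \<longrightarrow> v w = 0) \<and> (\<forall>a<n. row a v = 0) \<and> row n v \<noteq> 0"
  proof (rule ccontr)
    assume *: "\<not> ?thesis"
    have sum_row: "row a (\<lambda>w. \<Sum>b<n. M b u * e b w) = (\<Sum>b<n. M b u * row a (e b))" for a u
    proof -
      have "row a (\<lambda>w. \<Sum>b<n. M b u * e b w) = (\<Sum>w\<in>W. \<Sum>b<n. M b u * (e b w * M a w))"
        by (simp add: row_def sum_distrib_right mult.assoc)
      also have "\<dots> = (\<Sum>b<n. M b u * row a (e b))"
        by (subst sum.swap) (simp add: row_def sum_distrib_left)
      finally show ?thesis .
    qed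
    \<comment> \<open>A standard basis vector is corrected by the dual vectors e into the common
      kernel; vanishing of row n there expresses its entry at u by the other rows.\<close>
    have Mn: "M n u = (\<Sum>b<n. M b u * row n (e b))" if u: "u \<in> W" for u
    proof -
      let ?\<delta> = "\<lambda>w. if w = u then 1 else 0 :: complex"
      define v where "v = (\<lambda>w. ?\<delta> w + (-1) * (\<Sum>b<n. M b u * e b w))"
      have \<delta>: "row a ?\<delta> = M a u" for a
        using u assms(1) by (simp add: row_def if_distrib[of "\<lambda>z. z * _"] cong: if_cong)
      have rv: "row a v = M a u - (\<Sum>b<n. M b u * row a (e b))" for a
        unfolding v_def row_lin \<delta> sum_row by simp
      have "row a v = 0" if "a < n" for a
        using that by (simp add: rv e(2) if_distrib cong: if_cong)
      moreover have "\<forall>w. w \<notin> W \<longrightarrow> v w = 0"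
        using u e(1) by (auto simp: v_def)
      ultimately have "row n v = 0"
        using * by blast
      then show ?thesis
        by (simp add: rv)
    qed
    define c where "c = (\<lambda>b. if b = n then 1 else - row n (e b))"
    have "(\<Sum>a<Suc n. c a * M a w) = 0" if "w \<in> W" for w
    proof -
      have "(\<Sum>a<n. c a * M a w) = (\<Sum>a<n. - (M a w * row n (e a)))"
        by (rule sum.cong) (auto simp: c_def)
      then show ?thesis
        using Mn[OF that] by (simp add: c_def sum_negf)
    qed
    then have "\<forall>a<Suc n. c a = 0"
      by (rule Suc.prems)
    then show False
      by (auto simp: c_def)
  qed
  then obtain v1 where v1: "\<forall>w. w \<notin> W \<longrightarrow> v1 w = 0" "\<forall>a<n. row a v1 = 0" "row n v1 \<noteq> 0"
    by blast
  obtain v0 where v0: "\<forall>w. w \<notin> W \<longrightarrow> v0 w = 0" "\<forall>a<n. row a v0 = t a"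
    using IH by blast
  let ?v = "\<lambda>w. v0 w + ((t n - row n v0) / row n v1) * v1 w"
  have "row a ?v = t a" if "a < Suc n" for a
    using that v0 v1 unfolding row_lin by (cases "a = n") auto
  then show ?case
    using v0(1) v1(1) by (intro exI[of _ ?v]) (auto simp: row_def)
qed

definition cone_gens :: "('i::finite \<Rightarrow> complex) set \<Rightarrow> 'i cpoly set" where
  "cone_gens X = {g. homogeneous g \<and> (\<forall>x\<in>X. value_at x g = 0)}"

abbreviation cone_ideal :: "('i::finite \<Rightarrow> complex) set \<Rightarrow> 'i cpoly set" where
  "cone_ideal X \<equiv> mul.span (cone_gens X)"

lemma cone_ideal_vanishes:
  assumes "f \<in> cone_ideal X" "x \<in> X"
  shows "value_at x f = 0"
  using assms(1) by (induction rule: mul.span_induct_alt) (use assms(2) in \<open>auto simp: cone_gens_def\<close>)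

lemma span_lin_comb:
  assumes "\<And>a. a \<in> A \<Longrightarrow> g a \<in> mul.span B"
  shows "(\<Sum>a\<in>A. u a * g a) \<in> mul.span B"
  by (intro mul.span_sum mul.span_scale assms)

lemma loc_span_imageE:
  fixes a :: "nat \<Rightarrow> 'v cpoly"
  assumes "f \<in> loc x (mul.span (a ` {..<m}))"
  obtains h u where "value_at x h \<noteq> 0" "h * f = (\<Sum>n<m. u n * a n)"
  using assms by (auto simp: loc_def elim: span_lessThanE)

lemma loc_loc_span:
  assumes "f \<in> loc x (mul.span A)" "\<And>a. a \<in> A \<Longrightarrow> a \<in> loc x (mul.span B)"
  shows "f \<in> loc x (mul.span B)"
proof -
  have "mul.span A \<subseteq> loc x (mul.span B)"
    by (rule mul.span_minimal) (use assms(2) in \<open>auto intro!: subspace_loc\<close>)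
  then show ?thesis
    using assms(1) loc_cancel[of x _ f "mul.span B"] by (auto simp: loc_def[of x "mul.span A"])
qed

text \<open>Smoothness gives equations in an affine chart that belong to the chart ideal only
  locally. Multiplied by functions nonzero at the point they vanish on X in the chart; homogenized
  with an extra factor \<open>Var i\<close> they vanish on all of X. These factors are nonzero at y,
  so the differentials stay independent.\<close>

lemma local_equations_at_point:
  fixes X :: "('i::finite \<Rightarrow> complex) set"
  assumes "CARD('i) = N + 1" and "N = n + c" and "quasi_projective X" and "smooth_of_dim X n"
    and "y \<in> X"
  shows "\<exists>g. (\<forall>a<c. g a \<in> cone_gens X) \<and> (\<forall>t. \<exists>v. \<forall>a<c. dir y v (g a) = t a) \<and>
    cone_ideal X \<subseteq> loc y (mul.span (g ` {..<c}))"
proof -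
  obtain i where i: "y i \<noteq> 0"
    using quasi_projective_scale(1)[OF assms(3,5)] by blast
  define W where "W = UNIV - {i}"
  define y1 where "y1 = (\<lambda>l. y l / y i)"
  have to1: "(\<lambda>l. x l / x i) \<in> X" if "x \<in> X" "x i \<noteq> 0" for x
    using quasi_projective_scale(2)[OF assms(3) that(1), of "1 / x i"] that(2) by simp
  have "smooth_at W (chart_ideal X i) (int n) y1"
    using assms(4) to1[OF assms(5) i] i by (simp add: smooth_of_dim_def W_def y1_def)
  then obtain gs where gs: "set gs \<subseteq> carrier (poly_ring W)" "int (length gs) = int (card W) - int n"
    "same_stalk W y1 (chart_ideal X i) (genideal (poly_ring W) (set gs))"
    "independent_differentials W y1 gs" and "zero_of (chart_ideal X i) y1"
    by (auto simp: smooth_at_def)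
  have len: "length gs = c"
    using gs(2) assms(1,2) by (simp add: W_def card_Diff_subset)
  have gsW: "vars_in W p" if "p \<in> set gs" for p
    using gs(1) that by (auto simp: carrier_poly_ring)
  have span_gs: "genideal (poly_ring W) (set gs) = {p \<in> mul.span (set gs). vars_in W p}"
    by (rule genideal_eq_span) (rule gsW)
  define f where "f = (\<lambda>a. gs ! a)"
  have set_gs: "set gs = f ` {..<c}"
    using len by (auto simp: f_def set_conv_nth)
  have fW: "vars_in W (f a)" if "a < c" for a
    using gsW that len by (simp add: f_def)
  have "\<exists>h. value_at y1 h \<noteq> 0 \<and> h * f a \<in> chart_ideal X i" if "a < c" for a
  proof -
    have "f a \<in> genideal (poly_ring W) (set gs)"
      using fW[OF that] that set_gs unfolding span_gs by (auto intro!: mul.span_base)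
    then show ?thesis
      using gs(3) by (auto simp: same_stalk_def)
  qed
  then obtain h where h: "\<And>a. a < c \<Longrightarrow> value_at y1 (h a) \<noteq> 0"
    "\<And>a. a < c \<Longrightarrow> h a * f a \<in> chart_ideal X i"
    by metis
  define f' where "f' = (\<lambda>a. h a * f a)"
  obtain d G where G: "\<And>a. hom_deg (d a) (G a)"
    "\<And>a x. x i \<noteq> 0 \<Longrightarrow> value_at x (G a) = x i ^ d a * value_at (\<lambda>l. x l / x i) (f' a)"
    using homogenization[of i "f' _"] by metis
  define g where "g = (\<lambda>a. Var i * G a)"
  have f'_zero: "value_at (\<lambda>l. x l / x i) (f' a) = 0" if "a < c" "x \<in> X" "x i \<noteq> 0" for a x
    using h(2)[OF that(1)] to1[OF that(2,3)] that(3) by (simp add: chart_ideal_def f'_def)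
  have g_cone: "g a \<in> cone_gens X" if "a < c" for a
  proof -
    have "homogeneous (g a)"
      using hom_deg_mult[OF hom_deg_Var G(1)] by (auto simp: g_def homogeneous_iff)
    moreover have "value_at x (g a) = 0" if "x \<in> X" for x
      using f'_zero[OF \<open>a < c\<close> that] by (cases "x i = 0") (auto simp: g_def G(2))
    ultimately show ?thesis
      by (simp add: cone_gens_def)
  qed
  \<comment> \<open>Only directions inside the chart are tested. Since \<open>f a\<close> vanishes
    at y1, the derivative of the multiplier \<open>h a\<close> drops out.\<close>
  have dir_g: "dir y v (g a) = y i ^ (d a + 1) * value_at y1 (h a) * dir y1 (\<lambda>l. v l / y i) (f a)"
    if "a < c" "v i = 0" for a v
  proof -
    have "poly (jet y v (g a)) z = poly (smult (y i ^ (d a + 1)) (jet y1 (\<lambda>l. v l / y i) (f' a))) z" for z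
      using that(2) i G(2)[of "\<lambda>w. y w + z * v w"]
      by (simp add: poly_jet g_def y1_def add_divide_distrib)
    then have "jet y v (g a) = smult (y i ^ (d a + 1)) (jet y1 (\<lambda>l. v l / y i) (f' a))"
      using poly_eq_poly_eq_iff by blast
    then have "dir y v (g a) = y i ^ (d a + 1) * dir y1 (\<lambda>l. v l / y i) (f' a)"
      by (simp add: dir_def)
    moreover have "value_at y1 (f a) = 0"
      using f'_zero[OF that(1) assms(5) i] h(1)[OF that(1)] by (simp add: f'_def y1_def)
    ultimately show ?thesis
      by (simp add: f'_def)
  qed
  have "\<exists>v. \<forall>a<c. dir y v (g a) = t a" for t
  proof -
    have "\<exists>v. (\<forall>w. w \<notin> W \<longrightarrow> v w = 0) \<and> (\<forall>a<c. (\<Sum>w\<in>W. v w * partial_deriv w (f a) y1) =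
        t a / (y i ^ (d a + 1) * value_at y1 (h a)))"
      by (rule independent_rows_surjective)
        (use gs(4) len in \<open>auto simp: independent_differentials_def f_def\<close>)
    then obtain v where v: "\<And>w. w \<notin> W \<Longrightarrow> v w = 0"
      "\<And>a. a < c \<Longrightarrow> dir y1 v (f a) = t a / (y i ^ (d a + 1) * value_at y1 (h a))"
      using dir_eq_sum[OF fW] by auto
    have "dir y (\<lambda>l. y i * v l) (g a) = t a" if "a < c" for a
      using dir_g[OF that, of "\<lambda>l. y i * v l"] v(1)[of i] v(2)[OF that] h(1)[OF that] i
      by (simp add: W_def)
    then show ?thesis
      by blast
  qed
  moreover have "cone_gens X \<subseteq> loc y (mul.span (g ` {..<c}))"
  proof
    fix p assume p: "p \<in> cone_gens X"
    then obtain D where D: "hom_deg D p"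
      by (auto simp: cone_gens_def homogeneous_iff)
    define p1 where "p1 = subst (\<lambda>l. if l = i then 1 else Var l) p"
    have p1_value: "value_at x p1 = value_at x p" if "x i = 1" for x
      unfolding p1_def value_at_subst by (rule value_at_cong) (use that in auto)
    have "vars_in W p1"
      unfolding p1_def by (rule vars_in_subst) (auto simp: W_def)
    then have "p1 \<in> chart_ideal X i"
      using p p1_value by (auto simp: chart_ideal_def carrier_poly_ring W_def cone_gens_def)
    then obtain k where "value_at y1 k \<noteq> 0" "k * p1 \<in> genideal (poly_ring W) (set gs)"
      using gs(3) unfolding same_stalk_def by blast
    then have "p1 \<in> loc y1 (mul.span (f ` {..<c}))"
      unfolding span_gs by (auto simp: loc_def set_gs)
    moreover have "f a \<in> loc y1 (mul.span (f' ` {..<c}))" if "a < c" for a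
      using h(1)[OF that] mul.span_base[of "f' a" "f' ` {..<c}"] that
      by (auto simp: loc_def f'_def)
    ultimately have "p1 \<in> loc y1 (mul.span (f' ` {..<c}))"
      using loc_loc_span[of p1 y1 "f ` {..<c}" "f' ` {..<c}"] by blast
    then obtain k u where k: "value_at y1 k \<noteq> 0" "k * p1 = (\<Sum>a<c. u a * f' a)"
      by (rule loc_span_imageE)
    obtain d1 K where K: "\<And>x. x i \<noteq> 0 \<Longrightarrow> value_at x K = x i ^ d1 * value_at (\<lambda>l. x l / x i) k"
      using homogenization[of i k] by blast
    obtain e U where U: "\<And>a x. x i \<noteq> 0 \<Longrightarrow> value_at x (U a) = x i ^ e a * value_at (\<lambda>l. x l / x i) (u a)"
      using homogenization[of i "u _"] by metis
    \<comment> \<open>An exponent that clears the denominators of all c summands.\<close>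
    define M where "M = (\<Sum>a<c. e a + d a + 1)"
    have M: "e a + d a + 1 \<le> M" if "a < c" for a
      unfolding M_def by (rule member_le_sum) (use that in auto)
    define Q where "Q = Var i ^ (M + 1) * K"
    \<comment> \<open>The powers of \<open>Var i\<close> give each summand the exponent of the left
      side, with a spare one so that both sides vanish where \<open>x i = 0\<close>.\<close>
    define r where "r = (\<lambda>a. Var i ^ (1 + d1 + D) * Var i ^ (M - (e a + d a + 1)) * U a)"
    have "Q * p = (\<Sum>a<c. r a * g a)"
    proof (rule cpoly_eqI)
      fix x
      show "value_at x (Q * p) = value_at x (\<Sum>a<c. r a * g a)"
      proof (cases "x i = 0")
        case True
        then show ?thesis
          by (simp add: Q_def r_def value_at_sum)
      next
        case False
        let ?x = "\<lambda>l. x l / x i"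
        have "value_at x p = x i ^ D * value_at ?x p"
          using value_at_hom[OF D, of "x i" ?x] False by simp
        also have "value_at ?x p = value_at ?x p1"
          using p1_value[of ?x] False by simp
        finally have "value_at x (Q * p) = x i ^ (M + 1 + d1 + D) * value_at ?x (k * p1)"
          using False by (simp add: Q_def K power_add)
        also have "\<dots> = (\<Sum>a<c. x i ^ (M + 1 + d1 + D) * (value_at ?x (u a) * value_at ?x (f' a)))"
          by (simp add: k(2) value_at_sum sum_distrib_left)
        also have "\<dots> = (\<Sum>a<c. value_at x (r a * g a))"
        proof (rule sum.cong)
          fix a assume "a \<in> {..<c}"
          then obtain s where s: "M = e a + d a + 1 + s"
            using M[of a] le_Suc_ex by blast
          have "x i ^ (M + 1 + d1 + D) = x i ^ (1 + d1 + D) * x i ^ (M - (e a + d a + 1)) *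
              x i ^ e a * x i ^ d a * x i"
            by (simp add: s power_add)
          then show "x i ^ (M + 1 + d1 + D) * (value_at ?x (u a) * value_at ?x (f' a)) = value_at x (r a * g a)"
            using False by (simp add: r_def g_def U G(2))
        qed simp
        finally show ?thesis
          by (simp add: value_at_sum)
      qed
    qed
    then have "Q * p \<in> mul.span (g ` {..<c})"
      by (simp only:) (intro span_lin_comb mul.span_base imageI)
    moreover have "value_at y Q \<noteq> 0"
      using i k(1) by (simp add: Q_def K y1_def)
    ultimately show "p \<in> loc y (mul.span (g ` {..<c}))"
      by (auto simp: loc_def)
  qed
  then have "cone_ideal X \<subseteq> loc y (mul.span (g ` {..<c}))"
    by (rule mul.span_minimal) (simp add: subspace_loc)
  ultimately show ?thesis
    using g_cone by blast
qed

lemma lagrange_polynomials: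
  fixes T :: "('v \<Rightarrow> complex) set"
  assumes "finite T"
  shows "\<exists>q. \<forall>y\<in>T. \<forall>y'\<in>T. value_at y' (q y) = (if y = y' then 1 else 0)"
proof -
  have "\<exists>p. value_at y p = 1 \<and> value_at y' p = 0" if "y \<noteq> y'" for y y' :: "'v \<Rightarrow> complex"
  proof -
    obtain l where "y l \<noteq> y' l"
      using \<open>y \<noteq> y'\<close> by blast
    then show ?thesis
      by (intro exI[of _ "Const (1 / (y l - y' l)) * (Var l - Const (y' l))"]) simp
  qed
  then have ex: "\<exists>p. value_at (fst z) p = 1 \<and> value_at (snd z) p = 0"
    if "fst z \<noteq> snd z" for z :: "('v \<Rightarrow> complex) \<times> ('v \<Rightarrow> complex)"
    using that by blast
  define p :: "('v \<Rightarrow> complex) \<Rightarrow> ('v \<Rightarrow> complex) \<Rightarrow> 'v cpoly"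
    where "p = (\<lambda>y y'. SOME p. value_at y p = 1 \<and> value_at y' p = 0)"
  have p: "value_at y (p y y') = 1 \<and> value_at y' (p y y') = 0" if "y \<noteq> y'"
    for y y' :: "'v \<Rightarrow> complex"
    unfolding p_def by (rule someI_ex) (use ex[of "(y, y')"] that in simp)
  have "value_at y' (\<Prod>z\<in>T - {y}. p y z) = (if y = y' then 1 else 0)" if "y \<in> T" "y' \<in> T" for y y'
  proof (cases "y = y'")
    case True
    have "value_at y (p y z) = 1" if "z \<in> T - {y}" for z
      using p[of y z] that by auto
    then show ?thesis
      using True by (simp add: value_at_prod)
  next
    case False
    then have "\<exists>z\<in>T - {y}. value_at y' (p y z) = 0"
      using p[OF False] that by (intro bexI[of _ y']) auto
    then show ?thesis
      using False assms by (simp add: value_at_prod)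
  qed
  then show ?thesis
    by (intro exI[of _ "\<lambda>y. \<Prod>z\<in>T - {y}. p y z"]) blast
qed

text \<open>Weights equal to 1 at one point of T and 0 at the others glue the local systems into
  one. Near y it arises from the system at y by a matrix that is the identity at y, so it generates
  the same local ideal.\<close>

lemma local_equations:
  fixes X :: "('i::finite \<Rightarrow> complex) set"
  assumes "CARD('i) = N + 1" and "N = n + c" and "quasi_projective X" and "smooth_of_dim X n"
    and T: "finite T" "T \<subseteq> X"
  obtains g where "\<And>a. a < c \<Longrightarrow> g a \<in> cone_ideal X"
    "\<And>y t. y \<in> T \<Longrightarrow> \<exists>v. \<forall>a<c. dir y v (g a) = t a"
    "\<And>f. f \<in> cone_ideal X \<Longrightarrow> \<exists>h. (\<forall>y\<in>T. value_at y h \<noteq> 0) \<and> h * f \<in> mul.span (g ` {..<c})"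
proof -
  have "\<forall>y\<in>T. \<exists>g. (\<forall>a<c. g a \<in> cone_gens X) \<and> (\<forall>t. \<exists>v. \<forall>a<c. dir y v (g a) = t a) \<and>
    cone_ideal X \<subseteq> loc y (mul.span (g ` {..<c}))"
    using local_equations_at_point[OF assms(1-4)] T(2) by blast
  then obtain G where "\<forall>y\<in>T. (\<forall>a<c. G y a \<in> cone_gens X) \<and>
      (\<forall>t. \<exists>v. \<forall>a<c. dir y v (G y a) = t a) \<and> cone_ideal X \<subseteq> loc y (mul.span (G y ` {..<c}))"
    by metis
  then have G: "\<And>y a. y \<in> T \<Longrightarrow> a < c \<Longrightarrow> G y a \<in> cone_ideal X"
    "\<And>y t. y \<in> T \<Longrightarrow> \<exists>v. \<forall>a<c. dir y v (G y a) = t a"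
    "\<And>y. y \<in> T \<Longrightarrow> cone_ideal X \<subseteq> loc y (mul.span (G y ` {..<c}))"
    by (auto intro: mul.span_base)
  obtain q where q: "\<And>y y'. y \<in> T \<Longrightarrow> y' \<in> T \<Longrightarrow> value_at y' (q y) = (if y = y' then 1 else 0)"
    using lagrange_polynomials[OF T(1)] by blast
  define g where "g = (\<lambda>a. \<Sum>y\<in>T. q y * G y a)"
  have g_cone: "g a \<in> cone_ideal X" if "a < c" for a
    unfolding g_def using G(1) that by (intro mul.span_sum mul.span_scale)
  have dir_g: "dir y v (g a) = dir y v (G y a)" if "y \<in> T" "a < c" for y v a
  proof -
    have "dir y v (q y' * G y' a) = (if y' = y then dir y v (G y a) else 0)" if "y' \<in> T" for y'
      using cone_ideal_vanishes[OF G(1)[OF that \<open>a < c\<close>], of y] q[OF that \<open>y \<in> T\<close>] \<open>y \<in> T\<close> T(2)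
      by auto
    then show ?thesis
      using that(1) T(1) by (simp add: g_def dir_sum)
  qed
  have G_loc: "G y b \<in> loc y (mul.span (g ` {..<c}))" if y: "y \<in> T" and "b < c" for y b
  proof -
    define L where "L = loc y (mul.span (g ` {..<c}))"
    have L: "mul.subspace L"
      by (simp add: L_def subspace_loc)
    text \<open>The elements of the maximal ideal of the local ring at \<open>y\<close> times the ideal of the \<open>G y b\<close>.\<close>
    define M where "M = {f. \<exists>h u. value_at y h = 1 \<and> (\<forall>b. value_at y (u b) = 0) \<and>
        h * f = (\<Sum>b<c. u b * G y b)}"
    have M_add: "f + f' \<in> M" if "f \<in> M" "f' \<in> M" for f f'
    proof -
      obtain h u where 1: "value_at y h = 1" "\<forall>b. value_at y (u b) = 0" "h * f = (\<Sum>b<c. u b * G y b)"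
        using \<open>f \<in> M\<close> by (auto simp: M_def)
      obtain h' u' where 2: "value_at y h' = 1" "\<forall>b. value_at y (u' b) = 0" "h' * f' = (\<Sum>b<c. u' b * G y b)"
        using \<open>f' \<in> M\<close> by (auto simp: M_def)
      have "(h * h') * (f + f') = h' * (h * f) + h * (h' * f')"
        by (simp add: algebra_simps)
      also have "\<dots> = (\<Sum>b<c. (h' * u b + h * u' b) * G y b)"
        unfolding 1(3) 2(3) by (simp add: sum_distrib_left sum.distrib algebra_simps)
      finally show ?thesis
        using 1 2 unfolding M_def
        by (intro CollectI exI[of _ "h * h'"] exI[of _ "\<lambda>b. h' * u b + h * u' b"]) auto
    qed
    have M_0: "0 \<in> M"
      unfolding M_def by (intro CollectI exI[of _ 1] exI[of _ "\<lambda>_. 0"]) simp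
    have M_sum: "sum f A \<in> M" if "\<And>a. a \<in> A \<Longrightarrow> f a \<in> M" for f and A :: "('i \<Rightarrow> complex) set"
      using that by (induction A rule: infinite_finite_induct) (auto intro: M_add M_0)
    have in_M: "q y' * G y' a \<in> M" if "y' \<in> T - {y}" "a < c" for y' a
    proof -
      have "G y' a \<in> loc y (mul.span (G y ` {..<c}))"
        using G(1)[of y' a] G(3)[OF y] that by auto
      then obtain h u where hu: "value_at y h \<noteq> 0" "h * G y' a = (\<Sum>b<c. u b * G y b)"
        by (rule loc_span_imageE)
      let ?k = "Const (1 / value_at y h)"
      have "(?k * h) * (q y' * G y' a) = ?k * q y' * (h * G y' a)"
        by (simp add: algebra_simps)
      also have "\<dots> = (\<Sum>b<c. (?k * q y' * u b) * G y b)"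
        by (simp add: hu(2) sum_distrib_left algebra_simps)
      finally show ?thesis
        using hu(1) q[of y' y] that y unfolding M_def
        by (intro CollectI exI[of _ "?k * h"] exI[of _ "\<lambda>b. ?k * q y' * u b"]) auto
    qed
    have "\<exists>A. (\<Sum>b<c. A b * G y b) \<in> L \<and> (\<forall>b. value_at y (A b) = (if a = b then 1 else 0))"
      if "a < c" for a
    proof -
      have "(\<Sum>y'\<in>T - {y}. q y' * G y' a) \<in> M"
        by (intro M_sum in_M that)
      then obtain h u where hu: "value_at y h = 1" "\<forall>b. value_at y (u b) = 0"
        "h * (\<Sum>y'\<in>T - {y}. q y' * G y' a) = (\<Sum>b<c. u b * G y b)"
        by (auto simp: M_def)
      \<comment> \<open>A row of this matrix: the weight \<open>q y\<close> is 1 at y, and the other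
        points contribute coefficients vanishing at y.\<close>
      define A where "A = (\<lambda>b. (if b = a then h * q y else 0) + u b)"
      have "(\<Sum>b<c. A b * G y b) = (\<Sum>b<c. (if b = a then h * q y * G y b else 0) + u b * G y b)"
        by (rule sum.cong) (auto simp: A_def distrib_right)
      also have "\<dots> = h * q y * G y a + (\<Sum>b<c. u b * G y b)"
        using that by (simp add: sum.distrib)
      also have "\<dots> = h * g a"
        using y T(1) by (simp add: hu(3)[symmetric] g_def sum.remove[of T y] algebra_simps)
      finally have "(\<Sum>b<c. A b * G y b) \<in> mul.span (g ` {..<c})"
        using that by (simp add: mul.span_scale mul.span_base)
      then show ?thesis
        using hu(1,2) q[OF y y] loc_base[of "mul.span (g ` {..<c})" y]
        by (intro exI[of _ A]) (auto simp: A_def L_def)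
    qed
    then obtain A where A: "\<And>a. a < c \<Longrightarrow> (\<Sum>b<c. A a b * G y b) \<in> L"
      "\<And>a b. a < c \<Longrightarrow> value_at y (A a b) = (if a = b then 1 else 0)"
      by metis
    have "G y b \<in> L"
      by (rule local_cramer[of L y c A "G y" 1])
        (use L A \<open>b < c\<close> loc_cancel in \<open>auto simp: L_def\<close>)
    then show ?thesis
      by (simp add: L_def)
  qed
  have "\<exists>h. (\<forall>y\<in>T. value_at y h \<noteq> 0) \<and> h * f \<in> mul.span (g ` {..<c})" if f: "f \<in> cone_ideal X" for f
  proof -
    have "f \<in> loc y (mul.span (g ` {..<c}))" if "y \<in> T" for y
      by (rule loc_loc_span[of f y "G y ` {..<c}"]) (use G(3) G_loc f that in auto)
    then have "\<forall>y\<in>T. \<exists>h. value_at y h \<noteq> 0 \<and> h * f \<in> mul.span (g ` {..<c})"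
      by (auto simp: loc_def)
    then obtain h where h: "\<And>y. y \<in> T \<Longrightarrow> value_at y (h y) \<noteq> 0 \<and> h y * f \<in> mul.span (g ` {..<c})"
      by metis
    \<comment> \<open>The multipliers found at the single points are glued by the same weights into
      one that is nonzero on all of T.\<close>
    have "value_at y (\<Sum>y'\<in>T. q y' * h y') = value_at y (h y)" if "y \<in> T" for y
    proof -
      have "value_at y (\<Sum>y'\<in>T. q y' * h y') = (\<Sum>y'\<in>T. if y' = y then value_at y (h y) else 0)"
        unfolding value_at_sum by (rule sum.cong) (use q that in auto)
      then show ?thesis
        using that T(1) by simp
    qed
    moreover have "(\<Sum>y'\<in>T. q y' * h y') * f = (\<Sum>y'\<in>T. q y' * (h y' * f))"
      by (simp add: sum_distrib_right mult.assoc)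
    then have "(\<Sum>y'\<in>T. q y' * h y') * f \<in> mul.span (g ` {..<c})"
      using h by (simp add: span_lin_comb)
    ultimately show ?thesis
      using h by (intro exI[of _ "\<Sum>y'\<in>T. q y' * h y'"]) auto
  qed
  then show thesis
    using that[of g] g_cone dir_g G(2) by auto
qed

section \<open>Polynomials with coefficients in an ideal\<close>

text \<open>The extension of an ideal A to the polynomial ring over the base; nested, to polynomials
  in two variables.\<close>

definition coeffs_in :: "'a::comm_ring_1 set \<Rightarrow> 'a poly set" where
  "coeffs_in A = {f. \<forall>n. coeff f n \<in> A}"

lemma coeffs_inD: "f \<in> coeffs_in A \<Longrightarrow> coeff f n \<in> A"
  by (simp add: coeffs_in_def)

lemma subspace_coeffs_in:
  assumes "mul.subspace A"
  shows "mul.subspace (coeffs_in A)"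
  unfolding mul.subspace_def coeffs_in_def
  using assms by (auto simp: mul.subspace_0 mul.subspace_add coeff_mult
      intro!: mul.subspace_sum mul.subspace_scale)

lemma coeffs_in_simps:
  assumes "mul.subspace A"
  shows "0 \<in> coeffs_in A" "f \<in> coeffs_in A \<Longrightarrow> g \<in> coeffs_in A \<Longrightarrow> f + g \<in> coeffs_in A"
    "f \<in> coeffs_in A \<Longrightarrow> g \<in> coeffs_in A \<Longrightarrow> f - g \<in> coeffs_in A"
    "f \<in> coeffs_in A \<Longrightarrow> h * f \<in> coeffs_in A" "f \<in> coeffs_in A \<Longrightarrow> smult a f \<in> coeffs_in A"
    "a \<in> A \<Longrightarrow> monom a n \<in> coeffs_in A"
proof -
  note s = subspace_coeffs_in[OF assms]
  show "0 \<in> coeffs_in A" "f \<in> coeffs_in A \<Longrightarrow> g \<in> coeffs_in A \<Longrightarrow> f + g \<in> coeffs_in A"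
    "f \<in> coeffs_in A \<Longrightarrow> g \<in> coeffs_in A \<Longrightarrow> f - g \<in> coeffs_in A"
    "f \<in> coeffs_in A \<Longrightarrow> h * f \<in> coeffs_in A"
    using s by (auto intro: mul.subspace_0 mul.subspace_add mul.subspace_diff mul.subspace_scale)
  show "f \<in> coeffs_in A \<Longrightarrow> smult a f \<in> coeffs_in A"
    using assms by (auto simp: coeffs_in_def intro: mul.subspace_scale)
  show "a \<in> A \<Longrightarrow> monom a n \<in> coeffs_in A"
    using assms by (auto simp: coeffs_in_def mul.subspace_0)
qed

text \<open>Uniqueness of remainders once the leading coefficient is inverted. In degree
  \<open>n + k\<close> only \<open>coeff E n * coeff z k\<close> and coefficients of E of higher
  index occur, so downward induction puts E, and with it r, into A up to powers of
  \<open>coeff z k\<close>.\<close>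

lemma leading_coeff_power_kills:
  assumes A: "mul.subspace A" and z: "\<And>n. n > k \<Longrightarrow> coeff z n = 0"
    and r: "\<And>n. n \<ge> k \<Longrightarrow> coeff r n = 0" and E: "\<And>n. n \<ge> D \<Longrightarrow> coeff E n = 0"
    and rE: "r - E * z \<in> coeffs_in A"
  shows "coeff z k ^ D * coeff r n \<in> A"
proof -
  let ?\<phi> = "coeff z k"
  have kill: "?\<phi> ^ (D - n) * coeff E n \<in> A" for n
  proof (induction "D - n" arbitrary: n rule: less_induct)
    case less
    show ?case
    proof (cases "n \<ge> D")
      case True
      then show ?thesis
        using E A by (simp add: mul.subspace_0)
    next
      case False
      define m where "m = D - Suc n"
      have Dn: "D - n = Suc m"
        using False by (simp add: m_def)
      let ?S = "{..n + k} - {n}"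
      have "coeff (E * z) (n + k) = coeff E n * ?\<phi> + (\<Sum>i\<in>?S. coeff E i * coeff z (n + k - i))"
        by (simp add: coeff_mult sum.remove[of "{..n + k}" n])
      then have "?\<phi> ^ Suc m * coeff E n =
          - (?\<phi> ^ m * coeff (r - E * z) (n + k)) - (\<Sum>i\<in>?S. ?\<phi> ^ m * (coeff E i * coeff z (n + k - i)))"
        using r[of "n + k"] by (simp add: algebra_simps sum_distrib_left)
      also have "\<dots> \<in> A"
      proof (intro mul.subspace_diff[OF A] mul.subspace_neg[OF A] mul.subspace_sum[OF A])
        show "?\<phi> ^ m * coeff (r - E * z) (n + k) \<in> A"
          using coeffs_inD[OF rE] by (intro mul.subspace_scale[OF A])
        fix i assume i: "i \<in> ?S"
        show "?\<phi> ^ m * (coeff E i * coeff z (n + k - i)) \<in> A"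
        proof (cases "i < n")
          case True
          then show ?thesis
            using z[of "n + k - i"] A by (simp add: mul.subspace_0)
        next
          case i_gt: False
          then have "?\<phi> ^ (D - i) * coeff E i \<in> A"
            using less[of i] i False by auto
          moreover have "(m - (D - i)) + (D - i) = m"
            using i_gt i by (auto simp: m_def)
          then have "?\<phi> ^ m = ?\<phi> ^ (m - (D - i)) * ?\<phi> ^ (D - i)"
            by (metis power_add)
          then have "?\<phi> ^ m * (coeff E i * coeff z (n + k - i)) =
              ?\<phi> ^ (m - (D - i)) * coeff z (n + k - i) * (?\<phi> ^ (D - i) * coeff E i)"
            by (simp only: mult_ac)
          ultimately show ?thesis
            using mul.subspace_scale[OF A] by simp
        qed
      qed
      finally show ?thesis
        by (simp add: Dn)
    qed
  qed
  have "?\<phi> ^ D * coeff E n \<in> A" for n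
  proof -
    have "D = (D - (D - n)) + (D - n)"
      by simp
    then have "?\<phi> ^ D * coeff E n = ?\<phi> ^ (D - (D - n)) * (?\<phi> ^ (D - n) * coeff E n)"
      by (metis mult.assoc power_add)
    then show ?thesis
      using mul.subspace_scale[OF A kill[of n]] by simp
  qed
  then have "smult (?\<phi> ^ D) E \<in> coeffs_in A"
    by (simp add: coeffs_in_def)
  then have "smult (?\<phi> ^ D) (r - E * z) + z * smult (?\<phi> ^ D) E \<in> coeffs_in A"
    using coeffs_in_simps(2)[OF A coeffs_in_simps(5)[OF A rE] coeffs_in_simps(4)[OF A]] by blast
  then have "smult (?\<phi> ^ D) r \<in> coeffs_in A"
    by (simp add: smult_diff_right mult.commute)
  then show ?thesis
    using coeffs_inD by fastforce
qed

text \<open>McCoy's argument, by induction on the number of low coefficients of q that may lie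
  outside A.\<close>

lemma mccoy:
  assumes A: "mul.subspace A" and "coeff f e = 1" and "f * q \<in> coeffs_in A"
  shows "q \<in> coeffs_in A"
proof -
  have "q \<in> coeffs_in A" if "\<forall>n\<ge>N. coeff q n \<in> A" "f * q \<in> coeffs_in A" for N q
    using that
  proof (induction N arbitrary: q)
    case 0
    then show ?case
      by (simp add: coeffs_in_def)
  next
    case (Suc N)
    \<comment> \<open>Downwards in i: the product of \<open>coeff f i\<close> with the highest
      doubtful coefficient of q lies in A, so \<open>smult (coeff f i) q\<close> has one doubtful
      coefficient less.\<close>
    have "smult (coeff f i) q \<in> coeffs_in A" for i
    proof (induction "Suc (degree f) - i" arbitrary: i rule: less_induct)
      case less
      show ?case
      proof (cases "i > degree f")
        case True
        then show ?thesis
          using coeffs_in_simps(1)[OF A] by (simp add: coeff_eq_0)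
      next
        case False
        let ?S = "{..i + N} - {i}"
        have "coeff (f * q) (i + N) = coeff f i * coeff q N + (\<Sum>j\<in>?S. coeff f j * coeff q (i + N - j))"
          by (simp add: coeff_mult sum.remove[of "{..i + N}" i])
        then have "coeff f i * coeff q N = coeff (f * q) (i + N) - (\<Sum>j\<in>?S. coeff f j * coeff q (i + N - j))"
          by simp
        also have "\<dots> \<in> A"
        proof (intro mul.subspace_diff[OF A] mul.subspace_sum[OF A])
          show "coeff (f * q) (i + N) \<in> A"
            using Suc.prems(2) by (rule coeffs_inD)
          fix j assume j: "j \<in> ?S"
          show "coeff f j * coeff q (i + N - j) \<in> A"
          proof (cases "j < i")
            case True
            then show ?thesis
              using Suc.prems(1) by (intro mul.subspace_scale[OF A]) auto
          next
            case False
            then have "smult (coeff f j) q \<in> coeffs_in A"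
              using less[of j] j \<open>\<not> i > degree f\<close> by auto
            then show ?thesis
              using coeffs_inD[of "smult (coeff f j) q" A "i + N - j"] by simp
          qed
        qed
        finally have "coeff f i * coeff q N \<in> A" .
        then have "\<forall>n\<ge>N. coeff (smult (coeff f i) q) n \<in> A"
          using Suc.prems(1) mul.subspace_scale[OF A]
          by (metis Suc_leI coeff_smult le_neq_implies_less)
        moreover have "f * smult (coeff f i) q \<in> coeffs_in A"
          using coeffs_in_simps(5)[OF A Suc.prems(2), of "coeff f i"] by (simp add: mult_smult_right)
        ultimately show ?thesis
          by (rule Suc.IH)
      qed
    qed
    from this[of e] show ?case
      using assms(2) by simp
  qed
  moreover have "\<forall>n\<ge>Suc (degree q). coeff q n \<in> A"
    using A by (simp add: coeff_eq_0 mul.subspace_0)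
  ultimately show ?thesis
    using assms(3) by blast
qed

text \<open>Regular modulo every ideal of the base ring. In this form stability under products, the
  analogue of Gauss's lemma, is mere associativity.\<close>

definition primitive_poly :: "'a::comm_ring_1 poly \<Rightarrow> bool" where
  "primitive_poly f \<longleftrightarrow> (\<forall>A q. mul.subspace A \<longrightarrow> f * q \<in> coeffs_in A \<longrightarrow> q \<in> coeffs_in A)"

lemma primitive_poly_1: "primitive_poly 1"
  by (simp add: primitive_poly_def)

lemma primitive_poly_mult: "primitive_poly f \<Longrightarrow> primitive_poly g \<Longrightarrow> primitive_poly (f * g)"
  unfolding primitive_poly_def by (metis mult.assoc)

lemma primitive_poly_power: "primitive_poly f \<Longrightarrow> primitive_poly (f ^ n)"
  by (induction n) (auto intro: primitive_poly_1 primitive_poly_mult)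

lemma primitive_poly_prod: "(\<And>a. a \<in> A \<Longrightarrow> primitive_poly (f a)) \<Longrightarrow> primitive_poly (prod f A)"
  by (induction A rule: infinite_finite_induct) (auto intro: primitive_poly_1 primitive_poly_mult)

text \<open>Modulo A and \<phi> the relation reads \<open>z * q = 0\<close>, so q vanishes there by
  primitivity. Hence q is a multiple of \<phi> modulo A, and \<phi> can be cancelled: it stays
  regular modulo A and z.\<close>

lemma primitive_cancel_step:
  assumes A: "mul.subspace A" and \<phi>: "\<And>f. \<phi> * f \<in> A \<Longrightarrow> f \<in> A" and z: "primitive_poly z"
    and f: "smult \<phi> f - q * z \<in> coeffs_in A" and q: "\<And>n. n > d \<Longrightarrow> coeff q n = 0"
  obtains q' where "f - q' * z \<in> coeffs_in A" "\<And>n. n > d \<Longrightarrow> coeff q' n = 0"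
proof -
  let ?B = "mul.span (insert \<phi> A)"
  have AB: "A \<subseteq> ?B"
    using mul.span_superset by blast
  have sB: "mul.subspace ?B"
    by simp
  have "smult \<phi> f \<in> coeffs_in ?B"
    using mul.span_scale[OF mul.span_base[of \<phi> "insert \<phi> A"], of "coeff f _"]
    by (auto simp: coeffs_in_def mult.commute[of \<phi>])
  moreover have "smult \<phi> f - q * z \<in> coeffs_in ?B"
    using f AB by (auto simp: coeffs_in_def)
  ultimately have "smult \<phi> f - (smult \<phi> f - q * z) \<in> coeffs_in ?B"
    by (rule coeffs_in_simps(3)[OF sB])
  then have "z * q \<in> coeffs_in ?B"
    by (simp add: mult.commute)
  then have "q \<in> coeffs_in ?B"
    using z sB unfolding primitive_poly_def by blast
  then have "\<exists>b. coeff q n - b * \<phi> \<in> mul.span A" for n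
    using mul.span_breakdown_eq coeffs_inD by blast
  then obtain b where b: "\<And>n. coeff q n - b n * \<phi> \<in> A"
    using A by (metis mul.span_eq_iff)
  define q' where "q' = (\<Sum>n\<le>d. monom (b n) n)"
  have q'_coeff: "coeff q' n = (if n \<le> d then b n else 0)" for n
    by (simp add: q'_def coeff_sum)
  have "q - smult \<phi> q' \<in> coeffs_in A"
    unfolding coeffs_in_def
  proof (intro CollectI allI)
    fix n
    show "coeff (q - smult \<phi> q') n \<in> A"
      using b[of n] q[of n] A by (cases "n \<le> d") (auto simp: q'_coeff mult.commute mul.subspace_0)
  qed
  then have "(smult \<phi> f - q * z) + z * (q - smult \<phi> q') \<in> coeffs_in A"
    using coeffs_in_simps(2)[OF A f coeffs_in_simps(4)[OF A]] by blast
  then have "smult \<phi> (f - q' * z) \<in> coeffs_in A"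
    by (simp add: algebra_simps smult_diff_right)
  then have "f - q' * z \<in> coeffs_in A"
    using \<phi> by (auto simp: coeffs_in_def)
  then show thesis
    using that q'_coeff by (metis linorder_not_le)
qed

lemma primitive_cancel_power:
  assumes A: "mul.subspace A" and \<phi>: "\<And>f. \<phi> * f \<in> A \<Longrightarrow> f \<in> A" and z: "primitive_poly z"
    and f: "smult (\<phi> ^ m) f - q * z \<in> coeffs_in A" and q: "\<And>n. n > d \<Longrightarrow> coeff q n = 0"
  shows "\<exists>q'. f - q' * z \<in> coeffs_in A \<and> (\<forall>n>d. coeff q' n = 0)"
  using f q
proof (induction m arbitrary: q)
  case (Suc m)
  then have "smult \<phi> (smult (\<phi> ^ m) f) - q * z \<in> coeffs_in A"
    by simp
  then obtain q' where "smult (\<phi> ^ m) f - q' * z \<in> coeffs_in A" "\<And>n. n > d \<Longrightarrow> coeff q' n = 0"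
    using primitive_cancel_step[OF A \<phi> z] Suc.prems(2) by blast
  then show ?case
    by (rule Suc.IH)
qed auto


section \<open>Binary forms\<close>

text \<open>In a form of degree \<open>d\<close> in \<open>s\<close>, \<open>t\<close> substitute \<open>s = \<tau>\<close>, \<open>t = 1 + \<beta> \<tau>\<close>: the point \<open>(1 : \<beta>)\<close> becomes the
  point at infinity, and the form is recovered by \<open>hmg\<close>. The map \<open>graded\<close> has an additional variable
  which records the degree in \<open>s\<close>, \<open>t\<close>.\<close>

definition dehom :: "complex \<Rightarrow> 'i coord cpoly \<Rightarrow> 'i coord cpoly poly" where
  "dehom \<beta> = eval_in (\<lambda>c. [:Const c:])
     (\<lambda>v. if v = ParS then [:0, 1:] else if v = ParT then [:1, Const \<beta>:] else [:Var v:])"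

definition graded :: "complex \<Rightarrow> 'i coord cpoly \<Rightarrow> 'i coord cpoly poly poly" where
  "graded \<beta> = eval_in (\<lambda>c. [:[:Const c:]:])
     (\<lambda>v. if v = ParS then [:0, [:0, 1:]:] else if v = ParT then [:0, [:1, Const \<beta>:]:] else [:[:Var v:]:])"

definition hmg :: "complex \<Rightarrow> nat \<Rightarrow> 'i coord cpoly poly \<Rightarrow> 'i coord cpoly" where
  "hmg \<beta> d f = (\<Sum>n\<le>d. coeff f n * (Var ParS ^ n * (Var ParT - Const \<beta> * Var ParS) ^ (d - n)))"

lemma ring_map_dehom [simp]: "ring_map (dehom \<beta>)"
  by (simp add: dehom_def eval_in_ring_map)

lemmas dehom_simps [simp] = ring_map_simps[OF ring_map_dehom]

lemma ring_map_const_const_Const [simp]: "ring_map (\<lambda>c. [:[:Const c:]:])"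
  by (rule ring_map_comp[OF ring_map_const_poly ring_map_const_Const])

lemma ring_map_graded [simp]: "ring_map (graded \<beta>)"
  by (simp add: graded_def eval_in_ring_map)

lemmas graded_simps [simp] = ring_map_simps[OF ring_map_graded]

lemma dehom_Const [simp]: "dehom \<beta> (Const c) = [:Const c:]"
  and dehom_Var: "dehom \<beta> (Var v) =
    (if v = ParS then [:0, 1:] else if v = ParT then [:1, Const \<beta>:] else [:Var v:])"
  by (simp_all add: dehom_def)

lemma graded_Const [simp]: "graded \<beta> (Const c) = [:[:Const c:]:]"
  and graded_Var: "graded \<beta> (Var v) = (if v = ParS then [:0, [:0, 1:]:] else
    if v = ParT then [:0, [:1, Const \<beta>:]:] else [:[:Var v:]:])"
  by (simp_all add: graded_def)

lemma dehom_coefficient: "vars_in (- {ParS, ParT}) c \<Longrightarrow> dehom \<beta> c = [:c:]"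
  by (induction c rule: cpoly_induct_in) (auto simp: dehom_Var)

lemma graded_coefficient: "vars_in (- {ParS, ParT}) c \<Longrightarrow> graded \<beta> c = [:[:c:]:]"
  by (induction c rule: cpoly_induct_in) (auto simp: graded_Var)

lemma vars_in_dehom:
  "vars_in (W \<union> {ParS, ParT}) f \<Longrightarrow> vars_in W (coeff (dehom \<beta> f) n)"
proof (induction f arbitrary: n rule: cpoly_induct_in)
  case (Var v)
  then show ?case
    by (auto simp: dehom_Var coeff_pCons split: nat.splits)
qed (auto simp: coeff_mult coeff_pCons intro!: vars_in_sum split: nat.splits)

lemma degree_graded: "n < m \<Longrightarrow> coeff (coeff (graded \<beta> f) n) m = 0"
proof (induction f arbitrary: n m rule: cpoly_induct)
  case (mult p q)
  show ?case
    unfolding graded_simps coeff_mult coeff_sum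
  proof (intro sum.neutral ballI)
    fix i j assume i: "i \<in> {..n}" and j: "j \<in> {..m}"
    show "coeff (coeff (graded \<beta> p) i) j * coeff (coeff (graded \<beta> q) (n - i)) (m - j) = 0"
    proof (cases "i < j")
      case False
      then have "n - i < m - j"
        using i j mult.prems by auto
      then show ?thesis
        by (simp add: mult.IH(2))
    qed (simp add: mult.IH(1))
  qed
qed (auto simp: graded_Var coeff_pCons split: nat.splits)

lemma hmg_add: "hmg \<beta> d (f + g) = hmg \<beta> d f + hmg \<beta> d g"
  by (simp add: hmg_def distrib_right sum.distrib)

lemma hmg_sum: "hmg \<beta> d (sum f A) = (\<Sum>a\<in>A. hmg \<beta> d (f a))"
  by (induction A rule: infinite_finite_induct) (auto simp: hmg_add, auto simp: hmg_def)

lemma hmg_smult: "hmg \<beta> d (smult a f) = a * hmg \<beta> d f"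
  by (simp add: hmg_def sum_distrib_left mult.assoc)

lemma hmg_monom:
  "n \<le> d \<Longrightarrow> hmg \<beta> d (monom a n) = a * (Var ParS ^ n * (Var ParT - Const \<beta> * Var ParS) ^ (d - n))"
  by (simp add: hmg_def if_distrib[of "\<lambda>z. z * _"] cong: if_cong)

lemma poly_bounded_sum:
  assumes "\<And>n. n > d \<Longrightarrow> coeff f n = 0"
  shows "f = (\<Sum>n\<le>d. monom (coeff f n) n)"
  by (rule poly_eqI) (use assms in \<open>auto simp: coeff_sum\<close>)

lemma hmg_mult:
  assumes "\<And>n. n > d \<Longrightarrow> coeff f n = 0" "\<And>n. n > e \<Longrightarrow> coeff g n = 0"
  shows "hmg \<beta> (d + e) (f * g) = hmg \<beta> d f * hmg \<beta> e g"
proof -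
  have "f * g = (\<Sum>n\<le>d. monom (coeff f n) n) * (\<Sum>m\<le>e. monom (coeff g m) m)"
    using poly_bounded_sum[of d f] poly_bounded_sum[of e g] assms by simp
  also have "\<dots> = (\<Sum>n\<le>d. \<Sum>m\<le>e. monom (coeff f n * coeff g m) (n + m))"
    by (simp add: sum_product mult_monom)
  finally have "hmg \<beta> (d + e) (f * g) = hmg \<beta> (d + e) \<dots>"
    by simp
  also have "\<dots> = (\<Sum>n\<le>d. \<Sum>m\<le>e. hmg \<beta> (d + e) (monom (coeff f n * coeff g m) (n + m)))"
    by (simp add: hmg_sum)
  also have "\<dots> = (\<Sum>n\<le>d. \<Sum>m\<le>e.
      (coeff f n * (Var ParS ^ n * (Var ParT - Const \<beta> * Var ParS) ^ (d - n))) *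
      (coeff g m * (Var ParS ^ m * (Var ParT - Const \<beta> * Var ParS) ^ (e - m))))"
  proof (intro sum.cong refl)
    fix n m assume nm: "n \<in> {..d}" "m \<in> {..e}"
    then have "hmg \<beta> (d + e) (monom (coeff f n * coeff g m) (n + m)) = coeff f n * coeff g m *
        (Var ParS ^ (n + m) * (Var ParT - Const \<beta> * Var ParS) ^ ((d - n) + (e - m)))"
      by (simp add: hmg_monom)
    then show "hmg \<beta> (d + e) (monom (coeff f n * coeff g m) (n + m)) =
        (coeff f n * (Var ParS ^ n * (Var ParT - Const \<beta> * Var ParS) ^ (d - n))) *
        (coeff g m * (Var ParS ^ m * (Var ParT - Const \<beta> * Var ParS) ^ (e - m)))"
      by (simp add: power_add algebra_simps)
  qed
  also have "\<dots> = hmg \<beta> d f * hmg \<beta> e g"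
    by (simp add: hmg_def sum_product)
  finally show ?thesis .
qed

text \<open>A form is described by what is used of it: the degree of its dehomogenization, its
  recovery from that, and its concentration in one degree. The quantifier over \<beta> allows the
  same form to be read with two different points at infinity.\<close>

definition is_form :: "nat \<Rightarrow> 'i coord cpoly \<Rightarrow> bool" where
  "is_form d f \<longleftrightarrow> (\<forall>\<beta>. (\<forall>n>d. coeff (dehom \<beta> f) n = 0) \<and> hmg \<beta> d (dehom \<beta> f) = f \<and>
     graded \<beta> f = monom (dehom \<beta> f) d)"

lemma is_form_add: "is_form d f \<Longrightarrow> is_form d g \<Longrightarrow> is_form d (f + g)"
  by (auto simp: is_form_def hmg_add add_monom)

lemma is_form_0: "is_form d 0"
  by (auto simp: is_form_def) (simp add: hmg_def)

lemma is_form_sum: "(\<And>a. a \<in> A \<Longrightarrow> is_form d (f a)) \<Longrightarrow> is_form d (sum f A)"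
  by (induction A rule: infinite_finite_induct) (auto intro: is_form_add is_form_0)

lemma is_form_mult:
  assumes f: "is_form d f" and g: "is_form e g"
  shows "is_form (d + e) (f * g)"
  unfolding is_form_def
proof (intro allI conjI impI)
  fix \<beta>
  have fd: "\<And>n. n > d \<Longrightarrow> coeff (dehom \<beta> f) n = 0" and ge: "\<And>n. n > e \<Longrightarrow> coeff (dehom \<beta> g) n = 0"
    using f g by (auto simp: is_form_def)
  show "hmg \<beta> (d + e) (dehom \<beta> (f * g)) = f * g"
    using f g hmg_mult[OF fd ge] by (simp add: is_form_def)
  show "graded \<beta> (f * g) = monom (dehom \<beta> (f * g)) (d + e)"
    using f g by (simp add: is_form_def mult_monom)
  fix n assume "n > d + e"
  show "coeff (dehom \<beta> (f * g)) n = 0"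
    unfolding dehom_simps coeff_mult
  proof (intro sum.neutral ballI)
    fix i assume "i \<in> {..n}"
    then have "i > d \<or> n - i > e"
      using \<open>n > d + e\<close> by auto
    then show "coeff (dehom \<beta> f) i * coeff (dehom \<beta> g) (n - i) = 0"
      using fd ge by auto
  qed
qed

lemma is_form_coefficient: "vars_in (- {ParS, ParT}) c \<Longrightarrow> is_form 0 c"
  by (auto simp: is_form_def dehom_coefficient graded_coefficient hmg_def monom_0 coeff_pCons
      split: nat.splits)

lemma is_form_1: "is_form 0 1"
  by (rule is_form_coefficient) simp

lemma is_form_ParS: "is_form (Suc 0) (Var ParS)"
  and is_form_ParT: "is_form (Suc 0) (Var ParT)"
  by (auto simp: is_form_def dehom_Var graded_Var hmg_def monom_Suc monom_0 coeff_pCons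
      split: nat.splits)

lemma is_form_power: "is_form d f \<Longrightarrow> is_form (n * d) (f ^ n)"
  by (induction n) (auto intro: is_form_1 is_form_mult)

lemma is_form_prod: "(\<And>a. a \<in> A \<Longrightarrow> is_form (d a) (f a)) \<Longrightarrow> is_form (sum d A) (prod f A)"
  by (induction A rule: infinite_finite_induct) (auto intro: is_form_1 is_form_mult)

lemma is_form_subst:
  assumes "\<And>l. is_form 1 (\<sigma> l)" "hom_deg d g"
  shows "is_form d (subst \<sigma> g)"
  unfolding subst_def eval_in_def
proof (rule is_form_sum)
  fix m assume "m \<in> Poly_Mapping.keys g"
  then have d: "(\<Sum>v\<in>Poly_Mapping.keys m. Poly_Mapping.lookup m v * 1) = d"
    using assms(2) by (simp add: hom_deg_def)
  have "is_form (\<Sum>v\<in>Poly_Mapping.keys m. Poly_Mapping.lookup m v * 1)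
      (\<Prod>v\<in>Poly_Mapping.keys m. \<sigma> v ^ Poly_Mapping.lookup m v)"
    by (intro is_form_prod is_form_power assms(1))
  then have "is_form (0 + d) (Const (Poly_Mapping.lookup g m) *
      (\<Prod>v\<in>Poly_Mapping.keys m. \<sigma> v ^ Poly_Mapping.lookup m v))"
    unfolding d by (intro is_form_mult is_form_coefficient) simp
  then show "is_form d (Const (Poly_Mapping.lookup g m) *
      (\<Prod>v\<in>Poly_Mapping.keys m. \<sigma> v ^ Poly_Mapping.lookup m v))"
    by simp
qed

section \<open>The line, the families of points and Z as binary forms\<close>

lemma S_coords_no_params: "S_coords K i j e \<subseteq> - {ParS, ParT}" "LinePt \<notin> S_coords K i j e"
  by (auto simp: S_coords_def)

lemma vars_in_frame:
  "vars_in (S_coords K i j e) (frame_u i j l)" "vars_in (S_coords K i j e) (frame_v i j l)"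
  by (auto simp: frame_u_def frame_v_def S_coords_def)

lemma vars_in_line_param: "vars_in (S_coords K i j e \<union> {ParS, ParT}) (line_param i j l)"
  unfolding line_param_def
  by (intro vars_in_intros vars_in_mono[OF vars_in_frame(1)] vars_in_mono[OF vars_in_frame(2)]) auto

lemma vars_in_points_form:
  assumes "m \<in># K"
  shows "vars_in (S_coords K i j e \<union> {ParS, ParT}) (points_form K e m)"
  unfolding points_form_def
  by (intro vars_in_sum vars_in_intros vars_in_power) (use assms in \<open>auto simp: S_coords_def\<close>)

lemma vars_in_Z_form: "vars_in (S_coords K i j e \<union> {ParS, ParT}) (Z_form K e)"
  unfolding Z_form_def by (intro vars_in_prod vars_in_power vars_in_points_form) simp

lemma is_form_line_param: "is_form 1 (line_param i j l)"
proof -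
  have "vars_in (- {ParS, ParT}) (frame_u i j l)" "vars_in (- {ParS, ParT}) (frame_v i j l)"
    by (auto simp: frame_u_def frame_v_def)
  then show ?thesis
    using is_form_mult[OF is_form_ParS is_form_coefficient]
      is_form_mult[OF is_form_ParT is_form_coefficient]
    by (auto simp: line_param_def intro: is_form_add)
qed

lemma is_form_points_form: "is_form (count K m) (points_form K e m)"
  unfolding points_form_def
proof (rule is_form_sum)
  fix a assume "a \<in> {..count K m}"
  then have "0 + a * Suc 0 + (count K m - a) * Suc 0 = count K m"
    by simp
  moreover have "is_form (0 + a * Suc 0 + (count K m - a) * Suc 0)
      ((if a = e m then 1 else Var (FormCoeff m a)) * Var ParS ^ a * Var ParT ^ (count K m - a))"
    by (intro is_form_mult is_form_power is_form_ParS is_form_ParT is_form_coefficient) auto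
  ultimately show "is_form (count K m)
      ((if a = e m then 1 else Var (FormCoeff m a)) * Var ParS ^ a * Var ParT ^ (count K m - a))"
    by simp
qed

lemma sum_mset_eq_sum_count: "(\<Sum>m\<in>set_mset K. m * count K m) = sum_mset K"
proof (induction K)
  case (add x K)
  have "(\<Sum>m\<in>set_mset (add_mset x K). m * count (add_mset x K) m) =
      (\<Sum>m\<in>set_mset (add_mset x K). m * count K m + (if m = x then x else 0))"
    by (rule sum.cong) auto
  also have "\<dots> = (\<Sum>m\<in>set_mset (add_mset x K). m * count K m) + x"
    by (simp add: sum.distrib)
  also have "(\<Sum>m\<in>set_mset (add_mset x K). m * count K m) = (\<Sum>m\<in>set_mset K. m * count K m)"
    by (rule sum.mono_neutral_right) (auto simp: not_in_iff)
  finally show ?case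
    using add.IH by simp
qed simp

lemma is_form_Z_form: "is_form (sum_mset K) (Z_form K e)"
  unfolding Z_form_def sum_mset_eq_sum_count[symmetric]
  by (intro is_form_prod is_form_power is_form_points_form)

lemma dehom_ParT_0: "dehom 0 (Var ParT) = 1"
  by (simp add: dehom_Var Const_simps)

lemma monom_power: "[:0, 1:] ^ n = monom (1 :: 'a::comm_ring_1) n"
  by (simp add: monom_altdef)

text \<open>For \<beta> = 0 the dehomogenized point form keeps its own coefficients, one of which is
  normalized to 1, so McCoy's argument applies to each factor.\<close>

lemma primitive_Z_form:
  assumes "\<And>m. m \<in># K \<Longrightarrow> e m \<le> count K m"
  shows "primitive_poly (dehom 0 (Z_form K e :: 'i coord cpoly))"
proof -
  have "primitive_poly (dehom 0 (points_form K e m :: 'i coord cpoly))" if "m \<in># K" for m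
  proof -
    have "dehom 0 (points_form K e m :: 'i coord cpoly) =
        (\<Sum>a\<le>count K m. monom (if a = e m then 1 else Var (FormCoeff m a)) a)"
      unfolding points_form_def ring_map_sum[OF ring_map_dehom]
    proof (rule sum.cong)
      fix a
      show "dehom 0 ((if a = e m then 1 else Var (FormCoeff m a)) * Var ParS ^ a *
          Var ParT ^ (count K m - a)) = monom (if a = e m then 1 else Var (FormCoeff m a)) a"
        by (auto simp: dehom_ParT_0 dehom_Var[of 0 ParS] dehom_Var[of 0 "FormCoeff m a"]
            smult_monom monom_power)
    qed simp
    moreover have "e m \<le> count K m"
      using assms that by blast
    ultimately have "coeff (dehom 0 (points_form K e m :: 'i coord cpoly)) (e m) = 1"
      by (simp add: coeff_sum)
    then show ?thesis
      unfolding primitive_poly_def using mccoy by blast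
  qed
  then show ?thesis
    unfolding Z_form_def ring_map_prod[OF ring_map_dehom] dehom_simps
    by (intro primitive_poly_prod primitive_poly_power) auto
qed

section \<open>Local equations of the aligned Hilbert scheme\<close>

text \<open>The intersection defining \<open>H_ideal\<close> ranges over a nonempty family, as the
  unit ideal qualifies.\<close>

lemma H_ideal_vars:
  fixes X :: "('i::finite \<Rightarrow> complex) set"
  assumes "f \<in> H_ideal X K i j e"
  shows "vars_in (S_coords K i j e) f"
proof -
  let ?R = "S_coords K i j e" and ?R' = "S_coords K i j e \<union> {ParS, ParT}"
  let ?J = "{p \<in> (UNIV :: 'i coord cpoly set). vars_in ?R p}"
  have "ideal ?J (poly_ring ?R)"
    by (rule ideal_poly_ringI) simp
  moreover have "Z_in_closure_mod X K i j e ?J"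
    unfolding Z_in_closure_mod_def
  proof (intro allI impI)
    fix g :: "'i cpoly"
    have "1 \<in> mul.span (insert (Z_form K e) ?J)"
      by (rule mul.span_base) simp
    then have "p * 1 \<in> mul.span (insert (Z_form K e) ?J)" for p
      by (rule mul.span_scale)
    moreover have "vars_in ?R' (subst (line_param i j) g)"
      by (rule vars_in_subst) (rule vars_in_line_param)
    ultimately show "subst (line_param i j) g \<in> genideal (poly_ring ?R') (insert (Z_form K e) ?J)"
      by (subst genideal_eq_span) (auto intro: vars_in_Z_form vars_in_mono)
  qed
  ultimately show ?thesis
    using assms by (auto simp: H_ideal_def)
qed

lemma H_ideal_memI:
  assumes "\<And>J. ideal J (poly_ring (S_coords K i j e)) \<Longrightarrow> Z_in_closure_mod X K i j e J \<Longrightarrow> f \<in> J"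
  shows "f \<in> H_ideal X K i j e"
  using assms by (auto simp: H_ideal_def)

lemma smult_sum_right:
  fixes f :: "'a \<Rightarrow> 'b::comm_ring_1 poly"
  shows "smult a (sum f A) = (\<Sum>i\<in>A. smult a (f i))"
  by (induction A rule: infinite_finite_induct) (auto simp: smult_add_right)

lemma coeffs_in_smult_left: "mul.subspace A \<Longrightarrow> a \<in> A \<Longrightarrow> smult a f \<in> coeffs_in A"
  by (simp add: coeffs_in_def subspace_mult_right)

text \<open>The last assumption says that the point at infinity \<open>(1 : \<beta>)\<close> does
  not lie on the divisor at x, so that near x the equation of Z is monic up to a unit.\<close>

locale aligned_point =
  fixes X :: "('i::finite \<Rightarrow> complex) set" and K :: "nat multiset"
    and i j :: 'i and e :: "nat \<Rightarrow> nat" and x :: "'i coord \<Rightarrow> complex" and \<beta> :: complex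
  assumes chart: "is_S_chart K i j e" and point: "H_point X K i j e x"
    and lead_nonzero: "value_at x (coeff (dehom \<beta> (Z_form K e)) (sum_mset K)) \<noteq> 0"
begin

definition "SC = S_coords K i j e"
definition "k = sum_mset K"
definition z :: "'i coord cpoly poly" where "z = dehom \<beta> (Z_form K e)"
definition "\<phi> = coeff z k"
definition pull :: "'i cpoly \<Rightarrow> 'i coord cpoly poly" where
  "pull f = dehom \<beta> (subst (line_param i j) f)"
definition "H_loc = loc x (mul.span (H_ideal X K i j e))"

lemma i_neq_j: "i \<noteq> j" and e_le: "m \<in># K \<Longrightarrow> e m \<le> count K m"
  using chart by (auto simp: is_S_chart_def)

lemma SC_no_params: "SC \<subseteq> - {ParS, ParT}"
  unfolding SC_def by (rule S_coords_no_params)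

lemma \<phi>_nonzero: "value_at x \<phi> \<noteq> 0"
  using lead_nonzero by (simp add: \<phi>_def z_def k_def)

lemma z_bound: "m > k \<Longrightarrow> coeff z m = 0"
  using is_form_Z_form[of K e] by (auto simp: is_form_def z_def k_def)

lemma z_vars: "vars_in SC (coeff z m)"
  unfolding z_def SC_def by (rule vars_in_dehom) (rule vars_in_Z_form)

lemma \<phi>_vars: "vars_in SC \<phi>"
  by (simp add: \<phi>_def z_vars)

lemma ring_map_pull: "ring_map pull"
  unfolding pull_def[abs_def] by (rule ring_map_comp[OF ring_map_dehom ring_map_subst])

lemmas pull_simps = ring_map_simps[OF ring_map_pull]

lemma pull_vars: "vars_in SC (coeff (pull f) m)"
  unfolding pull_def SC_def by (intro vars_in_dehom vars_in_subst vars_in_line_param)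

lemma pull_form: "hom_deg d g \<Longrightarrow> is_form d (subst (line_param i j) g)"
  by (rule is_form_subst) (rule is_form_line_param)

lemma pull_bound: "hom_deg d g \<Longrightarrow> m > d \<Longrightarrow> coeff (pull g) m = 0"
  using pull_form[of d g] by (auto simp: is_form_def pull_def)

lemma H_loc_subspace: "mul.subspace H_loc"
  by (simp add: H_loc_def subspace_loc)

text \<open>The ideal generated by \<open>z\<close> and \<open>L\<close> after inverting the leading coefficient \<open>\<phi>\<close> of \<open>z\<close>.\<close>

definition near :: "'i coord cpoly set \<Rightarrow> 'i coord cpoly poly set" where
  "near L = {f. \<exists>M A. smult (\<phi> ^ M) f - A * z \<in> coeffs_in L}"

lemma subspace_near:
  assumes L: "mul.subspace L"
  shows "mul.subspace (near L)"
  unfolding mul.subspace_def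
proof (intro conjI ballI allI)
  show "0 \<in> near L"
    unfolding near_def using coeffs_in_simps(1)[OF L] by (auto intro!: exI[of _ 0])
  fix f g h
  assume "f \<in> near L"
  then obtain M A where f: "smult (\<phi> ^ M) f - A * z \<in> coeffs_in L"
    by (auto simp: near_def)
  have "smult (\<phi> ^ M) (h * f) - (h * A) * z = h * (smult (\<phi> ^ M) f - A * z)"
    by (simp add: algebra_simps)
  also have "\<dots> \<in> coeffs_in L"
    by (rule coeffs_in_simps(4)[OF L f])
  finally show "h * f \<in> near L"
    by (auto simp: near_def)
  assume "g \<in> near L"
  then obtain M' A' where g: "smult (\<phi> ^ M') g - A' * z \<in> coeffs_in L"
    by (auto simp: near_def)
  have "smult (\<phi> ^ (M + M')) (f + g) - (smult (\<phi> ^ M') A + smult (\<phi> ^ M) A') * z =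
      smult (\<phi> ^ M') (smult (\<phi> ^ M) f - A * z) + smult (\<phi> ^ M) (smult (\<phi> ^ M') g - A' * z)"
    by (simp add: algebra_simps smult_diff_right smult_add_right power_add)
  also have "\<dots> \<in> coeffs_in L"
    by (rule coeffs_in_simps(2)[OF L coeffs_in_simps(5)[OF L f] coeffs_in_simps(5)[OF L g]])
  finally show "f + g \<in> near L"
    by (auto simp: near_def)
qed

lemma near_z: "mul.subspace L \<Longrightarrow> A * z \<in> near L"
  unfolding near_def by (intro CollectI exI[of _ 0] exI[of _ A]) (simp add: coeffs_in_simps)

lemma near_remainder:
  assumes L: "mul.subspace L" "\<And>f. \<phi> * f \<in> L \<Longrightarrow> f \<in> L"
    and r: "r \<in> near L" "\<And>m. m \<ge> k \<Longrightarrow> coeff r m = 0"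
  shows "coeff r m \<in> L"
proof -
  obtain M A where rA: "smult (\<phi> ^ M) r - A * z \<in> coeffs_in L"
    using r(1) by (auto simp: near_def)
  have "coeff z k ^ Suc (degree A) * coeff (smult (\<phi> ^ M) r) m \<in> L"
    by (rule leading_coeff_power_kills[OF L(1) z_bound _ _ rA]) (use r(2) in \<open>auto simp: coeff_eq_0\<close>)
  then have "\<phi> ^ (Suc (degree A) + M) * coeff r m \<in> L"
    by (simp add: \<phi>_def power_add mult.assoc)
  moreover have "\<phi> ^ l * f \<in> L \<Longrightarrow> f \<in> L" for l f
    by (induction l) (use L(2) in \<open>auto simp: mult.assoc\<close>)
  ultimately show ?thesis
    by blast
qed

lemma loc_\<phi>_cancel: "\<phi> * f \<in> loc x A \<Longrightarrow> f \<in> loc x A"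
  using loc_cancel \<phi>_nonzero by blast

text \<open>Elements of J have degree 0 in s and t, so the ideal they generate is homogeneous and
  membership can be tested one degree at a time.\<close>

lemma graded_span:
  assumes J: "\<And>p. p \<in> J \<Longrightarrow> vars_in SC p" and "f \<in> mul.span J"
  shows "graded \<beta> f \<in> coeffs_in (coeffs_in (mul.span J))"
  using assms(2)
proof (induction rule: mul.span_induct_alt)
  case base
  show ?case
    by (simp add: coeffs_in_simps subspace_coeffs_in)
next
  case (step h a f)
  have "graded \<beta> a = [:[:a:]:]"
    by (rule graded_coefficient) (use J[OF step.hyps] SC_no_params vars_in_mono in blast)
  moreover have "[:[:a:]:] \<in> coeffs_in (coeffs_in (mul.span J))"
    using step.hyps by (auto simp: coeffs_in_def coeff_pCons mul.span_base mul.span_zero split: nat.splits)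
  ultimately have "graded \<beta> h * graded \<beta> a \<in> coeffs_in (coeffs_in (mul.span J))"
    by (simp only:) (intro coeffs_in_simps subspace_coeffs_in mul.subspace_span)
  then show ?case
    unfolding graded_simps
    by (intro coeffs_in_simps(2) subspace_coeffs_in mul.subspace_span step.IH)
qed

text \<open>The exponent of \<open>\<phi>\<close> must be bounded independently of \<open>J\<close>. This holds because the cofactor of
  \<open>Z\<close> can be replaced with its homogeneous component.\<close>

lemma pull_gens_near: 
  assumes g: "g \<in> cone_gens X"
  shows "pull g \<in> near H_loc"
proof -
  obtain d where d: "hom_deg d g"
    using g by (auto simp: cone_gens_def homogeneous_iff)
  obtain q r where qr: "smult (\<phi> ^ Suc d) (pull g) = q * z + r" "\<And>m. m \<ge> k \<Longrightarrow> coeff r m = 0"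
    "\<And>m. m + k \<ge> Suc d \<Longrightarrow> coeff q m = 0" "\<And>m. vars_in SC (coeff r m)"
    unfolding \<phi>_def
    by (rule pseudo_division[of k z SC "Suc d" "pull g"])
      (use z_bound z_vars pull_vars pull_bound[OF d] in auto)
  have "\<phi> ^ Suc d * coeff r m \<in> H_ideal X K i j e" for m
  proof (rule H_ideal_memI)
    fix J assume J: "ideal J (poly_ring (S_coords K i j e))" and ZJ: "Z_in_closure_mod X K i j e J"
    have Jv: "p \<in> J \<Longrightarrow> vars_in SC p" for p
      using ideal_poly_ringD(1)[OF J] by (simp add: SC_def)
    let ?f = "subst (line_param i j) g"
    have "?f \<in> genideal (poly_ring (S_coords K i j e \<union> {ParS, ParT})) (insert (Z_form K e) J)"
      using ZJ g by (auto simp: Z_in_closure_mod_def cone_gens_def)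
    also have "\<dots> \<subseteq> mul.span (insert (Z_form K e) J)"
      by (subst genideal_eq_span)
        (use ideal_poly_ringD(1)[OF J] in \<open>auto intro: vars_in_Z_form vars_in_mono\<close>)
    finally obtain A where "?f - A * Z_form K e \<in> mul.span J"
      by (auto simp: mul.span_breakdown_eq)
    then have "graded \<beta> (?f - A * Z_form K e) \<in> coeffs_in (coeffs_in (mul.span J))"
      using graded_span[of J] Jv by blast
    moreover have "graded \<beta> ?f = monom (pull g) d" "graded \<beta> (Z_form K e) = monom z k"
      using pull_form[OF d] is_form_Z_form[of K e] by (auto simp: is_form_def pull_def z_def k_def)
    ultimately have "monom (pull g) d - graded \<beta> A * monom z k \<in> coeffs_in (coeffs_in (mul.span J))"
      by simp
    then have "coeff (monom (pull g) d - graded \<beta> A * monom z k) d \<in> coeffs_in (mul.span J)"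
      by (rule coeffs_inD)
    then obtain A1 where A1: "pull g - A1 * z \<in> coeffs_in (mul.span J)" "\<And>m. m > d \<Longrightarrow> coeff A1 m = 0"
    proof (cases "k \<le> d")
      case True
      assume "coeff (monom (pull g) d - graded \<beta> A * monom z k) d \<in> coeffs_in (mul.span J)"
      then have "pull g - coeff (graded \<beta> A) (d - k) * z \<in> coeffs_in (mul.span J)"
        using True by (simp add: mult.commute[of _ "monom z k"] coeff_monom_mult) (simp add: mult.commute)
      then show ?thesis
        by (rule that) (simp add: degree_graded less_imp_diff_less)
    next
      case False
      assume "coeff (monom (pull g) d - graded \<beta> A * monom z k) d \<in> coeffs_in (mul.span J)"
      then show ?thesis
        using False
        by (intro that[of 0]) (simp_all add: mult.commute[of _ "monom z k"] coeff_monom_mult)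
    qed
    \<comment> \<open>The exact division modulo J is compared with the pseudo-division, which was
      made before J was given; this shows r to be \<open>E * z\<close> modulo J, with E of bounded
      degree.\<close>
    define E where "E = smult (\<phi> ^ Suc d) A1 - q"
    have "r - E * z = smult (\<phi> ^ Suc d) (pull g - A1 * z)"
      using qr(1) by (simp add: E_def algebra_simps smult_diff_right)
    also have "\<dots> \<in> coeffs_in (mul.span J)"
      by (intro coeffs_in_simps A1) simp
    finally have "coeff z k ^ Suc d * coeff r m \<in> mul.span J"
      by (rule leading_coeff_power_kills[rotated -1]) (use z_bound qr(2,3) A1(2) in \<open>auto simp: E_def\<close>)
    then have "\<phi> ^ Suc d * coeff r m \<in> mul.span J"
      by (simp only: \<phi>_def)
    then show "\<phi> ^ Suc d * coeff r m \<in> J"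
      by (rule ideal_span_subset[OF J])
        (use qr(4) \<phi>_vars in \<open>auto simp: SC_def simp del: power_Suc\<close>)
  qed
  then have "\<phi> ^ Suc d * coeff r m \<in> H_loc" for m
    unfolding H_loc_def using loc_base mul.span_base by blast
  then have "coeff r m \<in> H_loc" for m
    unfolding H_loc_def by (rule loc_cancel[rotated]) (simp add: \<phi>_nonzero)
  then have "r \<in> coeffs_in H_loc"
    by (simp add: coeffs_in_def)
  then show ?thesis
    unfolding near_def using qr(1) by (intro CollectI exI[of _ "Suc d"] exI[of _ q]) simp
qed

lemma pull_near:
  assumes "g \<in> cone_ideal X"
  shows "pull g \<in> near H_loc"
  using assms
proof (induction rule: mul.span_induct_alt)
  case base
  show ?case
    using mul.subspace_0[OF subspace_near[OF H_loc_subspace]] by (simp add: pull_simps)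
next
  case (step h g f)
  then show ?case
    using subspace_near[OF H_loc_subspace] pull_gens_near
    by (simp add: pull_simps mul.subspace_add mul.subspace_scale)
qed

section \<open>The line and the divisor at the closed point x, and local generators of the ideal of
  H\<close>

definition line0 :: "'i \<Rightarrow> complex poly" where
  "line0 l = map_poly (value_at x) (dehom \<beta> (line_param i j l))"

definition z0 :: "complex poly" where
  "z0 = map_poly (value_at x) z"

lemmas ring_map_val = ring_map_map_poly[OF ring_map_value_at]
lemmas val_simps = ring_map_simps[OF ring_map_val]

lemma coeff_z0: "coeff z0 m = value_at x (coeff z m)"
  by (simp add: z0_def coeff_map_poly)

lemma z0_nonzero: "z0 \<noteq> 0" and degree_z0: "degree z0 = k"
proof -
  have 1: "coeff z0 k \<noteq> 0"
    using \<phi>_nonzero by (simp add: coeff_z0 \<phi>_def)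
  have 2: "coeff z0 m = 0" if "m > k" for m
    using that by (simp add: coeff_z0 z_bound)
  show "z0 \<noteq> 0"
    using 1 by auto
  show "degree z0 = k"
    using 1 2 by (metis le_degree degree_le order_antisym)
qed

lemma poly_val_dehom:
  "poly (map_poly (value_at x) (dehom \<beta> f)) \<tau> = value_at (x(ParS := \<tau>, ParT := 1 + \<beta> * \<tau>)) f"
proof (induction f rule: cpoly_induct)
  case (Const a)
  then show ?case
    by (simp add: map_poly_pCons)
next
  case (Var v)
  then show ?case
    by (simp add: dehom_Var map_poly_pCons mult.commute)
qed (simp_all add: val_simps)

lemma poly_val_pull: "poly (map_poly (value_at x) (pull f)) \<tau> = value_at (\<lambda>l. poly (line0 l) \<tau>) f"
  by (simp add: pull_def poly_val_dehom value_at_subst line0_def)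

lemma root_in_X:
  assumes "poly z0 \<tau> = 0"
  shows "(\<lambda>l. poly (line0 l) \<tau>) \<in> X"
proof -
  have "(\<tau>, 1 + \<beta> * \<tau>) \<noteq> (0, 0)"
    by auto
  moreover have "value_at (x(ParS := \<tau>, ParT := 1 + \<beta> * \<tau>)) (Z_form K e) = 0"
    using assms by (simp add: z0_def z_def poly_val_dehom)
  ultimately show ?thesis
    using point by (auto simp: H_point_def support_in_def line0_def poly_val_dehom)
qed

text \<open>The roots of g are split off one at a time; modulo the linear factor of a root, f is a
  nonzero constant.\<close>

lemma bezout_no_common_root:
  fixes f g :: "complex poly"
  assumes "g \<noteq> 0" "\<And>\<tau>. poly g \<tau> = 0 \<Longrightarrow> poly f \<tau> \<noteq> 0"
  shows "\<exists>u v. u * f + v * g = 1"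
  using assms
proof (induction "degree g" arbitrary: g)
  case 0
  then obtain a where "g = [:a:]" "a \<noteq> 0"
    by (metis degree_eq_zeroE pCons_0_0)
  then show ?case
    by (intro exI[of _ 0] exI[of _ "[:1 / a:]"]) (simp add: one_pCons)
next
  case (Suc d)
  have "\<not> constant (poly g)"
    using Suc.hyps(2) by (simp add: constant_degree)
  then obtain \<rho> where \<rho>: "poly g \<rho> = 0"
    using fundamental_theorem_of_algebra by blast
  then obtain g1 where g1: "g = [:- \<rho>, 1:] * g1"
    by (metis dvdE poly_eq_0_iff_dvd)
  have "g1 \<noteq> 0"
    using Suc.prems(1) g1 by auto
  then have "degree g = Suc (degree g1)"
    unfolding g1 by (subst degree_mult_eq) auto
  then obtain u v where uv: "u * f + v * g1 = 1"
    using Suc.hyps(1)[of g1] Suc.hyps(2) Suc.prems(2) \<open>g1 \<noteq> 0\<close> g1 by auto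
  define a where "a = poly f \<rho>"
  have a: "a \<noteq> 0"
    using Suc.prems(2)[OF \<rho>] by (simp add: a_def)
  have "poly (f - [:a:]) \<rho> = 0"
    by (simp add: a_def)
  then obtain w where w: "f - [:a:] = [:- \<rho>, 1:] * w"
    by (metis dvdE poly_eq_0_iff_dvd)
  have 1: "smult (1 / a) (f - [:- \<rho>, 1:] * w) = 1"
    using a unfolding w[symmetric] by (simp add: one_pCons)
  have "1 = u * f + v * g1 * smult (1 / a) (f - [:- \<rho>, 1:] * w)"
    unfolding 1 using uv by simp
  also have "\<dots> = (u + smult (1 / a) (v * g1)) * f + (- smult (1 / a) (v * w)) * g"
    unfolding g1 by (simp add: algebra_simps smult_diff_right smult_add_right)
  finally show ?case
    by metis
qed

text \<open>A version of Nakayama's lemma for remainders modulo \<open>z\<close>.\<close>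

lemma near_unit_cancel:
  assumes L: "mul.subspace L" "\<And>h f. value_at x h \<noteq> 0 \<Longrightarrow> h * f \<in> L \<Longrightarrow> f \<in> L"
    and \<epsilon>: "map_poly (value_at x) \<epsilon> = 0" and r: "r * (1 + \<epsilon>) \<in> near L" "\<And>m. m \<ge> k \<Longrightarrow> coeff r m = 0"
  shows "coeff r m \<in> L"
proof (cases "m < k")
  case True
  note sN = subspace_near[OF L(1)]
  define D where "D = k + Suc (degree (1 + \<epsilon>))"
  have "\<exists>q A. smult (\<phi> ^ D) (monom 1 b * (1 + \<epsilon>)) = q * z + A \<and> (\<forall>m\<ge>k. coeff A m = 0)"
    if "b < k" for b
    unfolding \<phi>_def
  proof (rule pseudo_division[of k z UNIV D "monom 1 b * (1 + \<epsilon>)"])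
    show "coeff (monom 1 b * (1 + \<epsilon>)) m = 0" if "m \<ge> D" for m
      using that \<open>b < k\<close> coeff_eq_0[of "1 + \<epsilon>" "m - b"] by (simp add: coeff_monom_mult D_def)
  qed (use z_bound in \<open>auto simp: vars_in_def\<close>)
  \<comment> \<open>\<open>A b\<close> is column b of multiplication by
    \<open>1 + \<epsilon>\<close> on remainders modulo z, in the basis of powers of \<tau> and up to
    the factor \<open>\<phi> ^ D\<close>.\<close>
  then obtain q A where qA: "\<And>b. b < k \<Longrightarrow> smult (\<phi> ^ D) (monom 1 b * (1 + \<epsilon>)) = q b * z + A b"
    "\<And>b m. b < k \<Longrightarrow> m \<ge> k \<Longrightarrow> coeff (A b) m = 0"
    by metis
  have r_eq: "r = (\<Sum>b<k. smult (coeff r b) (monom 1 b))"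
    by (rule poly_eqI) (use r(2) in \<open>auto simp: coeff_sum smult_monom\<close>)
  define w where "w = (\<Sum>b<k. smult (coeff r b) (A b))"
  have "smult (\<phi> ^ D) (r * (1 + \<epsilon>)) =
      smult (\<phi> ^ D) ((\<Sum>b<k. smult (coeff r b) (monom 1 b)) * (1 + \<epsilon>))"
    using r_eq by simp
  also have "\<dots> = (\<Sum>b<k. smult (coeff r b) (smult (\<phi> ^ D) (monom 1 b * (1 + \<epsilon>))))"
    by (simp add: sum_distrib_right sum_distrib_left smult_sum_right mult.commute)
  also have "\<dots> = (\<Sum>b<k. smult (coeff r b) (q b * z + A b))"
    by (rule sum.cong) (use qA(1) in auto)
  also have "\<dots> = (\<Sum>b<k. smult (coeff r b) (q b)) * z + w"
    by (simp add: w_def smult_add_right sum.distrib sum_distrib_right)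
  finally have "w = smult (\<phi> ^ D) (r * (1 + \<epsilon>)) - (\<Sum>b<k. smult (coeff r b) (q b)) * z"
    by simp
  also have "\<dots> = [:\<phi> ^ D:] * (r * (1 + \<epsilon>)) - (\<Sum>b<k. smult (coeff r b) (q b)) * z"
    by simp
  also have "\<dots> \<in> near L"
    by (rule mul.subspace_diff[OF sN mul.subspace_scale[OF sN r(1)] near_z[OF L(1)]])
  finally have "w \<in> near L" .
  moreover have "coeff w m = 0" if "m \<ge> k" for m
    using that by (simp add: w_def coeff_sum qA(2))
  ultimately have wL: "coeff w a \<in> L" for a
    using near_remainder[OF L(1), of w a] L(2)[OF \<phi>_nonzero] by blast
  have A_x: "value_at x (coeff (A b) a) = (if a = b then value_at x \<phi> ^ D else 0)" if "b < k" for a b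
  proof -
    let ?v = "map_poly (value_at x)"
    have m: "?v (monom 1 b) = monom 1 b"
      by (rule poly_eqI) (simp add: coeff_map_poly)
    have s: "?v (smult p f) = smult (value_at x p) (?v f)" for p f
      by (rule poly_eqI) (simp add: coeff_map_poly)
    have eq: "smult (value_at x \<phi> ^ D) (monom 1 b) = ?v (q b) * z0 + ?v (A b)"
      using arg_cong[OF qA(1)[OF that], of ?v] \<epsilon> by (simp add: s m val_simps z0_def)
    \<comment> \<open>A multiple of z0 of degree below k, hence zero: at x the matrix is
      \<open>\<phi> ^ D\<close> times the identity.\<close>
    define R where "R = smult (value_at x \<phi> ^ D) (monom 1 b) - ?v (A b)"
    have "R = ?v (q b) * z0"
      unfolding R_def eq by simp
    moreover have "coeff R m = 0" if "m \<ge> k" for m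
      using that \<open>b < k\<close> qA(2) by (auto simp: R_def coeff_map_poly)
    then have "R = 0 \<or> degree R < degree z0"
      unfolding degree_z0 by (metis leading_coeff_0_iff linorder_not_le)
    ultimately have "R = 0"
      by (metis degree_mult_right_le linorder_not_le mult_eq_0_iff mult.commute)
    then have "coeff R a = 0"
      by simp
    then show ?thesis
      by (auto simp: R_def coeff_map_poly)
  qed
  show ?thesis
  proof (rule local_cramer[of L x k "\<lambda>a b. coeff (A b) a" "coeff r" "value_at x \<phi> ^ D"])
    show "(\<Sum>b<k. coeff (A b) a * coeff r b) \<in> L" for a
      using wL[of a] by (simp add: w_def coeff_sum mult.commute)
    show "value_at x (coeff (A b) a) = (if a = b then value_at x \<phi> ^ D else 0)" if "b < k" for a b
      by (rule A_x[OF that])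
    show "f \<in> L" if "value_at x h \<noteq> 0" "h * f \<in> L" for h f
      by (rule L(2)[OF that])
    show "value_at x \<phi> ^ D \<noteq> 0"
      using \<phi>_nonzero by simp
  qed (rule L(1) True)+
next
  case False
  then show ?thesis
    using r(2) L(1) by (simp add: mul.subspace_0)
qed

text \<open>The contraction J of the local ideal generated by S takes part in the intersection
  defining \<open>H_ideal\<close>. To see that it is admissible, an element of the cone ideal is
  expressed by the g only up to a multiplier h; as h is nonzero at the points of Z, it is invertible
  modulo z near x.\<close>

lemma H_ideal_locally_generated:
  fixes c :: nat
  assumes S: "\<And>p. p \<in> S \<Longrightarrow> vars_in SC p"
    and g: "\<And>a. a < c \<Longrightarrow> pull (g a) \<in> near (loc x (mul.span S))"
    and gen: "\<And>f. f \<in> cone_ideal X \<Longrightarrow>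
      \<exists>h. (\<forall>\<tau>. poly z0 \<tau> = 0 \<longrightarrow> value_at (\<lambda>l. poly (line0 l) \<tau>) h \<noteq> 0) \<and> h * f \<in> mul.span (g ` {..<c})"
  shows "H_ideal X K i j e \<subseteq> loc x (mul.span S)"
proof -
  define L where "L = loc x (mul.span S)"
  have L: "mul.subspace L" "\<And>h f. value_at x h \<noteq> 0 \<Longrightarrow> h * f \<in> L \<Longrightarrow> f \<in> L"
    using loc_cancel by (auto simp: L_def subspace_loc)
  have L\<phi>: "\<phi> * f \<in> L \<Longrightarrow> f \<in> L" for f
    using L(2)[OF \<phi>_nonzero] .
  note sN = subspace_near[OF L(1)]
  define J where "J = {p \<in> L. vars_in SC p}"
  have J_ideal: "ideal J (poly_ring (S_coords K i j e))"
    unfolding J_def SC_def[symmetric] by (rule ideal_poly_ringI[OF L(1)])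
  define \<rho> where "\<rho> = retract SC x"
  have \<rho>: "\<rho> f \<in> J" if f: "f \<in> L" for f
  proof -
    obtain h where h: "value_at x h \<noteq> 0" "h * f \<in> mul.span S"
      using f by (auto simp: L_def loc_def)
    have "\<rho> p \<in> mul.span S" if "p \<in> mul.span S" for p
      using that
    proof (induction rule: mul.span_induct_alt)
      case (step c a q)
      then have "\<rho> a \<in> mul.span S"
        using S by (simp add: \<rho>_def retract_id mul.span_base)
      then show ?case
        using step.IH by (simp add: \<rho>_def mul.span_add mul.span_scale)
    qed (simp add: \<rho>_def mul.span_zero)
    from this[OF h(2)] have "\<rho> h * \<rho> f \<in> mul.span S"
      by (simp add: \<rho>_def)
    then have "\<rho> f \<in> L"
      using h(1) unfolding L_def loc_def \<rho>_def by (intro CollectI exI[of _ "retract SC x h"]) simp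
    then show ?thesis
      by (simp add: J_def \<rho>_def)
  qed
  have \<rho>_map: "map_poly \<rho> f = f" if "\<And>m. vars_in SC (coeff f m)" for f
    by (rule poly_eqI) (use that in \<open>simp add: coeff_map_poly \<rho>_def retract_id\<close>)
  have ring_map_\<rho>: "ring_map (map_poly \<rho>)"
    unfolding \<rho>_def by (intro ring_map_map_poly ring_map_retract)
  have "Z_in_closure_mod X K i j e J"
    unfolding Z_in_closure_mod_def
  proof (intro allI impI)
    fix p :: "'i cpoly" assume p: "homogeneous p \<and> (\<forall>x\<in>X. value_at x p = 0)"
    obtain d where d: "hom_deg d p"
      using p by (auto simp: homogeneous_iff)
    have "p \<in> cone_ideal X"
      using p by (auto simp: cone_gens_def intro: mul.span_base)
    then obtain h where h: "\<And>\<tau>. poly z0 \<tau> = 0 \<Longrightarrow> value_at (\<lambda>l. poly (line0 l) \<tau>) h \<noteq> 0"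
      "h * p \<in> mul.span (g ` {..<c})"
      using gen by blast
    have "pull f \<in> near L" if "f \<in> mul.span (g ` {..<c})" for f
      using that
    proof (induction rule: mul.span_induct_alt)
      case base
      show ?case
        using mul.subspace_0[OF sN] by (simp add: pull_simps)
    next
      case (step u a f)
      then have "pull a \<in> near L"
        using g by (auto simp: L_def)
      then show ?case
        using step.IH sN by (simp add: pull_simps mul.subspace_add mul.subspace_scale)
    qed
    then have hp: "pull h * pull p \<in> near L"
      using h(2) by (simp flip: pull_simps(4))
    let ?v = "map_poly (value_at x)"
    \<comment> \<open>An inverse of h on the scheme \<open>z0 = 0\<close>. Lifted with constant
      coefficients it is an inverse modulo z up to \<epsilon>, which vanishes at x.\<close>
    obtain u v where uv: "u * ?v (pull h) + v * z0 = 1"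
      using bezout_no_common_root[OF z0_nonzero, of "?v (pull h)"] h(1) by (auto simp: poly_val_pull)
    let ?U = "map_poly Const u" and ?V = "map_poly Const v"
    have vC: "?v (map_poly Const f) = f" for f
      by (rule poly_eqI) (simp add: coeff_map_poly Const_simps)
    define \<epsilon> where "\<epsilon> = ?U * pull h + ?V * z - 1"
    have \<epsilon>: "?v \<epsilon> = 0"
      using uv by (simp add: \<epsilon>_def val_simps vC z0_def)
    have "pull p * (1 + \<epsilon>) = ?U * (pull h * pull p) + pull p * ?V * z"
      by (simp add: \<epsilon>_def algebra_simps)
    also have "\<dots> \<in> near L"
      by (rule mul.subspace_add[OF sN mul.subspace_scale[OF sN hp] near_z[OF L(1)]])
    finally have p\<epsilon>: "pull p * (1 + \<epsilon>) \<in> near L" .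
    obtain q r where qr: "smult (\<phi> ^ Suc d) (pull p) = q * z + r" "\<And>m. m \<ge> k \<Longrightarrow> coeff r m = 0"
      "\<And>m. m + k \<ge> Suc d \<Longrightarrow> coeff q m = 0" "\<And>m. vars_in SC (coeff q m)" "\<And>m. vars_in SC (coeff r m)"
      unfolding \<phi>_def
      by (rule pseudo_division[of k z SC "Suc d" "pull p"])
        (use z_bound z_vars pull_vars pull_bound[OF d] in auto)
    have "r * (1 + \<epsilon>) = (smult (\<phi> ^ Suc d) (pull p) - q * z) * (1 + \<epsilon>)"
      using qr(1) by simp
    also have "\<dots> = [:\<phi> ^ Suc d:] * (pull p * (1 + \<epsilon>)) - (q * (1 + \<epsilon>)) * z"
      by (simp add: algebra_simps)
    also have "\<dots> \<in> near L"
      by (rule mul.subspace_diff[OF sN mul.subspace_scale[OF sN p\<epsilon>] near_z[OF L(1)]])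
    finally have r\<epsilon>: "r * (1 + \<epsilon>) \<in> near L" .
    have rL: "coeff r m \<in> L" for m
      by (rule near_unit_cancel[OF L(1) _ \<epsilon> r\<epsilon> qr(2)]) (use L(2) in blast)+
    let ?f = "subst (line_param i j) p" and ?Z = "Z_form K e :: 'i coord cpoly"
    have f_form: "is_form d ?f" and Z_form: "is_form k ?Z"
      using pull_form[OF d] is_form_Z_form[of K e] by (auto simp: k_def)
    have f_hmg: "hmg b d (dehom b ?f) = ?f" and Z_hmg: "hmg b k (dehom b ?Z) = ?Z"
      and f_bound: "m > d \<Longrightarrow> coeff (dehom b ?f) m = 0" and Z_bound: "m > k \<Longrightarrow> coeff (dehom b ?Z) m = 0" for b m
      using f_form Z_form by (auto simp: is_form_def)
    have f_vars: "vars_in SC (coeff (dehom b ?f) m)" and Z_vars: "vars_in SC (coeff (dehom b ?Z) m)" for b m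
      unfolding SC_def by (intro vars_in_dehom vars_in_subst vars_in_line_param vars_in_Z_form)+
    \<comment> \<open>The power of \<phi> is removed in the coordinate with \<beta> = 0, where Z is
      known to be primitive.\<close>
    have "\<exists>q'. dehom 0 ?f - q' * dehom 0 ?Z \<in> coeffs_in L \<and> (\<forall>m. m + k > d \<longrightarrow> coeff q' m = 0)"
    proof (cases "k \<le> d")
      case True
      have q_bound: "coeff q m = 0" if "m > d - k" for m
        using qr(3)[of m] that by simp
      have r_bound: "coeff r m = 0" if "m > d" for m
        using qr(2)[of m] that True by simp
      have "\<phi> ^ Suc d * ?f = hmg \<beta> d (smult (\<phi> ^ Suc d) (pull p))"
        unfolding hmg_smult pull_def f_hmg ..
      also have "\<dots> = hmg \<beta> ((d - k) + k) (q * z) + hmg \<beta> d r"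
        unfolding qr(1) hmg_add using True by simp
      also have "hmg \<beta> ((d - k) + k) (q * z) = hmg \<beta> (d - k) q * ?Z"
        using hmg_mult[of "d - k" q k z \<beta>] q_bound z_bound Z_hmg[of \<beta>] by (simp add: z_def)
      finally have eq: "\<phi> ^ Suc d * ?f = hmg \<beta> (d - k) q * ?Z + hmg \<beta> d r" .
      have dehom_hmg: "dehom 0 (hmg \<beta> m f) =
          (\<Sum>a\<le>m. smult (coeff f a) ([:0, 1:] ^ a * ([:1:] - [:Const \<beta> :: 'i coord cpoly:] * [:0, 1:]) ^ (m - a)))"
        if "\<And>a. vars_in SC (coeff f a)" for m f
      proof -
        have "dehom 0 (coeff f a) = [:coeff f a:]" for a
          by (rule dehom_coefficient) (use that SC_no_params vars_in_mono in blast)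
        then show ?thesis
          by (simp add: hmg_def ring_map_sum[OF ring_map_dehom] dehom_Var Const_simps)
      qed
      have "dehom 0 (hmg \<beta> d r) \<in> coeffs_in L"
        unfolding dehom_hmg[OF qr(5)]
        by (intro mul.subspace_sum[OF subspace_coeffs_in[OF L(1)]] coeffs_in_smult_left L(1) rL)
      moreover have "coeff (dehom 0 (hmg \<beta> (d - k) q)) m = 0" if "m > d - k" for m
      proof -
        have "degree (dehom 0 (hmg \<beta> (d - k) q)) \<le> d - k"
          unfolding dehom_hmg[OF qr(4)]
        proof (rule degree_sum_le)
          fix a assume a: "a \<in> {..d - k}"
          have "degree ([:1:] - [:Const \<beta> :: 'i coord cpoly:] * [:0, 1:]) \<le> 1"
            by (rule degree_le) (auto simp: coeff_pCons split: nat.splits)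
          then have "degree (([:1:] - [:Const \<beta> :: 'i coord cpoly:] * [:0, 1:]) ^ (d - k - a)) \<le> 1 * (d - k - a)"
            by (intro order_trans[OF degree_power_le] mult_right_mono) auto
          moreover have "degree ([:0, 1:] ^ a :: 'i coord cpoly poly) \<le> a"
            by (simp add: monom_power degree_monom_le)
          ultimately have "degree ([:0, 1:] ^ a * ([:1:] - [:Const \<beta> :: 'i coord cpoly:] * [:0, 1:]) ^ (d - k - a))
              \<le> a + 1 * (d - k - a)"
            by (intro order_trans[OF degree_mult_le] add_mono)
          then have "degree ([:0, 1:] ^ a * ([:1:] - [:Const \<beta> :: 'i coord cpoly:] * [:0, 1:]) ^ (d - k - a)) \<le> d - k"
            using a by simp
          then show "degree (smult (coeff q a)
              ([:0, 1:] ^ a * ([:1:] - [:Const \<beta> :: 'i coord cpoly:] * [:0, 1:]) ^ (d - k - a))) \<le> d - k"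
            using degree_smult_le order_trans by blast
        qed simp
        then show ?thesis
          using that by (simp add: coeff_eq_0)
      qed
      moreover have "dehom 0 (\<phi> ^ Suc d) = [:\<phi> ^ Suc d:]"
        by (rule dehom_coefficient)
          (use \<phi>_vars SC_no_params vars_in_mono in \<open>blast intro: vars_in_power\<close>)
      then have "smult (\<phi> ^ Suc d) (dehom 0 ?f) - dehom 0 (hmg \<beta> (d - k) q) * dehom 0 ?Z = dehom 0 (hmg \<beta> d r)"
        using arg_cong[OF eq, of "dehom 0"] by (simp del: power_Suc)
      ultimately have "smult (\<phi> ^ Suc d) (dehom 0 ?f) - dehom 0 (hmg \<beta> (d - k) q) * dehom 0 ?Z \<in> coeffs_in L"
        and bound: "\<And>m. m > d - k \<Longrightarrow> coeff (dehom 0 (hmg \<beta> (d - k) q)) m = 0"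
        by simp_all
      then obtain q' where "dehom 0 ?f - q' * dehom 0 ?Z \<in> coeffs_in L" "\<forall>m>d - k. coeff q' m = 0"
        using primitive_cancel_power[where \<phi> = \<phi> and z = "dehom 0 ?Z", OF L(1) L\<phi> primitive_Z_form[OF e_le]]
        by blast
      then show ?thesis
        using True by (intro exI[of _ q']) auto
    next
      \<comment> \<open>Here the degree of p is below k, so the quotient vanishes and the
        coefficients of \<open>pull p\<close> themselves lie in L.\<close>
      case False
      then have "q = 0"
        using qr(3) by (simp add: poly_eq_iff)
      then have "coeff (pull p) m \<in> L" for m
        using L(2)[of "\<phi> ^ Suc d" "coeff (pull p) m"] rL[of m] \<phi>_nonzero qr(1)
        by (metis (no_types, lifting) add_0 coeff_smult mult_zero_left power_not_zero value_at_simps(7))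
      then have "dehom \<beta> ?f \<in> coeffs_in L"
        by (simp add: coeffs_in_def pull_def)
      moreover have "?f = hmg \<beta> d (dehom \<beta> ?f)"
        by (simp add: f_hmg)
      then have "dehom 0 ?f = (\<Sum>m\<le>d. dehom 0 (coeff (dehom \<beta> ?f) m) *
          dehom 0 (Var ParS ^ m * (Var ParT - Const \<beta> * Var ParS) ^ (d - m)))"
        by (metis (no_types, lifting) dehom_simps(4) hmg_def ring_map_dehom ring_map_sum sum.cong)
      moreover have "dehom 0 (coeff (dehom \<beta> ?f) m) = [:coeff (dehom \<beta> ?f) m:]" for m
        by (rule dehom_coefficient) (use f_vars SC_no_params vars_in_mono in blast)
      ultimately have "dehom 0 ?f \<in> coeffs_in L"
        by (auto simp: coeffs_in_def coeff_sum mult.commute[of "coeff (dehom \<beta> ?f) _"]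
            intro!: mul.subspace_sum[OF L(1)] mul.subspace_scale[OF L(1)])
      then show ?thesis
        by (intro exI[of _ 0]) simp
    qed
    then obtain q' where q': "dehom 0 ?f - q' * dehom 0 ?Z \<in> coeffs_in L"
      "\<And>m. m + k > d \<Longrightarrow> coeff q' m = 0"
      by blast
    \<comment> \<open>Retraction to the coordinates \<open>SC\<close>, so that the coefficients of b
      lie in J and not only in L.\<close>
    define q1 where "q1 = map_poly \<rho> q'"
    have q1_bound: "coeff q1 m = 0" if "m + k > d" for m
      using q'(2)[OF that] by (simp add: q1_def coeff_map_poly \<rho>_def)
    define b where "b = dehom 0 ?f - q1 * dehom 0 ?Z"
    have "b = map_poly \<rho> (dehom 0 ?f - q' * dehom 0 ?Z)"
      by (simp add: b_def q1_def ring_map_simps[OF ring_map_\<rho>] \<rho>_map f_vars Z_vars)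
    then have b: "coeff b m \<in> J" for m
      using \<rho>[OF coeffs_inD[OF q'(1)]] by (simp add: coeff_map_poly \<rho>_def)
    have q1Z: "\<exists>Q. hmg 0 d (q1 * dehom 0 ?Z) = Q * ?Z"
    proof (cases "k \<le> d")
      case True
      then have "hmg 0 d (q1 * dehom 0 ?Z) = hmg 0 ((d - k) + k) (q1 * dehom 0 ?Z)"
        by simp
      also have "\<dots> = hmg 0 (d - k) q1 * ?Z"
        using hmg_mult[of "d - k" q1 k "dehom 0 ?Z" 0] q1_bound Z_bound Z_hmg[of 0] True by auto
      finally show ?thesis
        by blast
    next
      case False
      then have "q1 = 0"
        using q1_bound by (simp add: poly_eq_iff)
      then show ?thesis
        by (intro exI[of _ 0]) (simp add: hmg_def)
    qed
    then obtain Q where Q: "hmg 0 d (q1 * dehom 0 ?Z) = Q * ?Z"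
      by blast
    have "?f = hmg 0 d (q1 * dehom 0 ?Z + b)"
      using f_hmg[of 0] by (simp add: b_def)
    also have "\<dots> = Q * ?Z + hmg 0 d b"
      unfolding hmg_add Q ..
    also have "\<dots> \<in> mul.span (insert ?Z J)"
    proof (rule mul.span_add)
      show "Q * ?Z \<in> mul.span (insert ?Z J)"
        by (intro mul.span_scale mul.span_base) simp
      have "coeff b m \<in> mul.span (insert ?Z J)" for m
        using b by (intro mul.span_base) simp
      then have "(\<Sum>m\<le>d. (Var ParS ^ m * (Var ParT - Const 0 * Var ParS) ^ (d - m)) * coeff b m)
          \<in> mul.span (insert ?Z J)"
        by (intro span_lin_comb)
      then show "hmg 0 d b \<in> mul.span (insert ?Z J)"
        by (simp add: hmg_def mult.commute)
    qed
    finally have "?f \<in> mul.span (insert ?Z J)" .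
    moreover have "vars_in (S_coords K i j e \<union> {ParS, ParT}) ?f"
      by (intro vars_in_subst vars_in_line_param)
    ultimately show "?f \<in> genideal (poly_ring (S_coords K i j e \<union> {ParS, ParT})) (insert ?Z J)"
      by (subst genideal_eq_span) (auto simp: J_def SC_def intro: vars_in_Z_form vars_in_mono)
  qed
  then have "H_ideal X K i j e \<subseteq> J"
    using J_ideal by (auto simp: H_ideal_def)
  then show ?thesis
    by (auto simp: J_def L_def)
qed

end

section \<open>Derivatives along a line\<close>

text \<open>Values and derivatives along the curve y with parameter \<tau>, for displacements
  \<sigma> that also vary with \<tau>. Everything stays polynomial in \<tau>, so that divisibility
  by z0 makes sense.\<close>

definition pval :: "('v \<Rightarrow> complex poly) \<Rightarrow> 'v cpoly \<Rightarrow> complex poly" where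
  "pval y = eval_in (\<lambda>c. [:c:]) y"

definition pjet :: "('v \<Rightarrow> complex poly) \<Rightarrow> ('v \<Rightarrow> complex poly) \<Rightarrow> 'v cpoly \<Rightarrow> complex poly poly" where
  "pjet y \<sigma> = eval_in (\<lambda>c. [:[:c:]:]) (\<lambda>l. [:y l, \<sigma> l:])"

definition pdir :: "('v \<Rightarrow> complex poly) \<Rightarrow> ('v \<Rightarrow> complex poly) \<Rightarrow> 'v cpoly \<Rightarrow> complex poly" where
  "pdir y \<sigma> g = coeff (pjet y \<sigma> g) 1"

lemma ring_map_const_const: "ring_map (\<lambda>c :: 'a::comm_ring_1. [:[:c:]:])"
  by (rule ring_map_comp[OF ring_map_const_poly ring_map_const_poly])

lemma ring_map_pval: "ring_map (pval y)"
  by (simp add: pval_def eval_in_ring_map)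

lemma ring_map_pjet: "ring_map (pjet y \<sigma>)"
  by (simp add: pjet_def eval_in_ring_map ring_map_const_const)

lemmas pval_simps [simp] = ring_map_simps[OF ring_map_pval]
lemmas pjet_simps = ring_map_simps[OF ring_map_pjet]

lemma pval_Const [simp]: "pval y (Const c) = [:c:]" and pval_Var [simp]: "pval y (Var l) = y l"
  by (simp_all add: pval_def)

lemma coeff_pjet_0: "coeff (pjet y \<sigma> g) 0 = pval y g"
  by (induction g rule: cpoly_induct) (simp_all add: pjet_simps coeff_mult, simp_all add: pjet_def ring_map_const_const)

lemma pdir_Const [simp]: "pdir y \<sigma> (Const c) = 0" and pdir_Var [simp]: "pdir y \<sigma> (Var l) = \<sigma> l"
  by (simp_all add: pdir_def pjet_def ring_map_const_const)

lemma pdir_0 [simp]: "pdir y \<sigma> 0 = 0"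
  and pdir_add [simp]: "pdir y \<sigma> (f + g) = pdir y \<sigma> f + pdir y \<sigma> g"
  and pdir_mult [simp]: "pdir y \<sigma> (f * g) = pval y f * pdir y \<sigma> g + pdir y \<sigma> f * pval y g"
  by (simp_all add: pdir_def pjet_simps coeff_mult coeff_pjet_0)

lemma pdir_lin:
  "pdir y (\<lambda>l. p * \<sigma> l + q * \<sigma>' l) g = p * pdir y \<sigma> g + q * pdir y \<sigma>' g"
  by (induction g rule: cpoly_induct) (simp_all add: algebra_simps)

lemma poly_pval: "poly (pval y g) \<tau> = value_at (\<lambda>l. poly (y l) \<tau>) g"
  by (induction g rule: cpoly_induct) simp_all

lemma poly_pdir: "poly (pdir y \<sigma> g) \<tau> = dir (\<lambda>l. poly (y l) \<tau>) (\<lambda>l. poly (\<sigma> l) \<tau>) g"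
  by (induction g rule: cpoly_induct) (simp_all add: poly_pval)

lemma pderiv_pval: "pderiv (pval y g) = pdir y (\<lambda>l. pderiv (y l)) g"
  by (induction g rule: cpoly_induct) (simp_all add: pderiv_add pderiv_mult pderiv_pCons mult.commute)

text \<open>Euler's relation: the jet at y in the direction y evaluates g at y times a scalar
  \<open>[:1, 1:]\<close>, which by homogeneity comes out as its d-th power.\<close>

lemma pdir_euler:
  assumes "hom_deg d g"
  shows "pdir y y g = of_nat d * pval y g"
proof -
  have "(\<lambda>l. [:y l, y l:]) = (\<lambda>l. [:1, 1:] * [:y l:])"
    by auto
  then have "pjet y y g = eval_in (\<lambda>c. [:[:c:]:]) (\<lambda>l. [:1, 1:] * [:y l:]) g"
    unfolding pjet_def by (rule arg_cong)
  also have "\<dots> = [:1, 1:] ^ d * eval_in (\<lambda>c. [:[:c:]:]) (\<lambda>l. [:y l:]) g"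
    by (rule eval_in_hom[OF assms])
  also have "eval_in (\<lambda>c. [:[:c:]:]) (\<lambda>l. [:y l:]) g = [:pval y g:]"
    unfolding pval_def by (rule ring_map_eval_in[OF ring_map_const_poly, symmetric])
  finally have "pdir y y g = coeff ([:1, 1:] ^ d * [:pval y g:]) 1"
    by (simp add: pdir_def)
  moreover have "coeff ([:1, 1 :: complex poly:] ^ d) 0 = 1 \<and> coeff ([:1, 1 :: complex poly:] ^ d) 1 = of_nat d" for d
    by (induction d) (simp_all add: coeff_pCons)
  ultimately show ?thesis
    by (simp add: coeff_mult mult.commute)
qed

lemma derivation_power:
  fixes v \<delta> :: "'a::comm_ring_1 \<Rightarrow> 'b::comm_ring_1"
  assumes v: "ring_map v" and \<delta>: "\<delta> 1 = 0" "\<And>a b. \<delta> (a * b) = v a * \<delta> b + \<delta> a * v b"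
  shows "\<delta> (a ^ n) = of_nat n * v a ^ (n - 1) * \<delta> a"
proof (induction n)
  case (Suc n)
  then show ?case
    by (cases n) (simp_all add: \<delta> ring_map_simps[OF v] algebra_simps)
qed (simp add: \<delta>)

text \<open>A derivation along an arbitrary ring map covers both the derivative of z0 in \<tau> and
  the variation of z along a tangent vector.\<close>

lemma derivation_prod_power:
  fixes v \<delta> :: "'a::comm_ring_1 \<Rightarrow> 'b::comm_ring_1"
  assumes v: "ring_map v" and \<delta>: "\<delta> 1 = 0" "\<And>a b. \<delta> (a * b) = v a * \<delta> b + \<delta> a * v b"
    and "finite A"
  shows "\<delta> (\<Prod>m\<in>A. f m ^ m) =
    (\<Sum>m\<in>A. of_nat m * v (f m) ^ (m - 1) * (\<Prod>l\<in>A - {m}. v (f l) ^ l) * \<delta> (f m))"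
  using assms(4)
proof (induction A rule: finite_induct)
  case (insert m A)
  have "(\<Prod>l\<in>insert m A - {b}. v (f l) ^ l) = v (f m) ^ m * (\<Prod>l\<in>A - {b}. v (f l) ^ l)"
    if "b \<in> A" for b
  proof -
    have "insert m A - {b} = insert m (A - {b})"
      using insert.hyps that by auto
    then show ?thesis
      using insert.hyps by simp
  qed
  moreover have "insert m A - {m} = A"
    using insert.hyps by auto
  ultimately show ?case
    using insert by (simp add: \<delta> derivation_power[of v \<delta>, OF v \<delta>] ring_map_prod[OF v]
        ring_map_simps[OF v] sum_distrib_left algebra_simps)
qed (simp add: \<delta>)

text \<open>The substituted monomials s^a t^(r - a) span the polynomials of degree at most r: the
  constant term fixes the coefficient for a = 0, and the rest is \<tau> times a polynomial of degree
  at most r - 1.\<close>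

lemma twisted_basis:
  fixes G :: "complex poly"
  assumes "\<And>n. n > r \<Longrightarrow> coeff G n = 0"
  shows "\<exists>\<gamma>. G = (\<Sum>a\<le>r. smult (\<gamma> a) ([:0, 1:] ^ a * [:1, \<beta>:] ^ (r - a)))"
  using assms
proof (induction r arbitrary: G)
  case 0
  then have "G = [:coeff G 0:]"
    by (intro poly_eqI) (auto simp: coeff_pCons split: nat.splits)
  then show ?case
    by (intro exI[of _ "\<lambda>_. coeff G 0"]) simp
next
  case (Suc r)
  define H where "H = G - smult (coeff G 0) ([:1, \<beta>:] ^ Suc r)"
  have c0: "coeff ([:1, \<beta>:] ^ n) 0 = 1" for n
    by (induction n) (auto simp: coeff_mult)
  have "coeff H 0 = 0"
    by (simp add: H_def c0 del: power_Suc)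
  then obtain H' where H': "H = pCons 0 H'"
    by (metis coeff_pCons_0 pCons_cases)
  have "degree ([:1, \<beta>:] ^ Suc r) \<le> 1 * Suc r"
    by (rule order_trans[OF degree_power_le]) (intro mult_right_mono, auto)
  then have "coeff H n = 0" if "n > Suc r" for n
    using Suc.prems[OF that] that by (simp add: H_def coeff_eq_0 del: power_Suc)
  then have "coeff H' n = 0" if "n > r" for n
    using that H' by (metis Suc_mono coeff_pCons_Suc)
  then obtain \<gamma> where \<gamma>: "H' = (\<Sum>a\<le>r. smult (\<gamma> a) ([:0, 1:] ^ a * [:1, \<beta>:] ^ (r - a)))"
    using Suc.IH by blast
  have "[:0, 1:] * H' = H"
    by (simp add: H')
  then have "G = smult (coeff G 0) ([:1, \<beta>:] ^ Suc r) + [:0, 1:] * H'"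
    by (simp add: H_def)
  also have "[:0, 1:] * H' = (\<Sum>a\<le>r. smult (\<gamma> a) ([:0, 1:] ^ Suc a * [:1, \<beta>:] ^ (Suc r - Suc a)))"
    unfolding \<gamma> sum_distrib_left by (intro sum.cong) (simp_all add: algebra_simps)
  finally have "G = (\<Sum>a\<le>Suc r. smult (case a of 0 \<Rightarrow> coeff G 0 | Suc b \<Rightarrow> \<gamma> b)
      ([:0, 1:] ^ a * [:1, \<beta>:] ^ (Suc r - a)))"
    unfolding sum.atMost_Suc_shift by simp
  then show ?case
    by blast
qed

section \<open>First-order variation of coefficients along a tangent vector\<close>

definition diff_coeffs :: "('v \<Rightarrow> complex) \<Rightarrow> ('v \<Rightarrow> complex) \<Rightarrow> 'v cpoly poly \<Rightarrow> complex poly" where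
  "diff_coeffs x v = map_poly (dir x v)"

lemma coeff_diff_coeffs: "coeff (diff_coeffs x v f) n = dir x v (coeff f n)"
  by (simp add: diff_coeffs_def coeff_map_poly)

lemma diff_coeffs_0 [simp]: "diff_coeffs x v 0 = 0"
  and diff_coeffs_add [simp]: "diff_coeffs x v (f + g) = diff_coeffs x v f + diff_coeffs x v g"
  by (rule poly_eqI; simp add: coeff_diff_coeffs)+

lemma diff_coeffs_sum: "diff_coeffs x v (sum f A) = (\<Sum>a\<in>A. diff_coeffs x v (f a))"
  by (induction A rule: infinite_finite_induct) auto

lemma diff_coeffs_mult [simp]: "diff_coeffs x v (f * g) =
    map_poly (value_at x) f * diff_coeffs x v g + diff_coeffs x v f * map_poly (value_at x) g"
  by (rule poly_eqI)
    (simp add: coeff_diff_coeffs coeff_mult coeff_map_poly dir_sum sum.distrib)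

lemma diff_coeffs_pCons [simp]: "diff_coeffs x v (pCons a f) = pCons (dir x v a) (diff_coeffs x v f)"
  by (rule poly_eqI) (simp add: coeff_diff_coeffs coeff_pCons split: nat.splits)

lemma diff_coeffs_1 [simp]: "diff_coeffs x v 1 = 0"
  by (simp add: one_pCons)


section \<open>Independence of the local equations\<close>

context aligned_point
begin

abbreviation val :: "'i coord cpoly poly \<Rightarrow> complex poly" where
  "val \<equiv> map_poly (value_at x)"

definition form0 :: "nat \<Rightarrow> complex poly" where
  "form0 m = val (dehom \<beta> (points_form K e m))"

definition dform :: "('i coord \<Rightarrow> complex) \<Rightarrow> nat \<Rightarrow> complex poly" where
  "dform v m = diff_coeffs x v (dehom \<beta> (points_form K e m))"

definition dline :: "('i coord \<Rightarrow> complex) \<Rightarrow> 'i \<Rightarrow> complex poly" where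
  "dline v l = diff_coeffs x v (dehom \<beta> (line_param i j l))"

lemma val_pull: "val (pull g) = pval line0 g"
  unfolding pull_def line0_def[abs_def]
  by (induction g rule: cpoly_induct) (simp_all add: val_simps map_poly_pCons)

lemma diff_coeffs_pull: "diff_coeffs x v (pull g) = pdir line0 (dline v) g"
proof (induction g rule: cpoly_induct)
  case (mult p q)
  then show ?case
    by (simp add: pull_simps val_pull)
next
  case (add p q)
  then show ?case
    by (simp add: pull_simps)
qed (simp_all add: pull_def dline_def)

lemma dehom_frame:
  "dehom \<beta> (frame_u i j l) = [:frame_u i j l:]" "dehom \<beta> (frame_v i j l) = [:frame_v i j l:]"
  by (rule dehom_coefficient; auto simp: frame_u_def frame_v_def)+

lemma line0_eq: "line0 l = (if l = i then [:0, 1:] else if l = j then [:1, \<beta>:] else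
    [:x (FrameV l), x (FrameU l) + \<beta> * x (FrameV l):])"
  using i_neq_j by (simp add: line0_def line_param_def dehom_frame dehom_Var)
    (auto simp: frame_u_def frame_v_def val_simps map_poly_pCons)

text \<open>A point of the line is \<tau> u + (1 + \<beta> \<tau>) v, so the coefficient of \<tau>
  is the displacement of the point at infinity, the quantity that tangent vectors of H can
  prescribe.\<close>

lemma dline_eq: "dline v l = (if l = i \<or> l = j then 0 else
    [:v (FrameV l), v (FrameU l) + \<beta> * v (FrameV l):])"
  using i_neq_j by (simp add: dline_def line_param_def dehom_frame dehom_Var)
    (auto simp: frame_u_def frame_v_def val_simps map_poly_pCons)

definition form_basis :: "nat \<Rightarrow> nat \<Rightarrow> complex poly" where
  "form_basis m a = [:0, 1:] ^ a * [:1, \<beta>:] ^ (count K m - a)"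

lemma form0_eq: "form0 m = (\<Sum>a\<le>count K m. smult (if a = e m then 1 else x (FormCoeff m a)) (form_basis m a))"
  and dform_eq: "dform v m = (\<Sum>a\<le>count K m. smult (if a = e m then 0 else v (FormCoeff m a)) (form_basis m a))"
proof -
  let ?c = "\<lambda>a. if a = e m then 1 else Var (FormCoeff m a) :: 'i coord cpoly"
  let ?B = "\<lambda>a. [:0, 1:] ^ a * [:1, Const \<beta>:] ^ (count K m - a) :: 'i coord cpoly poly"
  have F: "dehom \<beta> (points_form K e m) = (\<Sum>a\<le>count K m. [:?c a:] * ?B a)"
    unfolding points_form_def ring_map_sum[OF ring_map_dehom]
    by (rule sum.cong) (auto simp: dehom_Var one_pCons[symmetric])
  have B0: "val (?B a) = form_basis m a" for a
    by (simp only: val_simps form_basis_def map_poly_pCons value_at_simps value_at_Const map_poly_0)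
  have "diff_coeffs x v ([:0, 1:] ^ a) = 0" for a
    by (induction a) simp_all
  moreover have "diff_coeffs x v ([:1, Const \<beta>:] ^ a) = 0" for a
    by (induction a) (simp_all del: mult_pCons_left)
  ultimately have DB: "diff_coeffs x v (?B a) = 0" for a
    by simp
  show "form0 m = (\<Sum>a\<le>count K m. smult (if a = e m then 1 else x (FormCoeff m a)) (form_basis m a))"
    unfolding form0_def F ring_map_sum[OF ring_map_val]
  proof (rule sum.cong)
    fix a
    show "val ([:?c a:] * ?B a) = smult (if a = e m then 1 else x (FormCoeff m a)) (form_basis m a)"
      unfolding val_simps(4)[of x "[:?c a:]" "?B a"] B0 by (auto simp: map_poly_pCons)
  qed simp
  show "dform v m = (\<Sum>a\<le>count K m. smult (if a = e m then 0 else v (FormCoeff m a)) (form_basis m a))"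
    unfolding dform_def F diff_coeffs_sum
  proof (rule sum.cong)
    fix a
    show "diff_coeffs x v ([:?c a:] * ?B a) =
        smult (if a = e m then 0 else v (FormCoeff m a)) (form_basis m a)"
      unfolding diff_coeffs_mult[of x v "[:?c a:]" "?B a"] B0 DB by auto
  qed simp
qed

lemma form0_bound: "b > count K m \<Longrightarrow> coeff (form0 m) b = 0"
proof -
  assume "b > count K m"
  moreover have "is_form (count K m) (points_form K e m :: 'i coord cpoly)"
    by (rule is_form_points_form)
  ultimately show ?thesis
    by (auto simp: form0_def is_form_def coeff_map_poly)
qed

lemma z0_eq: "z0 = (\<Prod>m\<in>set_mset K. form0 m ^ m)"
  by (simp add: z0_def z_def Z_form_def ring_map_prod[OF ring_map_dehom] ring_map_prod[OF ring_map_val]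
      val_simps form0_def)

text \<open>The partial derivative of the product z0 with respect to its factor
  \<open>form0 m\<close>.\<close>

definition cofactor :: "nat \<Rightarrow> complex poly" where
  "cofactor m = of_nat m * form0 m ^ (m - 1) * (\<Prod>l\<in>set_mset K - {m}. form0 l ^ l)"

lemma cofactor_form0: "m \<in># K \<Longrightarrow> cofactor m * form0 m = of_nat m * z0"
  by (cases m) (simp_all add: cofactor_def z0_eq prod.remove[of "set_mset K" m] algebra_simps)

lemma pderiv_z0: "pderiv z0 = (\<Sum>m\<in>set_mset K. cofactor m * pderiv (form0 m))"
  unfolding z0_eq cofactor_def
  by (rule derivation_prod_power[of "\<lambda>x. x"]) (simp_all add: pderiv_mult mult.commute)

lemma diff_coeffs_z: "diff_coeffs x v z = (\<Sum>m\<in>set_mset K. cofactor m * dform v m)"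
  unfolding z_def Z_form_def ring_map_prod[OF ring_map_dehom] dehom_simps cofactor_def form0_def dform_def
  by (rule derivation_prod_power[OF ring_map_val]) simp_all

lemma tangent_H_loc:
  assumes v: "\<And>f. f \<in> H_ideal X K i j e \<Longrightarrow> dir x v f = 0" and f: "f \<in> H_loc"
  shows "value_at x f = 0" "dir x v f = 0"
proof -
  obtain h where h: "value_at x h \<noteq> 0" "h * f \<in> mul.span (H_ideal X K i j e)"
    using f by (auto simp: H_loc_def loc_def)
  have "value_at x p = 0 \<and> dir x v p = 0" if "p \<in> mul.span (H_ideal X K i j e)" for p
    using that
  proof (induction rule: mul.span_induct_alt)
    case (step c a q)
    then have "value_at x a = 0"
      using point by (auto simp: H_point_def zero_of_def)
    then show ?case
      using step v by simp
  qed simp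
  from this[OF h(2)] show "value_at x f = 0" "dir x v f = 0"
    using h(1) by auto
qed

text \<open>Displacements of any degree in \<tau> reach every target, since X is smooth at the
  points of Z. They are reduced to those of the chart by relations modulo z0: sliding along the line
  and scaling remove the components i and j, tangent vectors of H lower the degree, and changes of a
  form count only modulo that form.\<close>

lemma equations_independent:
  fixes c :: nat
  assumes g: "\<And>a. a < c \<Longrightarrow> g a \<in> cone_ideal X"
    and g_surj: "\<And>\<tau> t. poly z0 \<tau> = 0 \<Longrightarrow> \<exists>v. \<forall>a<c. dir (\<lambda>l. poly (line0 l) \<tau>) v (g a) = t a"
    and qr: "\<And>a. a < c \<Longrightarrow> smult (\<phi> ^ D a) (pull (g a)) = q a * z + r a"
    and r_bound: "\<And>a m. m \<ge> k \<Longrightarrow> coeff (r a) m = 0"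
    and r_loc: "\<And>a m. a < c \<Longrightarrow> coeff (r a) m \<in> H_loc"
    and tangent: "\<And>w. \<exists>v. (\<forall>f\<in>H_ideal X K i j e. dir x v f = 0) \<and>
      (\<forall>l. l \<noteq> i \<longrightarrow> l \<noteq> j \<longrightarrow> v (FrameU l) + \<beta> * v (FrameV l) = w l)"
  shows "\<exists>v. \<forall>a<c. \<forall>m<k. dir x v (coeff (r a) m) = t a m"
proof -
  define \<phi>0 where "\<phi>0 = value_at x \<phi>"
  have \<phi>0: "\<phi>0 \<noteq> 0"
    by (simp add: \<phi>0_def \<phi>_nonzero)
  define h where "h = (\<lambda>a. val (q a))"
  have val_r: "val (r a) = 0" if "a < c" for a
  proof -
    obtain v where "\<forall>f\<in>H_ideal X K i j e. dir x v f = 0"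
      using tangent by blast
    then show ?thesis
      using tangent_H_loc(1)[OF _ r_loc[OF that]] by (intro poly_eqI) (auto simp: coeff_map_poly)
  qed
  have val_smult: "val (smult p f) = smult (value_at x p) (val f)" for p f
    by (rule poly_eqI) (simp add: coeff_map_poly)
  have hz: "smult (\<phi>0 ^ D a) (pval line0 (g a)) = h a * z0" if "a < c" for a
    using arg_cong[OF qr[OF that], of val] val_r[OF that]
    by (simp add: val_smult val_simps val_pull h_def z0_def \<phi>0_def)
  have dvd_cancel: "z0 dvd f" if "z0 dvd smult (\<phi>0 ^ D a) f" for a f
    using that \<phi>0 by (simp add: dvd_smult_iff)
  have z0_pval: "z0 dvd pval line0 (g a)" if "a < c" for a
    by (rule dvd_cancel[of a]) (simp add: hz[OF that])
  text \<open>The derivative of the equations as a linear function of a displacement \<open>\<sigma>\<close> of the line and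
    a change \<open>G\<close> of the forms; unlike a tangent vector of the chart, these may have any degree.\<close>
  define \<psi> where "\<psi> = (\<lambda>a \<sigma> G. smult (\<phi>0 ^ D a) (pdir line0 \<sigma> (g a)) -
      h a * (\<Sum>m\<in>set_mset K. cofactor m * G m))"
  have \<psi>_lin: "\<psi> a (\<lambda>l. p * \<sigma> l + p' * \<sigma>' l) (\<lambda>m. p * G m + p' * G' m) = p * \<psi> a \<sigma> G + p' * \<psi> a \<sigma>' G'"
    for a p p' \<sigma> \<sigma>' G G'
    by (simp add: \<psi>_def pdir_lin smult_add_right algebra_simps sum.distrib sum_distrib_left)
  have \<psi>_diff: "\<psi> a \<sigma> G - \<psi> a \<sigma> G' = - h a * (\<Sum>m\<in>set_mset K. cofactor m * (G m - G' m))" for a \<sigma> G G'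
    by (simp add: \<psi>_def algebra_simps sum_subtractf)
  \<comment> \<open>Differentiating \<phi> or the quotient q produces only multiples of z0.\<close>
  have D_r: "z0 dvd diff_coeffs x v (r a) - \<psi> a (dline v) (dform v)" if "a < c" for a v
  proof -
    have 1: "smult p f = [:p:] * f" for p and f :: "'i coord cpoly poly"
      by simp
    have "diff_coeffs x v (smult (\<phi> ^ D a) (pull (g a))) =
        smult (\<phi>0 ^ D a) (pdir line0 (dline v) (g a)) + smult (dir x v (\<phi> ^ D a)) (pval line0 (g a))"
      unfolding 1 diff_coeffs_mult by (simp add: map_poly_pCons diff_coeffs_pull val_pull \<phi>0_def)
    then have "diff_coeffs x v (r a) - \<psi> a (dline v) (dform v) =
        smult (dir x v (\<phi> ^ D a)) (pval line0 (g a)) - diff_coeffs x v (q a) * z0"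
      unfolding qr[OF that] by (simp add: \<psi>_def diff_coeffs_z h_def z0_def algebra_simps)
    then show ?thesis
      using z0_pval[OF that] by (simp add: dvd_smult)
  qed
  have along_z: "z0 dvd \<psi> a \<sigma> G - \<psi> a \<sigma> G'"
    if "\<And>m. m \<in># K \<Longrightarrow> z0 dvd cofactor m * (G m - G' m)" for a \<sigma> G G'
    unfolding \<psi>_diff by (rule dvd_mult, rule dvd_sum) (rule that)
  \<comment> \<open>Sliding the line together with its divisor along itself is trivial modulo z0:
    differentiate the identity \<open>hz\<close> in \<tau>.\<close>
  have along_line: "z0 dvd \<psi> a (\<lambda>l. pderiv (line0 l)) (\<lambda>m. pderiv (form0 m))" if "a < c" for a
  proof -
    have "\<psi> a (\<lambda>l. pderiv (line0 l)) (\<lambda>m. pderiv (form0 m)) = pderiv (h a * z0) - h a * pderiv z0"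
      using hz[OF that] by (simp add: \<psi>_def pderiv_z0 pderiv_pval[symmetric] pderiv_smult[symmetric])
    then show ?thesis
      by (simp add: pderiv_mult)
  qed
  have z0_dvd_cone: "z0 dvd pval line0 f" if "f \<in> cone_ideal X" for f
  proof -
    have "pull f \<in> near H_loc"
      by (rule pull_near[OF that])
    then obtain M A where MA: "smult (\<phi> ^ M) (pull f) - A * z \<in> coeffs_in H_loc"
      by (auto simp: near_def)
    obtain v where v: "\<forall>f\<in>H_ideal X K i j e. dir x v f = 0"
      using tangent by blast
    have "val (smult (\<phi> ^ M) (pull f) - A * z) = 0"
      using tangent_H_loc(1)[OF v[rule_format] coeffs_inD[OF MA]]
      by (intro poly_eqI) (simp add: coeff_map_poly del: coeff_diff coeff_smult)
    then have "smult (\<phi>0 ^ M) (pval line0 f) = val A * z0"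
      by (simp add: val_simps val_smult val_pull \<phi>0_def z0_def)
    then show ?thesis
      using \<phi>0 by (metis dvd_smult_iff dvd_triv_right power_not_zero)
  qed
  \<comment> \<open>Euler's relation for the homogeneous generators, whose values on the line are
    multiples of z0.\<close>
  have along_scaling: "z0 dvd \<psi> a line0 (\<lambda>m. 0)" if "a < c" for a
  proof -
    have "z0 dvd pdir line0 line0 f" if "f \<in> cone_ideal X" for f
      using that
    proof (induction rule: mul.span_induct_alt)
      case (step p f f')
      obtain d where "hom_deg d f"
        using step.hyps by (auto simp: cone_gens_def homogeneous_iff)
      then show ?case
        using step z0_dvd_cone[OF mul.span_base[OF step.hyps]]
        by (simp add: pdir_euler)
    qed simp
    then show ?thesis
      using g[OF that] by (simp add: \<psi>_def dvd_smult)
  qed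
  have tangent_\<psi>: "z0 dvd \<psi> a (dline v) (dform v)"
    if "a < c" "\<And>f. f \<in> H_ideal X K i j e \<Longrightarrow> dir x v f = 0" for a v
  proof -
    have "diff_coeffs x v (r a) = 0"
      using tangent_H_loc(2)[OF that(2) r_loc[OF that(1)]] by (intro poly_eqI) (auto simp: coeff_diff_coeffs)
    then show ?thesis
      using D_r[OF that(1), of v] by simp
  qed
  \<comment> \<open>Interpolation at the roots of p with multiplicity: a constant vector solves the
    problem at one root, and the defect is divided by the linear factor.\<close>
  have jacobian_onto: "\<exists>\<sigma>. \<forall>a<c. p dvd pdir line0 \<sigma> (g a) - y a"
    if "p \<noteq> 0" "\<And>\<tau>. poly p \<tau> = 0 \<Longrightarrow> poly z0 \<tau> = 0" for p and y :: "nat \<Rightarrow> complex poly"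
    using that
  proof (induction "degree p" arbitrary: p y)
    case 0
    then have "p dvd f" for f
      by (metis is_unit_iff_degree unit_imp_dvd)
    then show ?case
      by blast
  next
    case (Suc d)
    have "\<not> constant (poly p)"
      using Suc.hyps(2) by (simp add: constant_degree)
    then obtain \<rho> where \<rho>: "poly p \<rho> = 0"
      using fundamental_theorem_of_algebra by blast
    let ?l = "[:- \<rho>, 1:]"
    obtain p1 where p1: "p = ?l * p1"
      using \<rho> by (metis dvdE poly_eq_0_iff_dvd)
    have "p1 \<noteq> 0"
      using Suc.prems(1) p1 by auto
    then have "degree p = Suc (degree p1)"
      unfolding p1 by (subst degree_mult_eq) auto
    obtain v where v: "\<And>a. a < c \<Longrightarrow> dir (\<lambda>l. poly (line0 l) \<rho>) v (g a) = poly (y a) \<rho>"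
      using g_surj[OF Suc.prems(2)[OF \<rho>], of "\<lambda>a. poly (y a) \<rho>"] by blast
    have "\<exists>w. y a - pdir line0 (\<lambda>l. [:v l:]) (g a) = ?l * w" if "a < c" for a
    proof -
      have "poly (y a - pdir line0 (\<lambda>l. [:v l:]) (g a)) \<rho> = 0"
        by (simp add: poly_pdir v[OF that])
      then show ?thesis
        by (metis dvdE poly_eq_0_iff_dvd)
    qed
    then obtain y' where y': "\<And>a. a < c \<Longrightarrow> y a - pdir line0 (\<lambda>l. [:v l:]) (g a) = ?l * y' a"
      by metis
    obtain \<sigma> where \<sigma>: "\<And>a. a < c \<Longrightarrow> p1 dvd pdir line0 \<sigma> (g a) - y' a"
      using Suc.hyps(1)[of p1 y'] Suc.hyps(2) Suc.prems(2) \<open>degree p = Suc (degree p1)\<close> \<open>p1 \<noteq> 0\<close> p1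
      by auto
    have "p dvd pdir line0 (\<lambda>l. 1 * [:v l:] + ?l * \<sigma> l) (g a) - y a" if "a < c" for a
    proof -
      have eq: "pdir line0 (\<lambda>l. 1 * [:v l:] + ?l * \<sigma> l) (g a) - y a = ?l * (pdir line0 \<sigma> (g a) - y' a)"
        unfolding pdir_lin right_diff_distrib y'[OF that, symmetric] by simp
      show ?thesis
        unfolding p1 eq by (rule mult_dvd_mono[OF dvd_refl \<sigma>[OF that]])
    qed
    then show ?case
      by blast
  qed
  have onto: "\<exists>\<sigma> G. \<sigma> i = 0 \<and> \<sigma> j = 0 \<and> (\<forall>a<c. z0 dvd \<psi> a \<sigma> G - y a)" for y
  proof -
    obtain \<sigma> where \<sigma>: "\<And>a. a < c \<Longrightarrow> z0 dvd pdir line0 \<sigma> (g a) - smult (1 / \<phi>0 ^ D a) (y a)"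
      using jacobian_onto[OF z0_nonzero, of "\<lambda>a. smult (1 / \<phi>0 ^ D a) (y a)"] by blast
    have \<sigma>': "z0 dvd \<psi> a \<sigma> (\<lambda>_. 0) - y a" if "a < c" for a
    proof -
      have "\<psi> a \<sigma> (\<lambda>_. 0) - y a = smult (\<phi>0 ^ D a) (pdir line0 \<sigma> (g a) - smult (1 / \<phi>0 ^ D a) (y a))"
        using \<phi>0 by (simp add: \<psi>_def smult_diff_right)
      then show ?thesis
        using \<sigma>[OF that] by (simp add: dvd_smult)
    qed
    \<comment> \<open>\<mu> and \<kappa> solve two linear equations:
      \<open>\<kappa> * pderiv (line0 l) + \<mu> * line0 l\<close> must agree with \<sigma> for l =
      i and l = j, where the line is \<tau> and \<open>1 + \<beta> * \<tau>\<close>.\<close>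
    define \<mu> where "\<mu> = \<sigma> j - smult \<beta> (\<sigma> i)"
    define \<kappa> where "\<kappa> = \<sigma> i - [:0, 1:] * \<mu>"
    define \<sigma>1 where "\<sigma>1 = (\<lambda>l. 1 * \<sigma> l + (-1) * (\<kappa> * pderiv (line0 l) + \<mu> * line0 l))"
    define G1 where "G1 = (\<lambda>m. 1 * 0 + (-1) * (\<kappa> * pderiv (form0 m) + \<mu> * 0))"
    have "\<sigma>1 i = 0"
      by (simp add: \<sigma>1_def line0_eq \<kappa>_def pderiv_pCons)
    moreover have "\<sigma>1 j = 0"
      using i_neq_j by (simp add: \<sigma>1_def line0_eq \<kappa>_def \<mu>_def pderiv_pCons algebra_simps
          smult_diff_right smult_add_right)
    moreover have "z0 dvd \<psi> a \<sigma>1 G1 - y a" if "a < c" for a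
    proof -
      have eq: "\<psi> a \<sigma>1 G1 - y a = (\<psi> a \<sigma> (\<lambda>_. 0) - y a)
          - (\<kappa> * \<psi> a (\<lambda>l. pderiv (line0 l)) (\<lambda>m. pderiv (form0 m)) + \<mu> * \<psi> a line0 (\<lambda>m. 0))"
        unfolding \<sigma>1_def G1_def \<psi>_lin by simp
      show ?thesis
        unfolding eq
        by (rule dvd_diff[OF \<sigma>'[OF that]]) (intro dvd_add dvd_mult along_line along_scaling that)
    qed
    ultimately show ?thesis
      by blast
  qed
  have to_constants: "\<exists>w G. w i = 0 \<and> w j = 0 \<and> (\<forall>a<c. z0 dvd \<psi> a \<sigma> (\<lambda>_. 0) - \<psi> a (\<lambda>l. [:w l:]) G)"
    if "\<sigma> i = 0" "\<sigma> j = 0" "\<And>l m. m \<ge> d \<Longrightarrow> coeff (\<sigma> l) m = 0" for d \<sigma>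
    using that
  proof (induction d arbitrary: \<sigma>)
    case 0
    then have "\<sigma> = (\<lambda>_. [:0:])"
      by (auto simp: poly_eq_iff)
    then show ?case
      by (intro exI[of _ "\<lambda>_. 0"]) simp
  next
    case (Suc d)
    have "\<forall>l. \<exists>b f. \<sigma> l = pCons b f"
      using pCons_cases by metis
    then obtain s0 \<sigma>' where \<sigma>': "\<And>l. \<sigma> l = pCons (s0 l) (\<sigma>' l)"
      by metis
    have "coeff (\<sigma>' l) m = 0" if "m \<ge> d" for l m
      using Suc.prems(3)[of "Suc m" l] that by (simp add: \<sigma>')
    moreover have ij: "\<sigma>' i = 0" "\<sigma>' j = 0" "s0 i = 0" "s0 j = 0"
      using Suc.prems(1,2) by (auto simp: \<sigma>')
    ultimately obtain w' G' where w': "w' i = 0" "w' j = 0"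
      "\<And>a. a < c \<Longrightarrow> z0 dvd \<psi> a \<sigma>' (\<lambda>_. 0) - \<psi> a (\<lambda>l. [:w' l:]) G'"
      using Suc.IH[of \<sigma>'] by blast
    obtain v where v: "\<And>f. f \<in> H_ideal X K i j e \<Longrightarrow> dir x v f = 0"
      "\<And>l. l \<noteq> i \<Longrightarrow> l \<noteq> j \<Longrightarrow> v (FrameU l) + \<beta> * v (FrameV l) = w' l"
      using tangent[of w'] by blast
    \<comment> \<open>By the choice of v, \<open>dline v\<close> is \<tau> times w' plus the
      constants \<open>v (FrameV l)\<close>. Modulo the tangent vector v, the term with \<tau>
      therefore becomes the negative of these constants.\<close>
    define w where "w = (\<lambda>l. if l = i \<or> l = j then 0 else s0 l - v (FrameV l))"
    define G where "G = (\<lambda>m. [:0, 1:] * G' m + (-1) * dform v m)"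
    have \<sigma>_eq: "\<sigma> = (\<lambda>l. 1 * [:s0 l:] + [:0, 1:] * \<sigma>' l)"
      by (auto simp: \<sigma>')
    have w_eq: "(\<lambda>l. [:w l:]) = (\<lambda>l. 1 * [:s0 l:] + 1 * ([:0, 1:] * [:w' l:] + (-1) * dline v l))"
      using ij(3,4) w'(1,2) v(2) by (auto simp: w_def dline_eq)
    have "\<psi> a \<sigma> (\<lambda>_. 0) - \<psi> a (\<lambda>l. [:w l:]) G =
        [:0, 1:] * (\<psi> a \<sigma>' (\<lambda>_. 0) - \<psi> a (\<lambda>l. [:w' l:]) G') + \<psi> a (dline v) (dform v)" for a
    proof -
      have "\<psi> a \<sigma> (\<lambda>_. 0) = \<psi> a (\<lambda>l. 1 * [:s0 l:] + [:0, 1:] * \<sigma>' l) (\<lambda>m. 1 * 0 + [:0, 1:] * 0)"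
        using \<sigma>_eq by simp
      then have 1: "\<psi> a \<sigma> (\<lambda>_. 0) = 1 * \<psi> a (\<lambda>l. [:s0 l:]) (\<lambda>m. 0) + [:0, 1:] * \<psi> a \<sigma>' (\<lambda>m. 0)"
        unfolding \<psi>_lin .
      have "\<psi> a (\<lambda>l. [:w l:]) G =
          \<psi> a (\<lambda>l. 1 * [:s0 l:] + 1 * ([:0, 1:] * [:w' l:] + (-1) * dline v l))
            (\<lambda>m. 1 * 0 + 1 * ([:0, 1:] * G' m + (-1) * dform v m))"
        unfolding w_eq G_def by simp
      then have 2: "\<psi> a (\<lambda>l. [:w l:]) G = 1 * \<psi> a (\<lambda>l. [:s0 l:]) (\<lambda>m. 0) +
          1 * ([:0, 1:] * \<psi> a (\<lambda>l. [:w' l:]) G' + (-1) * \<psi> a (dline v) (dform v))"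
        unfolding \<psi>_lin .
      show ?thesis
        unfolding 1 2 by (simp only: algebra_simps) simp
    qed
    moreover have "w i = 0" "w j = 0"
      by (simp_all add: w_def)
    ultimately show ?case
      using w'(3) tangent_\<psi>[OF _ v(1)]
      by (intro exI[of _ w] exI[of _ G]) (auto simp del: mult_pCons_left)
  qed
  define y where "y = (\<lambda>a. \<Sum>m<k. monom (t a m) m)"
  obtain \<sigma> G where \<sigma>: "\<sigma> i = 0" "\<sigma> j = 0" "\<And>a. a < c \<Longrightarrow> z0 dvd \<psi> a \<sigma> G - y a"
    using onto by blast
  define d where "d = Suc (\<Sum>l\<in>UNIV. degree (\<sigma> l))"
  have "coeff (\<sigma> l) m = 0" if "m \<ge> d" for l m
  proof -
    have "degree (\<sigma> l) \<le> (\<Sum>l\<in>UNIV. degree (\<sigma> l))"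
      by (rule member_le_sum) auto
    then show ?thesis
      using that by (intro coeff_eq_0) (simp add: d_def)
  qed
  then obtain w G1 where w: "w i = 0" "w j = 0"
    "\<And>a. a < c \<Longrightarrow> z0 dvd \<psi> a \<sigma> (\<lambda>_. 0) - \<psi> a (\<lambda>l. [:w l:]) G1"
    using to_constants[OF \<sigma>(1,2), of d] by blast
  define G2 where "G2 = (\<lambda>m. G m + G1 m)"
  have wG: "z0 dvd \<psi> a (\<lambda>l. [:w l:]) G2 - y a" if "a < c" for a
  proof -
    have eq: "\<psi> a (\<lambda>l. [:w l:]) G2 - y a =
        (\<psi> a \<sigma> G - y a) - (\<psi> a \<sigma> (\<lambda>_. 0) - \<psi> a (\<lambda>l. [:w l:]) G1)"
      by (simp add: \<psi>_def G2_def algebra_simps sum.distrib sum_distrib_left)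
    show ?thesis
      unfolding eq by (rule dvd_diff[OF \<sigma>(3)[OF that] w(3)[OF that]])
  qed
  have "\<exists>\<gamma>. \<gamma> (e m) = 0 \<and> z0 dvd cofactor m * ((\<Sum>a\<le>count K m. smult (\<gamma> a) (form_basis m a)) - G2 m)"
    if m: "m \<in># K" for m
  proof (cases "m = 0")
    case True
    then show ?thesis
      by (intro exI[of _ "\<lambda>_. 0"]) (simp add: cofactor_def)
  next
    case False
    have f0: "form0 m \<noteq> 0"
      using z0_nonzero m False by (auto simp: z0_eq zero_power)
    \<comment> \<open>The cofactor times \<open>form0 m\<close> is a multiple of z0, so the change
      of the form may be reduced modulo \<open>form0 m\<close>, to an admissible degree.\<close>
    define \<rho> where "\<rho> = G2 m mod form0 m"
    have "coeff \<rho> n = 0" if "n > count K m" for n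
    proof (rule coeff_eq_0)
      have "degree (form0 m) \<le> count K m"
        by (rule degree_le) (use form0_bound in blast)
      moreover have "\<rho> = 0 \<or> degree \<rho> < degree (form0 m)"
        unfolding \<rho>_def by (rule degree_mod_less[OF f0])
      ultimately show "degree \<rho> < n"
        using that by auto
    qed
    then obtain \<gamma> where \<gamma>: "\<rho> = (\<Sum>a\<le>count K m. smult (\<gamma> a) (form_basis m a))"
      using twisted_basis[of "count K m" \<rho> \<beta>] unfolding form_basis_def by blast
    let ?c = "\<lambda>a. if a = e m then 1 else x (FormCoeff m a)"
    \<comment> \<open>The coefficient at \<open>e m\<close> is fixed in the chart; subtracting a
      multiple of \<open>form0 m\<close>, where it is 1, makes its change zero.\<close>
    define \<gamma>' where "\<gamma>' = (\<lambda>a. \<gamma> a - \<gamma> (e m) * ?c a)"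
    have "(\<Sum>a\<le>count K m. smult (\<gamma>' a) (form_basis m a)) = \<rho> - smult (\<gamma> (e m)) (form0 m)"
      unfolding \<gamma> form0_eq smult_sum_right
      by (simp only: sum_subtractf[symmetric]) (simp add: \<gamma>'_def smult_diff_left)
    also have "\<dots> = G2 m - form0 m * (G2 m div form0 m + [:\<gamma> (e m):])"
      by (simp add: \<rho>_def minus_mult_div_eq_mod[symmetric] distrib_left)
    finally have eq: "(\<Sum>a\<le>count K m. smult (\<gamma>' a) (form_basis m a)) =
        G2 m - form0 m * (G2 m div form0 m + [:\<gamma> (e m):])" .
    have "cofactor m * ((\<Sum>a\<le>count K m. smult (\<gamma>' a) (form_basis m a)) - G2 m) =
        - (cofactor m * form0 m) * (G2 m div form0 m + [:\<gamma> (e m):])"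
      unfolding eq by (simp only: right_diff_distrib mult_minus_left mult.assoc) simp
    then have "z0 dvd cofactor m * ((\<Sum>a\<le>count K m. smult (\<gamma>' a) (form_basis m a)) - G2 m)"
      unfolding cofactor_form0[OF m] by simp
    moreover have "\<gamma>' (e m) = 0"
      by (simp add: \<gamma>'_def)
    ultimately show ?thesis
      by blast
  qed
  then obtain \<gamma> where \<gamma>: "\<And>m. m \<in># K \<Longrightarrow> \<gamma> m (e m) = 0 \<and>
      z0 dvd cofactor m * ((\<Sum>a\<le>count K m. smult (\<gamma> m a) (form_basis m a)) - G2 m)"
    by metis
  \<comment> \<open>The entries at \<open>FrameU l\<close> cancel the coefficient of \<tau> in the
    displacement and leave the constant \<open>w l\<close>.\<close>
  define v where "v = (\<lambda>u :: 'i coord. case u of FrameU l \<Rightarrow> - \<beta> * w l | FrameV l \<Rightarrow> w l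
      | FormCoeff m a \<Rightarrow> \<gamma> m a | _ \<Rightarrow> 0)"
  have "dline v = (\<lambda>l. [:w l:])"
    using w(1,2) by (auto simp: dline_eq v_def)
  moreover have "dform v m = (\<Sum>a\<le>count K m. smult (\<gamma> m a) (form_basis m a))" if "m \<in># K" for m
    unfolding dform_eq using \<gamma>[OF that] by (intro sum.cong) (auto simp: v_def)
  then have "z0 dvd \<psi> a (\<lambda>l. [:w l:]) (dform v) - \<psi> a (\<lambda>l. [:w l:]) G2" for a
    using \<gamma> by (intro along_z) simp
  ultimately have "z0 dvd \<psi> a (dline v) (dform v) - y a" if "a < c" for a
    using dvd_add[OF _ wG[OF that], of "\<psi> a (dline v) (dform v) - \<psi> a (\<lambda>l. [:w l:]) G2"] by simp
  then have "z0 dvd diff_coeffs x v (r a) - y a" if "a < c" for a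
    using dvd_add[OF D_r[OF that, of v], of "\<psi> a (dline v) (dform v) - y a"] that by simp
  \<comment> \<open>Both polynomials have degree below k, so their congruence modulo z0 is an
    equality.\<close>
  moreover have "coeff (diff_coeffs x v (r a) - y a) m = 0" if "m \<ge> k" for a m
    using that r_bound by (simp add: coeff_diff_coeffs y_def coeff_sum)
  then have "diff_coeffs x v (r a) - y a = 0 \<or> degree (diff_coeffs x v (r a) - y a) < degree z0" for a
    unfolding degree_z0 by (metis leading_coeff_0_iff linorder_not_le)
  ultimately have "diff_coeffs x v (r a) = y a" if "a < c" for a
    using that dvd_imp_degree_le linorder_not_le by (metis eq_iff_diff_eq_0)
  then have "dir x v (coeff (r a) m) = t a m" if "a < c" "m < k" for a m
    using that coeff_diff_coeffs[of x v "r a" m] by (simp add: y_def coeff_sum)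
  then show ?thesis
    by blast
qed

end

section \<open>The choice of a point at infinity\<close>

text \<open>For small \<eta> the diagonal dominates: in a relation between the rows, a coefficient
  of largest modulus would be smaller than itself.\<close>

lemma perturbed_identity_surjective:
  fixes V :: "'w \<Rightarrow> 'w \<Rightarrow> complex"
  assumes "finite W"
  shows "\<exists>\<epsilon>>0. \<forall>\<eta>. cmod \<eta> < \<epsilon> \<longrightarrow> (\<forall>t. \<exists>c. \<forall>a\<in>W. c a + \<eta> * (\<Sum>b\<in>W. c b * V a b) = t a)"
proof -
  \<comment> \<open>Bounds all absolute column sums of V; the summand 1 makes it positive.\<close>
  define C where "C = 1 + (\<Sum>a\<in>W. \<Sum>b\<in>W. cmod (V a b))"
  have C: "C > 0"
    unfolding C_def by (intro add_pos_nonneg sum_nonneg) auto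
  have "\<exists>c. \<forall>a\<in>W. c a + \<eta> * (\<Sum>b\<in>W. c b * V a b) = t a" if \<eta>: "cmod \<eta> < 1 / C" for \<eta> t
  proof -
    obtain f where f: "bij_betw f {..<card W} W"
      using ex_bij_betw_nat_finite[OF assms] by (auto simp: lessThan_atLeast0)
    define M where "M = (\<lambda>n b. (if f n = b then 1 else 0) + \<eta> * V (f n) b)"
    have "\<exists>v. (\<forall>w. w \<notin> W \<longrightarrow> v w = 0) \<and> (\<forall>n<card W. (\<Sum>b\<in>W. v b * M n b) = t (f n))"
    proof (rule independent_rows_surjective[OF assms])
      fix c :: "nat \<Rightarrow> complex" assume c: "\<And>b. b \<in> W \<Longrightarrow> (\<Sum>n<card W. c n * M n b) = 0"
      show "\<forall>n<card W. c n = 0"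
      proof (rule ccontr)
        assume "\<not> ?thesis"
        then obtain n0 where n0: "n0 < card W" "c n0 \<noteq> 0"
          by blast
        define m where "m = Max ((\<lambda>n. cmod (c n)) ` {..<card W})"
        have "m \<in> (\<lambda>n. cmod (c n)) ` {..<card W}"
          unfolding m_def by (rule Max_in) (use n0 in auto)
        then obtain n1 where n1: "n1 < card W" "m = cmod (c n1)"
          by auto
        have le: "cmod (c n) \<le> m" if "n < card W" for n
          unfolding m_def by (rule Max_ge) (use that in auto)
        have m: "m > 0"
          using le[OF n0(1)] n0(2) by (meson norm_le_zero_iff not_less order_trans)
        have fW: "f n \<in> W" if "n < card W" for n
          using f that by (auto simp: bij_betw_def)
        have inj: "f n = f n1 \<longleftrightarrow> n = n1" if "n < card W" for n
          using f that n1(1) by (auto simp: bij_betw_def inj_on_def)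
        have "0 = (\<Sum>n<card W. c n * M n (f n1))"
          using c[OF fW[OF n1(1)]] by simp
        also have "\<dots> = (\<Sum>n<card W. (if n = n1 then c n else 0) + \<eta> * (c n * V (f n) (f n1)))"
          by (rule sum.cong) (use inj in \<open>auto simp: M_def algebra_simps\<close>)
        also have "\<dots> = c n1 + \<eta> * (\<Sum>n<card W. c n * V (f n) (f n1))"
          using n1(1) by (simp add: sum.distrib sum_distrib_left)
        finally have "c n1 = - (\<eta> * (\<Sum>n<card W. c n * V (f n) (f n1)))"
          by (simp add: eq_neg_iff_add_eq_0)
        then have "m = cmod \<eta> * cmod (\<Sum>n<card W. c n * V (f n) (f n1))"
          by (simp add: n1(2) norm_mult)
        also have "cmod (\<Sum>n<card W. c n * V (f n) (f n1)) \<le> (\<Sum>n<card W. m * cmod (V (f n) (f n1)))"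
          by (rule sum_norm_le) (use le in \<open>auto simp: norm_mult intro: mult_right_mono\<close>)
        also have "\<dots> = m * (\<Sum>a\<in>W. cmod (V a (f n1)))"
          using sum.reindex_bij_betw[OF f, of "\<lambda>a. cmod (V a (f n1))"] by (simp add: sum_distrib_left[symmetric])
        also have "(\<Sum>a\<in>W. cmod (V a (f n1))) \<le> (\<Sum>a\<in>W. \<Sum>b\<in>W. cmod (V a b))"
          by (intro sum_mono member_le_sum fW n1 assms) auto
        also have "\<dots> \<le> C"
          by (simp add: C_def)
        finally have "m \<le> cmod \<eta> * (m * C)"
          using m by (simp add: mult_left_mono)
        moreover have "cmod \<eta> * (m * C) < m"
          using \<eta> C m by (simp add: field_simps)
        ultimately show False
          by simp
      qed
    qed
    then obtain v where v: "\<And>n. n < card W \<Longrightarrow> (\<Sum>b\<in>W. v b * M n b) = t (f n)"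
      by blast
    have "v a + \<eta> * (\<Sum>b\<in>W. v b * V a b) = t a" if a: "a \<in> W" for a
    proof -
      obtain n where n: "n < card W" "a = f n"
        using f a by (auto simp: bij_betw_def)
      have "(\<Sum>b\<in>W. v b * M n b) = (\<Sum>b\<in>W. (if b = a then v b else 0) + \<eta> * (v b * V a b))"
        by (rule sum.cong) (auto simp: M_def n(2) algebra_simps)
      also have "\<dots> = v a + \<eta> * (\<Sum>b\<in>W. v b * V a b)"
        using a assms by (simp add: sum.distrib sum_distrib_left)
      finally show ?thesis
        using v[OF n(1)] n(2) by simp
    qed
    then show ?thesis
      by blast
  qed
  then show ?thesis
    using C by (intro exI[of _ "1 / C"]) simp
qed

text \<open>The leading coefficient is the value of Z at \<open>(1 : \<beta>)\<close>, a polynomial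
  in \<beta> that is nonzero because each factor has a coefficient normalized to 1.\<close>

lemma finite_bad_infinity:
  fixes x :: "'i coord \<Rightarrow> complex"
  assumes "\<And>m. m \<in># K \<Longrightarrow> e m \<le> count K m"
  shows "finite {\<beta>. value_at x (coeff (dehom \<beta> (Z_form K e)) (sum_mset K)) = 0}"
proof -
  define F where "F = (\<lambda>m. \<Sum>a\<le>count K m. monom (if a = e m then 1 else x (FormCoeff m a)) (count K m - a))"
  have "F m \<noteq> 0" if "m \<in># K" for m
  proof -
    have "coeff (F m) (count K m - e m) = (\<Sum>a\<le>count K m. if a = e m then 1 else 0)"
      unfolding F_def coeff_sum by (rule sum.cong) (use assms[OF that] in auto)
    also have "\<dots> = 1"
      using assms[OF that] by simp
    finally show ?thesis
      by auto
  qed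
  then have P: "(\<Prod>m\<in>set_mset K. F m ^ m) \<noteq> 0"
    by auto
  have "value_at x (coeff (dehom \<beta> (Z_form K e)) (sum_mset K)) = poly (\<Prod>m\<in>set_mset K. F m ^ m) \<beta>" for \<beta>
  proof -
    let ?Z = "Z_form K e :: 'i coord cpoly" and ?y = "x(ParS := 1, ParT := \<beta>)"
    have Z_form: "is_form (sum_mset K) ?Z"
      by (rule is_form_Z_form)
    \<comment> \<open>The frame indices do not occur in Z, so arbitrary ones are inserted.\<close>
    have Z: "vars_in (S_coords K undefined undefined e \<union> {ParS, ParT}) ?Z"
      by (rule vars_in_Z_form)
    have "ParS \<notin> vars (coeff (dehom \<beta> ?Z) n)" "ParT \<notin> vars (coeff (dehom \<beta> ?Z) n)" for n
      using vars_in_dehom[OF Z, of \<beta> n] S_coords_no_params(1)[of K undefined undefined e]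
      by (auto simp: vars_in_def)
    then have no_params: "value_at ?y (coeff (dehom \<beta> ?Z) n) = value_at x (coeff (dehom \<beta> ?Z) n)" for n
      by (intro value_at_cong) auto
    have "value_at ?y ?Z = value_at ?y (hmg \<beta> (sum_mset K) (dehom \<beta> ?Z))"
      using Z_form by (simp add: is_form_def)
    also have "\<dots> = (\<Sum>n\<le>sum_mset K. if n = sum_mset K then value_at x (coeff (dehom \<beta> ?Z) n) else 0)"
      unfolding hmg_def value_at_sum by (rule sum.cong) (auto simp: no_params)
    also have "\<dots> = value_at x (coeff (dehom \<beta> ?Z) (sum_mset K))"
      by simp
    finally have "value_at x (coeff (dehom \<beta> ?Z) (sum_mset K)) = value_at ?y ?Z"
      by simp
    also have "\<dots> = (\<Prod>m\<in>set_mset K. (\<Sum>a\<le>count K m.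
        (if a = e m then 1 else x (FormCoeff m a)) * \<beta> ^ (count K m - a)) ^ m)"
      by (simp add: Z_form_def points_form_def value_at_prod value_at_sum if_distrib[of "value_at _"] cong: if_cong)
    also have "\<dots> = poly (\<Prod>m\<in>set_mset K. F m ^ m) \<beta>"
      by (simp add: F_def poly_prod poly_sum poly_monom)
    finally show ?thesis .
  qed
  then show ?thesis
    using poly_roots_finite[OF P] by simp
qed

text \<open>At the given point of the line tangent vectors produce every displacement. By
  perturbation this persists at nearby points, infinitely many of which avoid Z.\<close>

lemma exists_point_at_infinity:
  fixes x :: "'i::finite coord \<Rightarrow> complex"
  assumes ij: "i \<noteq> j" and e: "\<And>m. m \<in># K \<Longrightarrow> e m \<le> count K m"
    and T: "\<And>w. \<exists>v. (\<forall>f\<in>H. dir x v f = 0) \<and>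
      (\<forall>l. l \<noteq> (if \<delta> then i else j) \<longrightarrow> dir x v (theta i j \<delta> l) = w l)"
  obtains \<beta> where "value_at x (coeff (dehom \<beta> (Z_form K e)) (sum_mset K)) \<noteq> 0"
    "\<And>w. \<exists>v. (\<forall>f\<in>H. dir x v f = 0) \<and>
      (\<forall>l. l \<noteq> i \<longrightarrow> l \<noteq> j \<longrightarrow> v (FrameU l) + \<beta> * v (FrameV l) = w l)"
proof -
  define W where "W = UNIV - {i, j}"
  define s where "s = (if \<delta> then 1 else x LinePt)"
  define t where "t = (if \<delta> then x LinePt else 1)"
  have "\<exists>v. (\<forall>f\<in>H. dir x v f = 0) \<and>
      (\<forall>l\<in>W. s * v (FrameU l) + t * v (FrameV l) = (if l = b then 1 else 0))" for b
  proof -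
    let ?w = "\<lambda>l. if l = i \<or> l = j then 0 else if l = b then 1 else 0"
    obtain v where v: "\<forall>f\<in>H. dir x v f = 0"
      "\<And>l. l \<noteq> (if \<delta> then i else j) \<Longrightarrow> dir x v (theta i j \<delta> l) = ?w l"
      using T[of ?w] by blast
    \<comment> \<open>The coordinate of \<theta> at the other frame index is \<open>LinePt\<close>
      itself. Prescribing 0 there fixes the point of the parameter line to first order, so that only
      the frame moves.\<close>
    have "v LinePt = 0"
      using v(2)[of "if \<delta> then j else i"] ij
      by (cases \<delta>) (auto simp: theta_def frame_u_def frame_v_def)
    then have "s * v (FrameU l) + t * v (FrameV l) = (if l = b then 1 else 0)" if "l \<in> W" for l
      using v(2)[of l] that
      by (auto simp: W_def theta_def frame_u_def frame_v_def s_def t_def algebra_simps split: if_splits)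
    then show ?thesis
      using v(1) by blast
  qed
  then obtain E where E: "\<And>b f. f \<in> H \<Longrightarrow> dir x (E b) f = 0"
    "\<And>b l. l \<in> W \<Longrightarrow> s * E b (FrameU l) + t * E b (FrameV l) = (if l = b then 1 else 0)"
    by metis
  \<comment> \<open>The derivative in \<eta> of the displacement that \<open>E b\<close> produces at
    the moving point \<open>(s' : t')\<close>.\<close>
  define V where "V = (\<lambda>l b. if \<delta> then E b (FrameV l) else E b (FrameU l))"
  obtain \<epsilon> where \<epsilon>: "\<epsilon> > 0" "\<And>\<eta> w. cmod \<eta> < \<epsilon> \<Longrightarrow> \<exists>c. \<forall>a\<in>W. c a + \<eta> * (\<Sum>b\<in>W. c b * V a b) = w a"
    using perturbed_identity_surjective[of W V] by (auto simp: W_def)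
  text \<open>A point \<open>(s' : t')\<close> of the line near \<open>(s : t)\<close>.\<close>
  define s' where "s' = (\<lambda>\<eta>. if \<delta> then s else s + \<eta>)"
  define t' where "t' = (\<lambda>\<eta>. if \<delta> then t + \<eta> else t)"
  have near: "\<exists>v. (\<forall>f\<in>H. dir x v f = 0) \<and> (\<forall>l\<in>W. s' \<eta> * v (FrameU l) + t' \<eta> * v (FrameV l) = w l)"
    if \<eta>: "cmod \<eta> < \<epsilon>" for \<eta> w
  proof -
    obtain c where c: "\<And>a. a \<in> W \<Longrightarrow> c a + \<eta> * (\<Sum>b\<in>W. c b * V a b) = w a"
      using \<epsilon>(2)[OF \<eta>] by blast
    define v where "v = (\<lambda>u. \<Sum>b\<in>W. c b * E b u)"
    have "dir x v f = (\<Sum>b\<in>W. c b * dir x (E b) f)" for f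
    proof -
      have "finite B \<Longrightarrow> dir x (\<lambda>u. \<Sum>b\<in>B. c b * E b u) f = (\<Sum>b\<in>B. c b * dir x (E b) f)" for B
      proof (induction B rule: finite_induct)
        case (insert b B)
        then show ?case
          using dir_lin[of x "c b" "E b" 1 "\<lambda>u. \<Sum>b\<in>B. c b * E b u" f] by simp
      qed simp
      then show ?thesis
        by (simp add: v_def W_def)
    qed
    then have "\<forall>f\<in>H. dir x v f = 0"
      using E(1) by simp
    moreover have "s' \<eta> * v (FrameU l) + t' \<eta> * v (FrameV l) = w l" if l: "l \<in> W" for l
    proof -
      have "s' \<eta> * v (FrameU l) + t' \<eta> * v (FrameV l) =
          (\<Sum>b\<in>W. c b * (s * E b (FrameU l) + t * E b (FrameV l)) + \<eta> * (c b * V l b))"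
        by (simp add: v_def s'_def t'_def V_def sum_distrib_left sum.distrib algebra_simps)
      also have "\<dots> = (\<Sum>b\<in>W. (if b = l then c b else 0) + \<eta> * (c b * V l b))"
        by (rule sum.cong) (auto simp: E(2)[OF l])
      also have "\<dots> = c l + \<eta> * (\<Sum>b\<in>W. c b * V l b)"
        using l by (simp add: sum.distrib sum_distrib_left W_def)
      finally show ?thesis
        using c[OF l] by simp
    qed
    ultimately show ?thesis
      by blast
  qed
  define Bad where "Bad = {\<beta>. value_at x (coeff (dehom \<beta> (Z_form K e)) (sum_mset K)) = 0}"
  \<comment> \<open>\<open>- s\<close> is excluded so that \<open>s' \<eta>\<close> is nonzero and
    \<beta> is finite.\<close>
  define R where "R = complex_of_real ` {0<..<\<epsilon>} - {- s}"
  have "infinite (complex_of_real ` {0<..<\<epsilon>})"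
    using \<epsilon>(1) by (simp add: finite_image_iff inj_on_def infinite_Ioo)
  then have R: "infinite R"
    by (simp add: R_def)
  have s': "s' \<eta> \<noteq> 0" if "\<eta> \<in> R" for \<eta>
    using that by (auto simp: s'_def s_def R_def add_eq_0_iff)
  have "inj_on (\<lambda>\<eta>. t' \<eta> / s' \<eta>) R"
  proof (rule inj_onI)
    fix \<eta> \<eta>' assume "\<eta> \<in> R" "\<eta>' \<in> R" "t' \<eta> / s' \<eta> = t' \<eta>' / s' \<eta>'"
    then show "\<eta> = \<eta>'"
      using s'[of \<eta>] s'[of \<eta>'] by (auto simp: s'_def t'_def s_def t_def field_simps split: if_splits)
  qed
  then have "infinite ((\<lambda>\<eta>. t' \<eta> / s' \<eta>) ` R)"
    using R by (simp add: finite_image_iff)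
  moreover have "finite Bad"
    unfolding Bad_def by (rule finite_bad_infinity) (rule e)
  ultimately obtain \<eta> where \<eta>: "\<eta> \<in> R" "t' \<eta> / s' \<eta> \<notin> Bad"
    by (meson finite_subset image_subsetI)
  define \<beta> where "\<beta> = t' \<eta> / s' \<eta>"
  have "cmod \<eta> < \<epsilon>"
    using \<eta>(1) by (auto simp: R_def)
  have "\<exists>v. (\<forall>f\<in>H. dir x v f = 0) \<and> (\<forall>l. l \<noteq> i \<longrightarrow> l \<noteq> j \<longrightarrow> v (FrameU l) + \<beta> * v (FrameV l) = w l)" for w
  proof -
    obtain v where v: "\<forall>f\<in>H. dir x v f = 0"
      "\<And>l. l \<in> W \<Longrightarrow> s' \<eta> * v (FrameU l) + t' \<eta> * v (FrameV l) = s' \<eta> * w l"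
      using near[OF \<open>cmod \<eta> < \<epsilon>\<close>, of "\<lambda>l. s' \<eta> * w l"] by blast
    have "v (FrameU l) + \<beta> * v (FrameV l) = w l" if "l \<noteq> i" "l \<noteq> j" for l
    proof -
      have "s' \<eta> * (v (FrameU l) + \<beta> * v (FrameV l)) = s' \<eta> * w l"
        using v(2)[of l] that s'[OF \<eta>(1)] by (simp add: W_def \<beta>_def distrib_left)
      then show ?thesis
        using s'[OF \<eta>(1)] by simp
    qed
    then show ?thesis
      using v(1) by blast
  qed
  moreover have "value_at x (coeff (dehom \<beta> (Z_form K e)) (sum_mset K)) \<noteq> 0"
    using \<eta>(2) by (simp add: Bad_def \<beta>_def)
  ultimately show thesis
    using that by blast
qed


section \<open>Smoothness of the fibre at a point\<close>

lemma surjective_imp_independent_differentials: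
  assumes gs: "\<And>p. p \<in> set gs \<Longrightarrow> vars_in W p" and "finite W"
    and surj: "\<And>t. \<exists>v. \<forall>a<length gs. dir x v (gs ! a) = t a"
  shows "independent_differentials W x gs"
  unfolding independent_differentials_def
proof (intro allI impI)
  fix c :: "nat \<Rightarrow> complex" and a
  assume c: "\<forall>w\<in>W. (\<Sum>a<length gs. c a * partial_deriv w (gs ! a) x) = 0" and a: "a < length gs"
  obtain v where v: "\<And>b. b < length gs \<Longrightarrow> dir x v (gs ! b) = (if b = a then 1 else 0)"
    using surj[of "\<lambda>b. if b = a then 1 else 0"] by blast
  have "c a = (\<Sum>b<length gs. if b = a then c b else 0)"
    using a by simp
  also have "\<dots> = (\<Sum>b<length gs. c b * dir x v (gs ! b))"
    by (rule sum.cong) (auto simp: v)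
  also have "\<dots> = (\<Sum>b<length gs. \<Sum>w\<in>W. v w * (c b * partial_deriv w (gs ! b) x))"
    using gs assms(2) by (simp add: dir_eq_sum[of W] sum_distrib_left algebra_simps)
  also have "\<dots> = (\<Sum>w\<in>W. v w * (\<Sum>b<length gs. c b * partial_deriv w (gs ! b) x))"
    by (subst sum.swap) (simp add: sum_distrib_left)
  also have "\<dots> = 0"
    using c by simp
  finally show "c a = 0" .
qed

lemma sum_count_eq_size: "(\<Sum>m\<in>set_mset K. count K m) = size K"
  by (simp add: size_multiset_overloaded_eq)

lemma finite_S_coords:
  fixes i j :: "'i::finite"
  shows "finite (S_coords K i j e)"
proof -
  have "{FormCoeff m a | m a. m \<in># K \<and> a \<le> count K m \<and> a \<noteq> e m}
      \<subseteq> (\<Union>m\<in>set_mset K. FormCoeff m ` {..count K m})"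
    by auto
  then have "finite {FormCoeff m a :: 'i coord | m a. m \<in># K \<and> a \<le> count K m \<and> a \<noteq> e m}"
    by (rule finite_subset) auto
  then show ?thesis
    by (simp add: S_coords_def)
qed

text \<open>A line has 2 (N - 1) coordinates, a form F_m has r_m free coefficients because one of
  r_m + 1 is normalized, and the point on the line adds one coordinate.\<close>

lemma card_bundle_coords:
  fixes i j :: "'i::finite"
  assumes "i \<noteq> j" "CARD('i) = N + 1" and e: "\<And>m. m \<in># K \<Longrightarrow> e m \<le> count K m"
  shows "int (card (bundle_coords K i j e)) = 2 * int N - 1 + int (size K)"
proof -
  let ?F = "{FormCoeff m a :: 'i coord | m a. m \<in># K \<and> a \<le> count K m \<and> a \<noteq> e m}"
  have F: "?F = (\<lambda>(m, a). FormCoeff m a) ` (SIGMA m:set_mset K. {..count K m} - {e m})"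
    by auto
  have "card ?F = card (SIGMA m:set_mset K. {..count K m} - {e m})"
    unfolding F by (rule card_image) (auto simp: inj_on_def)
  also have "\<dots> = (\<Sum>m\<in>set_mset K. count K m)"
    using e by (simp add: card_Diff_subset)
  finally have cF: "card ?F = size K"
    by (simp add: sum_count_eq_size)
  have fin: "finite ?F"
    unfolding F by simp
  have card_ij: "card (UNIV - {i, j}) = N - 1"
    using assms(1,2) by (simp add: card_Diff_subset)
  have N: "N \<ge> 1"
    using card_mono[of UNIV "{i, j}"] assms(1,2) by simp
  have U: "card (FrameU ` (UNIV - {i, j}) :: 'i coord set) = N - 1"
    and V: "card (FrameV ` (UNIV - {i, j}) :: 'i coord set) = N - 1"
    unfolding card_ij[symmetric] by (rule card_image; auto simp: inj_on_def)+
  have "card (S_coords K i j e) = (N - 1) + (N - 1) + size K"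
    unfolding S_coords_def using fin
    by (subst card_Un_disjoint, simp, simp, blast, subst card_Un_disjoint, simp, simp, blast)
      (simp add: U V cF)
  then show ?thesis
    using N S_coords_no_params(2)[of K i j e] finite_S_coords[of K i j e]
    by (simp add: bundle_coords_def)
qed

lemma vars_in_theta: "vars_in (bundle_coords K i j e) (theta i j \<delta> l)"
proof -
  have "vars_in (bundle_coords K i j e) (frame_u i j l)" "vars_in (bundle_coords K i j e) (frame_v i j l)"
    by (rule vars_in_mono[OF vars_in_frame(1)], force simp: bundle_coords_def)
      (rule vars_in_mono[OF vars_in_frame(2)], force simp: bundle_coords_def)
  then show ?thesis
    by (auto simp: theta_def bundle_coords_def)
qed

lemma theta_base: "i \<noteq> j \<Longrightarrow> theta i j \<delta> (if \<delta> then i else j) = 1"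
  by (auto simp: theta_def frame_u_def frame_v_def)

lemma theta_fibre_zeroD:
  assumes "zero_of (theta_fibre_ideal X K p i j e \<delta>) x"
  shows "zero_of (H_ideal X K i j e) x"
    "p l * value_at x (theta i j \<delta> l') = p l' * value_at x (theta i j \<delta> l)"
proof -
  let ?S = "H_ideal X K i j e \<union> {Const (p l) * theta i j \<delta> l' - Const (p l') * theta i j \<delta> l | l l'. True}"
  have vars: "vars_in (bundle_coords K i j e) f" if "f \<in> ?S" for f
    using that H_ideal_vars[of f X K i j e] vars_in_mono[of "S_coords K i j e" f "bundle_coords K i j e"]
      vars_in_theta[of K i j e \<delta>]
    by (auto simp: bundle_coords_def)
  have zero: "value_at x f = 0" if "f \<in> ?S" for f
    using assms vars[OF that] that genideal_eq_span[of ?S, OF vars]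
    unfolding theta_fibre_ideal_def zero_of_def by (auto intro: mul.span_base)
  show "zero_of (H_ideal X K i j e) x"
    using zero by (auto simp: zero_of_def)
  have "Const (p l) * theta i j \<delta> l' - Const (p l') * theta i j \<delta> l \<in> ?S"
    by blast
  from zero[OF this] show "p l * value_at x (theta i j \<delta> l') = p l' * value_at x (theta i j \<delta> l)"
    by simp
qed

text \<open>In the 2 N - 1 + r coordinates of the line bundle, the fibre is cut out by k c
  coefficients of remainders and N equations fixing the image point. The differentials of the first
  group are independent, and tangent vectors of H, on which they vanish, realize all values of the
  second.\<close>

lemma theta_fibre_smooth_at:
  fixes X :: "('i::finite \<Rightarrow> complex) set"
  assumes N: "CARD('i) = N + 1" "N = n + c" and X: "quasi_projective X" "smooth_of_dim X n"
    and chart: "is_S_chart K i j e" and point: "H_point X K i j e x"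
    and zero: "zero_of (theta_fibre_ideal X K p i j e \<delta>) x"
    and p: "p (if \<delta> then i else j) \<noteq> 0"
    and surj: "\<And>w. \<exists>v. (\<forall>f\<in>H_ideal X K i j e. dir x v f = 0) \<and>
      (\<forall>l. l \<noteq> (if \<delta> then i else j) \<longrightarrow> dir x v (theta i j \<delta> l) = w l)"
  shows "smooth_at (bundle_coords K i j e) (theta_fibre_ideal X K p i j e \<delta>)
    (int N - 1 + int (size K) - int (sum_mset K) * int c) x"
proof -
  have ij: "i \<noteq> j" and e: "\<And>m. m \<in># K \<Longrightarrow> e m \<le> count K m"
    using chart by (auto simp: is_S_chart_def)
  obtain \<beta> where \<beta>: "value_at x (coeff (dehom \<beta> (Z_form K e)) (sum_mset K)) \<noteq> 0"
    and tangent: "\<And>w. \<exists>v. (\<forall>f\<in>H_ideal X K i j e. dir x v f = 0) \<and>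
      (\<forall>l. l \<noteq> i \<longrightarrow> l \<noteq> j \<longrightarrow> v (FrameU l) + \<beta> * v (FrameV l) = w l)"
    using exists_point_at_infinity[OF ij e surj] by blast
  interpret aligned_point X K i j e x \<beta>
    using chart point \<beta> by unfold_locales
  define \<iota> where "\<iota> = (if \<delta> then i else j)"
  define BC where "BC = bundle_coords K i j e"
  have SC_BC: "SC \<subseteq> BC"
    by (auto simp: SC_def BC_def bundle_coords_def)
  \<comment> \<open>Representatives in X of the points of Z; one system of local equations has to
    serve at all of them.\<close>
  define T where "T = (\<lambda>\<tau> l. poly (line0 l) \<tau>) ` {\<tau>. poly z0 \<tau> = 0}"
  have "finite T" "T \<subseteq> X"
    using poly_roots_finite[OF z0_nonzero] root_in_X by (auto simp: T_def)
  then obtain g where g: "\<And>a. a < c \<Longrightarrow> g a \<in> cone_ideal X"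
    "\<And>y t. y \<in> T \<Longrightarrow> \<exists>v. \<forall>a<c. dir y v (g a) = t a"
    "\<And>f. f \<in> cone_ideal X \<Longrightarrow> \<exists>h. (\<forall>y\<in>T. value_at y h \<noteq> 0) \<and> h * f \<in> mul.span (g ` {..<c})"
    using local_equations[OF N X] by blast
  define D where "D = (\<lambda>a. Suc (degree (pull (g a))))"
  have "\<exists>q r. smult (\<phi> ^ D a) (pull (g a)) = q * z + r \<and> (\<forall>m\<ge>k. coeff r m = 0) \<and>
      (\<forall>m. vars_in SC (coeff r m))" for a
    unfolding \<phi>_def
    by (rule pseudo_division[of k z SC "D a" "pull (g a)"])
      (use z_bound z_vars pull_vars in \<open>auto simp: D_def coeff_eq_0\<close>)
  then obtain q r where qr: "\<And>a. smult (\<phi> ^ D a) (pull (g a)) = q a * z + r a"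
    "\<And>a m. m \<ge> k \<Longrightarrow> coeff (r a) m = 0" "\<And>a m. vars_in SC (coeff (r a) m)"
    by metis
  have r_loc: "coeff (r a) m \<in> H_loc" if "a < c" for a m
  proof (rule near_remainder[OF H_loc_subspace])
    note sN = subspace_near[OF H_loc_subspace]
    have "r a = [:\<phi> ^ D a:] * pull (g a) - q a * z"
      using qr(1)[of a] by simp
    also have "\<dots> \<in> near H_loc"
      by (rule mul.subspace_diff[OF sN mul.subspace_scale[OF sN pull_near[OF g(1)[OF that]]]
            near_z[OF H_loc_subspace]])
    finally show "r a \<in> near H_loc" .
  qed (use qr(2) loc_\<phi>_cancel in \<open>auto simp: H_loc_def\<close>)
  define S where "S = {coeff (r a) m | a m. a < c \<and> m < k}"
  have H_S: "H_ideal X K i j e \<subseteq> loc x (mul.span S)"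
  proof (rule H_ideal_locally_generated)
    show "vars_in SC f" if "f \<in> S" for f
      using that qr(3) by (auto simp: S_def)
    show "pull (g a) \<in> near (loc x (mul.span S))" if "a < c" for a
    proof -
      have "coeff (r a) m \<in> mul.span S" for m
      proof (cases "m < k")
        case True
        then show ?thesis
          using \<open>a < c\<close> by (intro mul.span_base) (auto simp: S_def)
      qed (simp add: qr(2) mul.span_zero)
      then have "r a \<in> coeffs_in (loc x (mul.span S))"
        using loc_base[of "mul.span S" x] by (auto simp: coeffs_in_def)
      moreover have "r a = smult (\<phi> ^ D a) (pull (g a)) - q a * z"
        using qr(1)[of a] by simp
      ultimately show ?thesis
        unfolding near_def by (intro CollectI exI[of _ "D a"] exI[of _ "q a"]) simp
    qed
    show "\<exists>h. (\<forall>\<tau>. poly z0 \<tau> = 0 \<longrightarrow> value_at (\<lambda>l. poly (line0 l) \<tau>) h \<noteq> 0) \<and>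
        h * f \<in> mul.span (g ` {..<c})" if "f \<in> cone_ideal X" for f
      using g(3)[OF that] by (auto simp: T_def)
  qed
  obtain en where en: "bij_betw en {..<N} (UNIV - {\<iota>})"
    using ex_bij_betw_nat_finite[of "UNIV - {\<iota>}"] N(1) by (auto simp: card_Diff_subset lessThan_atLeast0)
  \<comment> \<open>As \<theta> is 1 at the index \<iota> and \<open>p \<iota>\<close> is a nonzero
    constant, these equations generate all proportionality equations.\<close>
  define E where "E = (\<lambda>l. Const (p \<iota>) * theta i j \<delta> l - Const (p l))"
  \<comment> \<open>The remainder coefficients are numbered \<open>a * k + m\<close>, followed by
    the N fibre equations.\<close>
  define eqn where "eqn = (\<lambda>a. if a < c * k then coeff (r (a div k)) (a mod k) else E (en (a - c * k)))"
  define gs where "gs = map eqn [0..<c * k + N]"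
  have len: "length gs = c * k + N" and gs_nth: "a < c * k + N \<Longrightarrow> gs ! a = eqn a" for a
    by (simp_all add: gs_def)
  have set_gs: "set gs = S \<union> E ` (UNIV - {\<iota>})"
  proof (intro equalityI subsetI)
    fix f assume "f \<in> set gs"
    then obtain a where a: "a < c * k + N" "f = eqn a"
      by (auto simp: gs_def)
    show "f \<in> S \<union> E ` (UNIV - {\<iota>})"
    proof (cases "a < c * k")
      case True
      then have "a div k < c" "a mod k < k"
        by (auto simp: less_mult_imp_div_less intro!: mod_less_divisor gr0I)
      then show ?thesis
        using True a(2) by (auto simp: eqn_def S_def)
    next
      case False
      then have "en (a - c * k) \<in> UNIV - {\<iota>}"
        using en a(1) by (intro bij_betwE[OF en, rule_format]) auto
      then show ?thesis
        using False a(2) by (auto simp: eqn_def)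
    qed
  next
    fix f assume "f \<in> S \<union> E ` (UNIV - {\<iota>})"
    then show "f \<in> set gs"
    proof
      assume "f \<in> S"
      then obtain a m where am: "f = coeff (r a) m" "a < c" "m < k"
        by (auto simp: S_def)
      have "a * k + m < c * k"
        using am(2,3) by (metis add.commute add_less_cancel_left less_le_trans mult_Suc mult_le_mono1 Suc_leI)
      then have "eqn (a * k + m) = f" "a * k + m < c * k + N"
        using am by (simp_all add: eqn_def)
      then show ?thesis
        unfolding gs_def by force
    next
      assume "f \<in> E ` (UNIV - {\<iota>})"
      then obtain l where "l \<in> UNIV - {\<iota>}" "f = E l"
        by blast
      moreover from this(1) obtain b where "b < N" "l = en b"
        using bij_betw_imp_surj_on[OF en] by (metis imageE lessThan_iff)
      ultimately have "b < N" "f = E (en b)"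
        by simp_all
      then have "eqn (c * k + b) = f" "c * k + b < c * k + N"
        by (simp_all add: eqn_def)
      then show ?thesis
        unfolding gs_def by force
    qed
  qed
  have E_vars: "vars_in BC (E l)" for l
    using vars_in_theta[of K i j e \<delta> l] by (simp add: E_def BC_def)
  have gs_vars: "vars_in BC f" if "f \<in> set gs" for f
    using that qr(3) vars_in_mono[OF _ SC_BC] E_vars by (auto simp: set_gs S_def)
  define \<Theta> where "\<Theta> = {Const (p l) * theta i j \<delta> l' - Const (p l') * theta i j \<delta> l | l l'. True}"
  have \<iota>: "theta i j \<delta> \<iota> = 1" "p \<iota> \<noteq> 0"
    using theta_base[OF ij] p by (simp_all add: \<iota>_def)
  have stalk: "same_stalk BC x (theta_fibre_ideal X K p i j e \<delta>) (genideal (poly_ring BC) (set gs))"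
    unfolding theta_fibre_ideal_def BC_def[symmetric] \<Theta>_def[symmetric]
  proof (rule same_stalkI)
    show "vars_in BC f" if "f \<in> H_ideal X K i j e \<union> \<Theta>" for f
      using that
    proof
      assume "f \<in> H_ideal X K i j e"
      then show ?thesis
        using vars_in_mono[OF H_ideal_vars SC_BC[unfolded SC_def]] by blast
    next
      assume "f \<in> \<Theta>"
      then show ?thesis
        using vars_in_theta[of K i j e \<delta>] by (auto simp: \<Theta>_def BC_def)
    qed
    show "vars_in BC f" if "f \<in> set gs" for f
      using gs_vars[OF that] .
    show "f \<in> loc x (mul.span (set gs))" if "f \<in> H_ideal X K i j e \<union> \<Theta>" for f
      using that
    proof
      assume "f \<in> H_ideal X K i j e"
      then show ?thesis
        using H_S loc_mono[OF mul.span_mono[of S "set gs"], of x] by (auto simp: set_gs)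
    next
      assume "f \<in> \<Theta>"
      then obtain l l' where f: "f = Const (p l) * theta i j \<delta> l' - Const (p l') * theta i j \<delta> l"
        by (auto simp: \<Theta>_def)
      have E_span: "E l \<in> mul.span (set gs)" for l
      proof (cases "l = \<iota>")
        case True
        then show ?thesis
          by (simp add: E_def \<iota>(1) mul.span_zero)
      next
        case False
        then show ?thesis
          by (intro mul.span_base) (auto simp: set_gs)
      qed
      have "Const (p \<iota>) * f = Const (p l) * E l' - Const (p l') * E l"
        by (simp add: f E_def algebra_simps)
      also have "\<dots> \<in> mul.span (set gs)"
        by (intro mul.span_diff mul.span_scale E_span)
      finally show ?thesis
        using \<iota>(2) unfolding loc_def by (intro CollectI exI[of _ "Const (p \<iota>)"]) simp
    qed
    show "f \<in> loc x (mul.span (H_ideal X K i j e \<union> \<Theta>))" if "f \<in> set gs" for f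
    proof -
      consider "f \<in> S" | l where "f = E l"
        using \<open>f \<in> set gs\<close> unfolding set_gs by blast
      then show ?thesis
      proof cases
        case 1
        then have "f \<in> H_loc"
          using r_loc by (auto simp: S_def)
        then show ?thesis
          using loc_mono[OF mul.span_mono[of "H_ideal X K i j e" "H_ideal X K i j e \<union> \<Theta>"], of x]
          by (auto simp: H_loc_def)
      next
        case 2
        then have "f = Const (p \<iota>) * theta i j \<delta> l - Const (p l) * theta i j \<delta> \<iota>"
          by (simp add: E_def \<iota>(1))
        then have "f \<in> \<Theta>"
          unfolding \<Theta>_def by blast
        then have "f \<in> mul.span (H_ideal X K i j e \<union> \<Theta>)"
          by (intro mul.span_base) simp
        then show ?thesis
          using loc_base[of "mul.span (H_ideal X K i j e \<union> \<Theta>)" x] by blast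
      qed
    qed
  qed
  have "independent_differentials BC x gs"
  proof (rule surjective_imp_independent_differentials[OF gs_vars])
    show "finite BC"
      using finite_S_coords[of K i j e] by (simp add: BC_def bundle_coords_def)
    fix t :: "nat \<Rightarrow> complex"
    have "\<exists>v. \<forall>a<c. \<forall>m<k. dir x v (coeff (r a) m) = t (a * k + m)"
    proof (rule equations_independent[of c g D q r "\<lambda>a m. t (a * k + m)"])
      show "\<exists>v. \<forall>a<c. dir (\<lambda>l. poly (line0 l) \<tau>) v (g a) = t a" if "poly z0 \<tau> = 0" for \<tau> t
        using g(2)[of "\<lambda>l. poly (line0 l) \<tau>" t] that by (auto simp: T_def)
    qed (use g(1) qr r_loc tangent in auto)
    then obtain v1 where v1: "\<And>a m. a < c \<Longrightarrow> m < k \<Longrightarrow> dir x v1 (coeff (r a) m) = t (a * k + m)"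
      by blast
    \<comment> \<open>Corrects the values of v1 on the fibre equations; the division compensates the
      factor \<open>p \<iota>\<close> in E.\<close>
    define w where "w = (\<lambda>l. (t (c * k + the_inv_into {..<N} en l) - dir x v1 (E l)) / p \<iota>)"
    obtain v2 where v2: "\<And>f. f \<in> H_ideal X K i j e \<Longrightarrow> dir x v2 f = 0"
      "\<And>l. l \<noteq> \<iota> \<Longrightarrow> dir x v2 (theta i j \<delta> l) = w l"
      using surj[of w] unfolding \<iota>_def by blast
    define v where "v = (\<lambda>u. 1 * v1 u + 1 * v2 u)"
    have dir_v: "dir x v f = dir x v1 f + dir x v2 f" for f
      unfolding v_def dir_lin by simp
    have "dir x v (gs ! a) = t a" if a: "a < length gs" for a
    proof (cases "a < c * k")
      case True
      then have "a div k < c" "a mod k < k"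
        by (auto simp: less_mult_imp_div_less intro!: mod_less_divisor gr0I)
      then have "dir x v1 (gs ! a) = t a" "dir x v2 (gs ! a) = 0"
        using True a v1[of "a div k" "a mod k"] tangent_H_loc(2)[OF v2(1) r_loc]
        by (simp_all add: gs_nth len eqn_def)
      then show ?thesis
        by (simp add: dir_v)
    next
      case False
      define b where "b = a - c * k"
      have b: "b < N" "a = c * k + b"
        using a False by (auto simp: b_def len)
      have "en b \<noteq> \<iota>"
        using bij_betwE[OF en] b(1) by auto
      then have "dir x v2 (E (en b)) = p \<iota> * w (en b)"
        using v2(2) by (simp add: E_def)
      also have "\<dots> = t a - dir x v1 (E (en b))"
        using \<iota>(2) the_inv_into_f_f[of en "{..<N}" b] en b by (simp add: w_def bij_betw_def)
      finally show ?thesis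
        using a False by (simp add: dir_v gs_nth len eqn_def b_def)
    qed
    then show "\<exists>v. \<forall>a<length gs. dir x v (gs ! a) = t a"
      by blast
  qed
  moreover have "int (length gs) = int (card BC) - (int N - 1 + int (size K) - int (sum_mset K) * int c)"
    using card_bundle_coords[OF ij N(1) e] by (simp add: BC_def len k_def mult.commute)
  moreover have "set gs \<subseteq> carrier (poly_ring BC)"
    using gs_vars by (auto simp: carrier_poly_ring)
  ultimately show ?thesis
    unfolding smooth_at_def using zero stalk unfolding BC_def by blast
qed

section \<open>The general fibre\<close>

lemma dir_subst_Var: "dir \<xi> v (subst (\<lambda>w. Var (f w)) p) = dir (\<lambda>w. \<xi> (f w)) (\<lambda>w. v (f w)) p"
  by (induction p rule: cpoly_induct) (simp_all add: value_at_subst)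

text \<open>Sard's lemma is applied to the graph of \<open>\<theta>\<close>, in the coordinates of the affine chart of the
  projective space and of the chart of the line bundle.\<close>

lemma theta_generically_submersive:
  fixes X :: "('i::finite \<Rightarrow> complex) set"
  assumes ij: "i \<noteq> j" and \<iota>: "\<iota> = (if \<delta> then i else j)"
  shows "\<exists>Q. homogeneous Q \<and> Q \<noteq> 0 \<and> (\<forall>p x. value_at p Q \<noteq> 0 \<longrightarrow> p \<iota> \<noteq> 0 \<and>
    (zero_of (theta_fibre_ideal X K p i j e \<delta>) x \<longrightarrow>
      (\<forall>w. \<exists>v. (\<forall>f\<in>H_ideal X K i j e. dir x v f = 0) \<and>
        (\<forall>l. l \<noteq> \<iota> \<longrightarrow> dir x v (theta i j \<delta> l) = w l))))"
proof -
  define lift :: "'i coord cpoly \<Rightarrow> ('i + 'i coord) cpoly" where "lift = subst (\<lambda>w. Var (Inr w))"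
  \<comment> \<open>\<open>Inl\<close> carries affine coordinates of the target in the chart where
    coordinate \<iota> is 1, \<open>Inr\<close> the coordinates of the line bundle.\<close>
  define \<Lambda> :: "('i + 'i coord) set" where "\<Lambda> = Inl ` (UNIV - {\<iota>})"
  define W :: "('i + 'i coord) set" where "W = Inr ` bundle_coords K i j e"
  define S where "S = lift ` H_ideal X K i j e \<union> (\<lambda>l. Var (Inl l) - lift (theta i j \<delta> l)) ` (UNIV - {\<iota>})"
  define submersive where "submersive = (\<lambda>x. \<forall>w. \<exists>v. (\<forall>f\<in>H_ideal X K i j e. dir x v f = 0) \<and>
      (\<forall>l. l \<noteq> \<iota> \<longrightarrow> dir x v (theta i j \<delta> l) = w l))"
  define graph where "graph = (\<lambda>x u. case u of Inl l \<Rightarrow> value_at x (theta i j \<delta> l) | Inr w \<Rightarrow> x w)"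
  define B where "B = graph ` {x. zero_of (H_ideal X K i j e) x \<and> \<not> submersive x}"
  have lift_vars: "vars_in W (lift f)" if "vars_in (bundle_coords K i j e) f" for f
    unfolding lift_def by (rule vars_in_subst) (use that in \<open>auto simp: W_def vars_in_def\<close>)
  have H_vars: "vars_in (bundle_coords K i j e) f" if "f \<in> H_ideal X K i j e" for f
    using vars_in_mono[OF H_ideal_vars[OF that], of "bundle_coords K i j e"]
    by (auto simp: bundle_coords_def)
  have value_lift: "value_at (graph x) (lift f) = value_at x f" for x f
    unfolding lift_def value_at_subst by (simp add: graph_def)
  have dir_lift: "dir (graph x) v (lift f) = dir x (\<lambda>w. v (Inr w)) f" for x v f
    unfolding lift_def dir_subst_Var by (simp add: graph_def)
  have "\<exists>q. q \<noteq> 0 \<and> vars_in \<Lambda> q \<and> (\<forall>\<xi>\<in>B. value_at \<xi> q = 0)"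
  proof (rule algebraic_sard)
    show "finite \<Lambda>" "finite W" "W \<inter> \<Lambda> = {}"
      using finite_S_coords[of K i j e] by (auto simp: \<Lambda>_def W_def bundle_coords_def)
    show "vars_in (W \<union> \<Lambda>) f" if "f \<in> S" for f
      using that
    proof (unfold S_def, elim UnE imageE)
      fix h assume "f = lift h" "h \<in> H_ideal X K i j e"
      then show ?thesis
        using vars_in_mono[OF lift_vars[OF H_vars], of h "W \<union> \<Lambda>"] by auto
    next
      fix l assume "f = Var (Inl l) - lift (theta i j \<delta> l)" "l \<in> UNIV - {\<iota>}"
      then show ?thesis
        using vars_in_mono[OF lift_vars[OF vars_in_theta], of "W \<union> \<Lambda>"] by (auto simp: \<Lambda>_def)
    qed
    show "value_at \<xi> f = 0" if f: "f \<in> S" and \<xi>: "\<xi> \<in> B" for f \<xi>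
    proof -
      obtain x where x: "\<xi> = graph x" "zero_of (H_ideal X K i j e) x"
        using \<xi> by (auto simp: B_def)
      have "value_at \<xi> (Var (Inl l)) = value_at x (theta i j \<delta> l)" for l
        by (simp add: x(1) graph_def)
      then show ?thesis
        using f x by (auto simp: S_def value_lift zero_of_def)
    qed
    show "\<exists>a. \<nexists>v. (\<forall>u\<in>\<Lambda>. v u = a u) \<and> (\<forall>f\<in>S. dir \<xi> v f = 0)" if \<xi>: "\<xi> \<in> B" for \<xi>
    proof -
      obtain x where x: "\<xi> = graph x" "\<not> submersive x"
        using \<xi> by (auto simp: B_def)
      then obtain w where w: "\<nexists>v. (\<forall>f\<in>H_ideal X K i j e. dir x v f = 0) \<and>
          (\<forall>l. l \<noteq> \<iota> \<longrightarrow> dir x v (theta i j \<delta> l) = w l)"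
        unfolding submersive_def by blast
      show ?thesis
      proof (intro exI[of _ "\<lambda>u. case u of Inl l \<Rightarrow> w l | Inr _ \<Rightarrow> 0"] notI)
        assume "\<exists>v. (\<forall>u\<in>\<Lambda>. v u = (case u of Inl l \<Rightarrow> w l | Inr _ \<Rightarrow> 0)) \<and> (\<forall>f\<in>S. dir \<xi> v f = 0)"
        then obtain v where v: "\<And>l. l \<noteq> \<iota> \<Longrightarrow> v (Inl l) = w l" "\<And>f. f \<in> S \<Longrightarrow> dir \<xi> v f = 0"
          by (auto simp: \<Lambda>_def)
        have "dir x (\<lambda>u. v (Inr u)) f = 0" if "f \<in> H_ideal X K i j e" for f
          using v(2)[of "lift f"] that by (auto simp: S_def x(1) dir_lift)
        moreover have "dir x (\<lambda>u. v (Inr u)) (theta i j \<delta> l) = w l" if "l \<noteq> \<iota>" for l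
        proof -
          have "Var (Inl l) - lift (theta i j \<delta> l) \<in> S"
            using that by (auto simp: S_def)
          from v(2)[OF this] show ?thesis
            using v(1)[OF that] by (simp add: x(1) dir_lift)
        qed
        ultimately show False
          using w by blast
      qed
    qed
  qed
  then obtain q where q: "q \<noteq> 0" "vars_in \<Lambda> q" "\<And>\<xi>. \<xi> \<in> B \<Longrightarrow> value_at \<xi> q = 0"
    by blast
  \<comment> \<open>q involves \<open>Inl\<close> variables only; the value 0 for the others is a
    default.\<close>
  define q' where "q' = subst (\<lambda>u. case u of Inl l \<Rightarrow> Var l | Inr _ \<Rightarrow> 0) q"
  have value_q': "value_at y q' = value_at \<xi> q" if "\<And>l. l \<noteq> \<iota> \<Longrightarrow> \<xi> (Inl l) = y l" for y \<xi>
    unfolding q'_def value_at_subst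
  proof (rule value_at_cong)
    fix u assume "u \<in> vars q"
    then obtain l where "u = Inl l" "l \<noteq> \<iota>"
      using q(2) by (auto simp: vars_in_def \<Lambda>_def)
    then show "value_at y (case u of Inl l \<Rightarrow> Var l | Inr _ \<Rightarrow> 0) = \<xi> u"
      using that by simp
  qed
  obtain d G where G: "hom_deg d G"
    "\<And>y. y \<iota> \<noteq> 0 \<Longrightarrow> value_at y G = y \<iota> ^ d * value_at (\<lambda>l. y l / y \<iota>) q'"
    using homogenization[of \<iota> q'] by blast
  \<comment> \<open>The factor \<open>Var \<iota>\<close> confines p to the chart of projective
    space in which q' has been homogenized.\<close>
  define Q where "Q = Var \<iota> * G"
  have "homogeneous Q"
    using hom_deg_mult[OF hom_deg_Var G(1)] by (auto simp: Q_def homogeneous_iff)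
  moreover have "Q \<noteq> 0"
  proof -
    obtain \<xi> where \<xi>: "value_at \<xi> q \<noteq> 0"
      using cpoly_nonzero_value[OF q(1)] by blast
    define y where "y = (\<lambda>l. if l = \<iota> then 1 else \<xi> (Inl l))"
    have "value_at y Q = value_at (\<lambda>l. y l / y \<iota>) q'"
      using G(2)[of y] by (simp add: Q_def y_def)
    also have "\<dots> = value_at \<xi> q"
      by (rule value_q') (simp add: y_def)
    finally show ?thesis
      using \<xi> by auto
  qed
  moreover have "p \<iota> \<noteq> 0 \<and> (zero_of (theta_fibre_ideal X K p i j e \<delta>) x \<longrightarrow> submersive x)"
    if "value_at p Q \<noteq> 0" for p x
  proof (intro conjI impI)
    show p: "p \<iota> \<noteq> 0"
      using that by (auto simp: Q_def)
    assume zero: "zero_of (theta_fibre_ideal X K p i j e \<delta>) x"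
    have "value_at x (theta i j \<delta> l) = p l / p \<iota>" for l
    proof -
      have "p \<iota> * value_at x (theta i j \<delta> l) = p l * value_at x (theta i j \<delta> \<iota>)"
        by (rule theta_fibre_zeroD(2)[OF zero])
      moreover have "theta i j \<delta> \<iota> = 1"
        unfolding \<iota> by (rule theta_base[OF ij])
      ultimately show ?thesis
        using p by (simp add: field_simps)
    qed
    then have "value_at (\<lambda>l. p l / p \<iota>) q' = value_at (graph x) q"
      by (intro value_q') (simp add: graph_def)
    then have "value_at (graph x) q \<noteq> 0"
      using that G(2)[of p] p by (auto simp: Q_def)
    then have "graph x \<notin> B"
      using q(3) by blast
    then show "submersive x"
      using theta_fibre_zeroD(1)[OF zero] by (auto simp: B_def)
  qed
  ultimately show ?thesis
    unfolding submersive_def by blast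
qed

text \<open>Only the values of \<open>e\<close> on \<open>K\<close> matter, so there are finitely many charts.\<close>

lemma chart_cong:
  fixes X :: "('i::finite \<Rightarrow> complex) set"
  assumes "\<And>m. m \<in># K \<Longrightarrow> e m = e' m"
  shows "S_coords K i j e = S_coords K i j e'" "H_ideal X K i j e = H_ideal X K i j e'"
    "theta_fibre_ideal X K p i j e \<delta> = theta_fibre_ideal X K p i j e' \<delta>"
proof -
  show S: "S_coords K i j e = S_coords K i j e'"
    unfolding S_coords_def using assms by auto
  have "points_form K e m = (points_form K e' m :: 'i coord cpoly)" if "m \<in># K" for m
    unfolding points_form_def using assms[OF that] by simp
  then have Z: "Z_form K e = (Z_form K e' :: 'i coord cpoly)"
    unfolding Z_form_def by (intro prod.cong) auto
  show H: "H_ideal X K i j e = H_ideal X K i j e'"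
    unfolding H_ideal_def Z_in_closure_mod_def S Z ..
  show "theta_fibre_ideal X K p i j e \<delta> = theta_fibre_ideal X K p i j e' \<delta>"
    unfolding theta_fibre_ideal_def bundle_coords_def S H ..
qed

theorem theorem1p3:
  fixes X :: "('i::finite \<Rightarrow> complex) set"
    and N n c k r :: nat
    and K :: "nat multiset"
  assumes "CARD('i) = N + 1" and "N = n + c"
    and "quasi_projective X" and "connectedin zariski X" and "smooth_of_dim X n"
    and "\<forall>m\<in>#K. m > 0" and "r = size K" and "k = sum_mset K"
  shows "\<exists>U. openin zariski U \<and> U \<noteq> {} \<and>
    (\<forall>p\<in>U. theta_fibre_smooth_of_pure_dim X K p (int N - 1 + int r - int k * int c))"
proof -
  \<comment> \<open>Exponent functions normalized to 0 off K; finitely many, and every chart is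
    represented by one of them.\<close>
  define E where "E = {e :: nat \<Rightarrow> nat. \<forall>m. (m \<in> set_mset K \<longrightarrow> e m \<in> {..size K}) \<and> (m \<notin> set_mset K \<longrightarrow> e m = 0)}"
  have finE: "finite E"
    unfolding E_def by (rule finite_set_of_finite_funs) auto
  define base where "base = (\<lambda>i j \<delta>. if \<delta> then i else j :: 'i)"
  define good where "good = (\<lambda>i j e \<delta> Q. \<forall>p x. value_at p Q \<noteq> 0 \<longrightarrow> p (base i j \<delta>) \<noteq> 0 \<and>
    (zero_of (theta_fibre_ideal X K p i j e \<delta>) x \<longrightarrow>
      (\<forall>w. \<exists>v. (\<forall>f\<in>H_ideal X K i j e. dir x v f = 0) \<and>
        (\<forall>l. l \<noteq> base i j \<delta> \<longrightarrow> dir x v (theta i j \<delta> l) = w l))))"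
  have ex: "\<exists>Q. homogeneous Q \<and> Q \<noteq> 0 \<and> (i \<noteq> j \<longrightarrow> good i j e \<delta> Q)" for i j e \<delta>
  proof (cases "i = j")
    case True
    \<comment> \<open>Equal indices give no chart; the constant 1 fills their place in the
      product.\<close>
    have "homogeneous (1 :: 'i cpoly)"
      unfolding homogeneous_iff by (rule exI[of _ 0]) simp
    then show ?thesis
      using True by (intro exI[of _ 1]) simp
  next
    case False
    then show ?thesis
      using theta_generically_submersive[where X = X and K = K and e = e and \<delta> = \<delta>, OF False refl] unfolding good_def base_def by blast
  qed
  define Q where "Q = (\<lambda>i j e \<delta>. SOME Q. homogeneous Q \<and> Q \<noteq> 0 \<and> (i \<noteq> j \<longrightarrow> good i j e \<delta> Q))"
  have Q: "homogeneous (Q i j e \<delta>)" "Q i j e \<delta> \<noteq> 0" "i \<noteq> j \<Longrightarrow> good i j e \<delta> (Q i j e \<delta>)" for i j e \<delta>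
    using someI_ex[OF ex[of i j e \<delta>]] by (simp_all add: Q_def)
  define C where "C = (UNIV :: ('i \<times> 'i \<times> bool) set) \<times> E"
  \<comment> \<open>Where this product is nonzero, the exceptional loci of all charts are avoided at
    once.\<close>
  define R where "R = (\<Prod>((i, j, \<delta>), e)\<in>C. Q i j e \<delta>)"
  have finC: "finite C"
    using finE by (simp add: C_def)
  have "R \<noteq> 0"
    unfolding R_def by (rule cpoly_prod_nonzero[OF finC]) (use Q(2) in auto)
  have "homogeneous R"
    unfolding R_def by (rule homogeneous_prod) (use Q(1) in auto)
  \<comment> \<open>The extra variable forces a point where V does not vanish to be a nonzero
    vector, hence to represent a point of projective space.\<close>
  define V where "V = Var (undefined :: 'i) * R"
  have "V \<noteq> 0"
  proof -
    have "value_at (\<lambda>_. 1) (Var (undefined :: 'i)) \<noteq> 0"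
      by simp
    then have "Var (undefined :: 'i) \<noteq> 0"
      by force
    then show ?thesis
      using \<open>R \<noteq> 0\<close> by (simp add: V_def cpoly_mult_nonzero)
  qed
  define U where "U = {p :: 'i \<Rightarrow> complex. (\<exists>l. p l \<noteq> 0) \<and> value_at p R \<noteq> 0}"
  have "openin zariski U"
    unfolding zariski_def U_def
    by (rule topology_generated_by_Basis) (use \<open>homogeneous R\<close> in blast)
  moreover have "U \<noteq> {}"
  proof -
    obtain p where "value_at p V \<noteq> 0"
      using cpoly_nonzero_value[OF \<open>V \<noteq> 0\<close>] by blast
    then have "p \<in> U"
      by (auto simp: U_def V_def)
    then show ?thesis
      by blast
  qed
  moreover have "theta_fibre_smooth_of_pure_dim X K p (int N - 1 + int r - int k * int c)"
    if p: "p \<in> U" for p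
    unfolding theta_fibre_smooth_of_pure_dim_def
  proof (intro allI impI, elim conjE)
    fix i j e \<delta> x
    assume chart: "is_S_chart K i j e" and point: "H_point X K i j e x"
      and zero: "zero_of (theta_fibre_ideal X K p i j e \<delta>) x"
    define e' where "e' = (\<lambda>m. if m \<in># K then e m else 0)"
    have "e' \<in> E"
      unfolding E_def e'_def
    proof (intro CollectI allI conjI impI)
      fix m assume "m \<in># K"
      then have "e m \<le> size K"
        using chart order_trans[OF _ count_le_size[of K m]] by (auto simp: is_S_chart_def)
      then show "(if m \<in># K then e m else 0) \<in> {..size K}"
        by simp
    qed simp
    have ij: "i \<noteq> j"
      using chart by (simp add: is_S_chart_def)
    have "value_at p R = (\<Prod>((i, j, \<delta>), e)\<in>C. value_at p (Q i j e \<delta>))"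
      unfolding R_def value_at_prod by (rule prod.cong) auto
    moreover have "value_at p R \<noteq> 0"
      using p by (simp add: U_def)
    moreover have "((i, j, \<delta>), e') \<in> C"
      using \<open>e' \<in> E\<close> by (simp add: C_def)
    ultimately have "value_at p (Q i j e' \<delta>) \<noteq> 0"
      using prod_zero[OF finC, of "\<lambda>((i, j, \<delta>), e). value_at p (Q i j e \<delta>)"] by fastforce
    moreover have eq: "H_ideal X K i j e = H_ideal X K i j e'"
      "theta_fibre_ideal X K p i j e \<delta> = theta_fibre_ideal X K p i j e' \<delta>"
      by (rule chart_cong; simp add: e'_def)+
    ultimately have "p (base i j \<delta>) \<noteq> 0" and "\<And>w. \<exists>v. (\<forall>f\<in>H_ideal X K i j e. dir x v f = 0) \<and>
        (\<forall>l. l \<noteq> base i j \<delta> \<longrightarrow> dir x v (theta i j \<delta> l) = w l)"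
      using Q(3)[OF ij, of e' \<delta>] zero unfolding good_def by auto
    then show "smooth_at (bundle_coords K i j e) (theta_fibre_ideal X K p i j e \<delta>)
        (int N - 1 + int r - int k * int c) x"
      using theta_fibre_smooth_at[OF assms(1-3,5) chart point zero] unfolding base_def assms(7,8)
      by blast
  qed
  ultimately show ?thesis
    by blast
qed

end
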